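(* Let $g\in \mathrm{Sp}(n,1)$. Strong reversibility below means strong reversibility in $\mathrm{Sp}(n,1)$. \begin{enumerate} \item Let $g$ be hyperbolic. Then $g$ is strongly reversible if and only if every positive eigenvalue class of $g$ is either $\pm 1$ or of even multiplicity, and the null eigenvalues of $g$ are real numbers. \item Let $g$ be elliptic. Then $g$ is strongly reversible if and only if the eigenvalue of negative or indefinite type of $g$ is $1$ or $-1$ and every positive eigenvalue class of $g$ is either $\pm 1$ or of even multiplicity. \item Let $g$ be a vertical translation. Then $g$ is not strongly reversible. \item Let $g$ be a non-vertical translation. Then $g$ is strongly reversible. \item Let $g=g_sg_u$ be a non-unipotent parabolic element. Then $g$ is strongly reversible if and only if the null eigenvalue of $g$ is $1$ or $-1$, the minimal polynomial of $g_u$ is $(x-1)^3$, and every positive eigenvalue class of $g$ is either $\pm 1$ or of even multiplicity. \end{enumerate}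
   Context: Let $\mathbb{H}$ be the real quaternions and let $V=\mathbb{H}^{n+1}$ be the right $\mathbb{H}$-vector space with Hermitian form $\Phi(z,w)=-\bar z_0w_0+\bar z_1w_1+\cdots+\bar z_nw_n$. Put $J=\mathrm{diag}(-1,1,\ldots,1)$ and $\mathrm{Sp}(n,1)=\{g\in \mathrm{GL}(n+1,\mathbb{H})\mid {}^{t}\bar g J g=J\}$, the group preserving $\Phi$. An element $g$ of a group $G$ is strongly reversible if there is $x\in G$ with $x^2=1$ and $g^{-1}=xgx^{-1}$. Let $V_0,V_+,V_-$ be the sets of $v\in V$ with $\Phi(v,v)=0$, $>0$, $<0$ respectively, and let $\Pi:V\setminus\{0\}\to\mathbb{P}(V)$ be the projection to quaternionic projective space (where $u\sim v\lambda$, $\lambda\in\mathbb{H}\setminus\{0\}$). Quaternionic hyperbolic space is $\mathbf{H}^n_{\mathbb{H}}=\Pi(V_-)$, with boundary $\partial\mathbf{H}^n_{\mathbb{H}}=\Pi(V_0\setminus\{0\})$. Non-identity elements of $\mathrm{Sp}(n,1)$ fall into three disjoint classes: $g$ is elliptic if it has a fixed point in $\mathbf{H}^n_{\mathbb{H}}$; otherwise it is parabolic if it has exactly one fixed point on $\partial\mathbf{H}^n_{\mathbb{H}}$, and hyperbolic if it has exactly two fixed points on $\partial\mathbf{H}^n_{\mathbb{H}}$. Elliptic and hyperbolic elements are semisimple. A parabolic $g$ has a unique Jordan decomposition $g=g_sg_u=g_ug_s$ with $g_s$ semisimple (elliptic) and $g_u$ unipotent. A unipotent parabolic element with minimal polynomial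 $(x-1)^2$ is a vertical translation; one with minimal polynomial $(x-1)^3$ is a non-vertical translation. A quaternion $\lambda$ is an eigenvalue of $g$ if $gv=v\lambda$ for some $v\ne0$; eigenvalues occur in similarity classes $[\lambda]=\{\mu^{-1}\lambda\mu:\mu\in\mathbb{H}\setminus\{0\}\}$, called eigenvalue classes, and each class contains a unique pair of complex conjugate numbers. "The class is $\pm1$" means it is $\{1\}$ or $\{-1\}$. Let $V_\lambda=\{v\in V: gv=v\lambda\}$ be the $\lambda$-eigenspace. An eigenvalue $\lambda$ of $g$ is of positive type (resp. negative type) if every eigenvector in $V_\lambda$ lies in $V_+$ (resp. $V_-$); it is null if $V_\lambda$ is degenerate (the restriction of the Hermitian form to it is degenerate); it is of indefinite type if $V_\lambda$ contains vectors of $V_+$ and vectors of $V_-$. A class $[\lambda]$ is called null, positive or negative according to its representative $\lambda$. The multiplicity of a positive eigenvalue class $[\lambda]$ is the dimension over $\mathbb{H}$ of the right $\mathbb{H}$-span of $V_\lambda$, i.e. the number of times $[\lambda]$ is repeated in a diagonal form of $g$ on that span. *)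

theory Defs
  imports "HOL-Analysis.Analysis" "HOL-Computational_Algebra.Polynomial"
begin

section \<open>Quaternions\<close>

datatype quat = Quat (qRe: real) (qI: real) (qJ: real) (qK: real)

lemma quat_eq_iff:
  "x = y \<longleftrightarrow> qRe x = qRe y \<and> qI x = qI y \<and> qJ x = qJ y \<and> qK x = qK y"
  by (cases x; cases y) simp

instantiation quat :: ab_group_add
begin

definition zero_quat :: quat
  where "0 = Quat 0 0 0 0"

definition plus_quat :: "quat \<Rightarrow> quat \<Rightarrow> quat"
  where "x + y = Quat (qRe x + qRe y) (qI x + qI y) (qJ x + qJ y) (qK x + qK y)"

definition uminus_quat :: "quat \<Rightarrow> quat"
  where "- x = Quat (- qRe x) (- qI x) (- qJ x) (- qK x)"

definition minus_quat :: "quat \<Rightarrow> quat \<Rightarrow> quat"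
  where "x - y = Quat (qRe x - qRe y) (qI x - qI y) (qJ x - qJ y) (qK x - qK y)"

instance
  by standard
    (simp_all add: quat_eq_iff zero_quat_def plus_quat_def uminus_quat_def minus_quat_def)

end

instantiation quat :: real_vector
begin

definition scaleR_quat :: "real \<Rightarrow> quat \<Rightarrow> quat"
  where "r *\<^sub>R x = Quat (r * qRe x) (r * qI x) (r * qJ x) (r * qK x)"

instance
  by standard (simp_all add: quat_eq_iff plus_quat_def scaleR_quat_def algebra_simps)

end

instantiation quat :: real_algebra_1
begin

definition one_quat :: quat
  where "1 = Quat 1 0 0 0"

definition times_quat :: "quat \<Rightarrow> quat \<Rightarrow> quat"
  where "x * y = Quat
    (qRe x * qRe y - qI x * qI y - qJ x * qJ y - qK x * qK y)
    (qRe x * qI y + qI x * qRe y + qJ x * qK y - qK x * qJ y)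
    (qRe x * qJ y - qI x * qK y + qJ x * qRe y + qK x * qI y)
    (qRe x * qK y + qI x * qJ y - qJ x * qI y + qK x * qRe y)"

instance
  by standard
    (simp_all add: quat_eq_iff zero_quat_def one_quat_def plus_quat_def times_quat_def
      scaleR_quat_def algebra_simps)

end

definition qcnj :: "quat \<Rightarrow> quat"
  where "qcnj x = Quat (qRe x) (- qI x) (- qJ x) (- qK x)"

lemma qcnj_mult_self:
  "qcnj x * x = of_real ((qRe x)\<^sup>2 + (qI x)\<^sup>2 + (qJ x)\<^sup>2 + (qK x)\<^sup>2)"
  "x * qcnj x = of_real ((qRe x)\<^sup>2 + (qI x)\<^sup>2 + (qJ x)\<^sup>2 + (qK x)\<^sup>2)"
  by (simp_all add: of_real_def quat_eq_iff qcnj_def one_quat_def times_quat_def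
      scaleR_quat_def power2_eq_square)

lemma quat_normsq_eq_0_iff:
  "(qRe x)\<^sup>2 + (qI x)\<^sup>2 + (qJ x)\<^sup>2 + (qK x)\<^sup>2 = 0 \<longleftrightarrow> x = 0"
  by (simp add: quat_eq_iff zero_quat_def add_nonneg_eq_0_iff)

instantiation quat :: real_div_algebra
begin

definition inverse_quat :: "quat \<Rightarrow> quat"
  where "inverse x = inverse ((qRe x)\<^sup>2 + (qI x)\<^sup>2 + (qJ x)\<^sup>2 + (qK x)\<^sup>2) *\<^sub>R qcnj x"

definition divide_quat :: "quat \<Rightarrow> quat \<Rightarrow> quat"
  where "x div y = x * inverse (y :: quat)"

instance
proof
  fix x y :: quat
  show "inverse x * x = 1" "x * inverse x = 1" if "x \<noteq> 0"
    using that quat_normsq_eq_0_iff[of x]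
    by (simp_all add: inverse_quat_def qcnj_mult_self of_real_def)
  show "x div y = x * inverse y"
    by (simp add: divide_quat_def)
  show "inverse (0 :: quat) = 0"
    by (simp add: inverse_quat_def zero_quat_def qcnj_def scaleR_quat_def)
qed

end

section \<open>The right vector space and its Hermitian form\<close>

text \<open>
  Coordinates are indexed by a finite type \<open>'m\<close> with a distinguished element \<open>0\<close>, the index of the
  negative coordinate; thus \<open>n + 1 = CARD('m)\<close>. Matrices act on the left, scalars on the right.
  Beware that \<open>1\<close>, \<open>*\<close> and \<open>^\<close> on matrices are entrywise: the identity matrix is \<open>mat 1\<close> and the
  product is \<open>**\<close>.
\<close>

type_synonym 'm qvec = "(quat, 'm) vec"
type_synonym 'm qmat = "((quat, 'm) vec, 'm) vec"

definition rscale :: "('m::finite) qvec \<Rightarrow> quat \<Rightarrow> 'm qvec"  (infixl "*\<^sub>H" 75)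
  where "v *\<^sub>H a = (\<chi> i. v $ i * a)"

definition herm :: "('m::{finite,zero}) qvec \<Rightarrow> 'm qvec \<Rightarrow> quat"
  where "herm z w = - (qcnj (z $ 0) * w $ 0) + (\<Sum>i\<in>UNIV - {0}. qcnj (z $ i) * w $ i)"

lemma herm_self_real: "herm v v = of_real (qRe (herm v v))"
proof -
  have "herm v v \<in> \<real>"
    unfolding herm_def qcnj_mult_self
    by (intro Reals_add Reals_minus_iff[THEN iffD2] sum_in_Reals Reals_of_real)
  then obtain r where r: "herm v v = of_real r"
    by (rule Reals_cases)
  then show ?thesis
    by (simp add: of_real_def one_quat_def scaleR_quat_def)
qed

text \<open>By the lemma just proved, the sign of \<open>herm v v\<close> is the sign of its real part.\<close>

definition V_null :: "('m::{finite,zero}) qvec set"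
  where "V_null = {v. qRe (herm v v) = 0}"

definition V_pos :: "('m::{finite,zero}) qvec set"
  where "V_pos = {v. qRe (herm v v) > 0}"

definition V_neg :: "('m::{finite,zero}) qvec set"
  where "V_neg = {v. qRe (herm v v) < 0}"

definition hspan :: "('m::finite) qvec set \<Rightarrow> 'm qvec set"
  where "hspan S = {\<Sum>v\<in>T. v *\<^sub>H c v | T c. finite T \<and> T \<subseteq> S}"

definition hindependent :: "('m::finite) qvec set \<Rightarrow> bool"
  where "hindependent B \<longleftrightarrow>
    (\<forall>T c. finite T \<and> T \<subseteq> B \<and> (\<Sum>v\<in>T. v *\<^sub>H c v) = 0 \<longrightarrow> (\<forall>v\<in>T. c v = 0))"

text \<open>Dimension over the quaternions of the right span of a set, defined as in \<^const>\<open>dim\<close>.\<close>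

definition hdim :: "('m::finite) qvec set \<Rightarrow> nat"
  where "hdim S = card (SOME B. hindependent B \<and> hspan B = hspan S)"

section \<open>The group and strong reversibility\<close>

definition cnj_transpose :: "('m::finite) qmat \<Rightarrow> 'm qmat"
  where "cnj_transpose A = (\<chi> i j. qcnj (A $ j $ i))"

definition J_mat :: "('m::{finite,zero}) qmat"
  where "J_mat = (\<chi> i j. if i = j then (if i = 0 then -1 else 1) else 0)"

definition Sp_n1 :: "('m::{finite,zero}) qmat set"
  where "Sp_n1 = {g. invertible g \<and> cnj_transpose g ** J_mat ** g = J_mat}"

definition strongly_reversible_in :: "('m::finite) qmat set \<Rightarrow> 'm qmat \<Rightarrow> bool"
  where "strongly_reversible_in G g \<longleftrightarrow>
    (\<exists>x\<in>G. x ** x = mat 1 \<and> matrix_inv g = x ** g ** matrix_inv x)"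

section \<open>Quaternionic hyperbolic space and the classification of isometries\<close>

text \<open>A point of projective space is the set of nonzero right multiples of a nonzero vector.\<close>

definition proj_pt :: "('m::finite) qvec \<Rightarrow> 'm qvec set"
  where "proj_pt v = {v *\<^sub>H a | a. a \<noteq> 0}"

definition hyp_space :: "('m::{finite,zero}) qvec set set"
  where "hyp_space = proj_pt ` V_neg"

definition hyp_boundary :: "('m::{finite,zero}) qvec set set"
  where "hyp_boundary = proj_pt ` (V_null - {0})"

definition fixed_pts :: "('m::finite) qmat \<Rightarrow> 'm qvec set set \<Rightarrow> 'm qvec set set"
  where "fixed_pts g X = {p \<in> X. (\<lambda>v. g *v v) ` p = p}"

definition elliptic :: "('m::{finite,zero}) qmat \<Rightarrow> bool"
  where "elliptic g \<longleftrightarrow> g \<in> Sp_n1 \<and> g \<noteq> mat 1 \<and> fixed_pts g hyp_space \<noteq> {}"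

definition parabolic :: "('m::{finite,zero}) qmat \<Rightarrow> bool"
  where "parabolic g \<longleftrightarrow>
    g \<in> Sp_n1 \<and> g \<noteq> mat 1 \<and> fixed_pts g hyp_space = {} \<and> card (fixed_pts g hyp_boundary) = 1"

definition hyperbolic :: "('m::{finite,zero}) qmat \<Rightarrow> bool"
  where "hyperbolic g \<longleftrightarrow>
    g \<in> Sp_n1 \<and> g \<noteq> mat 1 \<and> fixed_pts g hyp_space = {} \<and> card (fixed_pts g hyp_boundary) = 2"

section \<open>Eigenvalues and their types\<close>

definition eigenspace :: "('m::finite) qmat \<Rightarrow> quat \<Rightarrow> 'm qvec set"
  where "eigenspace g a = {v. g *v v = v *\<^sub>H a}"

definition eigenvalue :: "('m::finite) qmat \<Rightarrow> quat \<Rightarrow> bool"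
  where "eigenvalue g a \<longleftrightarrow> (\<exists>v. v \<noteq> 0 \<and> g *v v = v *\<^sub>H a)"

definition sim_class :: "quat \<Rightarrow> quat set"
  where "sim_class a = {inverse u * a * u | u. u \<noteq> 0}"

definition degenerate_on :: "('m::{finite,zero}) qvec set \<Rightarrow> bool"
  where "degenerate_on W \<longleftrightarrow> (\<exists>v\<in>W. v \<noteq> 0 \<and> (\<forall>w\<in>W. herm v w = 0))"

text \<open>
  The type of an eigenvalue depends only on its similarity class, since
  \<open>eigenspace g (inverse u * a * u)\<close> is the image of \<open>eigenspace g a\<close> under \<open>\<lambda>v. v *\<^sub>H u\<close>. A
  condition on eigenvalue classes is therefore expressed by quantifying over all representatives.
\<close>

definition positive_type :: "('m::{finite,zero}) qmat \<Rightarrow> quat \<Rightarrow> bool"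
  where "positive_type g a \<longleftrightarrow> eigenvalue g a \<and> eigenspace g a - {0} \<subseteq> V_pos"

definition negative_type :: "('m::{finite,zero}) qmat \<Rightarrow> quat \<Rightarrow> bool"
  where "negative_type g a \<longleftrightarrow> eigenvalue g a \<and> eigenspace g a - {0} \<subseteq> V_neg"

definition indefinite_type :: "('m::{finite,zero}) qmat \<Rightarrow> quat \<Rightarrow> bool"
  where "indefinite_type g a \<longleftrightarrow>
    eigenvalue g a \<and> eigenspace g a \<inter> V_pos \<noteq> {} \<and> eigenspace g a \<inter> V_neg \<noteq> {}"

definition null_type :: "('m::{finite,zero}) qmat \<Rightarrow> quat \<Rightarrow> bool"
  where "null_type g a \<longleftrightarrow> eigenvalue g a \<and> degenerate_on (eigenspace g a)"

text \<open>
  For non-real \<open>a\<close> the set \<open>eigenspace g a\<close> is not closed under right scalar multiplication, hence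
  the span.
\<close>

definition class_multiplicity :: "('m::finite) qmat \<Rightarrow> quat \<Rightarrow> nat"
  where "class_multiplicity g a = hdim (hspan (eigenspace g a))"

section \<open>Jordan decomposition and minimal polynomials\<close>

primrec mat_pow :: "('m::finite) qmat \<Rightarrow> nat \<Rightarrow> 'm qmat"
  where
    "mat_pow A 0 = mat 1"
  | "mat_pow A (Suc k) = A ** mat_pow A k"

text \<open>Minimal polynomials are taken over the reals, the centre of the quaternions.\<close>

definition poly_mat :: "real poly \<Rightarrow> ('m::finite) qmat \<Rightarrow> 'm qmat"
  where "poly_mat p A = (\<Sum>i\<le>degree p. coeff p i *\<^sub>R mat_pow A i)"

definition is_min_poly :: "('m::finite) qmat \<Rightarrow> real poly \<Rightarrow> bool"
  where "is_min_poly A p \<longleftrightarrow>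
    lead_coeff p = 1 \<and> poly_mat p A = 0 \<and>
    (\<forall>q. q \<noteq> 0 \<and> poly_mat q A = 0 \<longrightarrow> degree p \<le> degree q)"

definition unipotent :: "('m::finite) qmat \<Rightarrow> bool"
  where "unipotent A \<longleftrightarrow> (\<exists>k. mat_pow (A - mat 1) k = 0)"

text \<open>Semisimple means diagonalizable: the eigenvectors span the whole space.\<close>

definition semisimple :: "('m::finite) qmat \<Rightarrow> bool"
  where "semisimple A \<longleftrightarrow> hspan {v. \<exists>a. v \<in> eigenspace A a} = UNIV"

definition jordan_decomposition ::
    "('m::{finite,zero}) qmat \<Rightarrow> 'm qmat \<Rightarrow> 'm qmat \<Rightarrow> bool"
  where "jordan_decomposition g gs gu \<longleftrightarrow>
    gs \<in> Sp_n1 \<and> gu \<in> Sp_n1 \<and> g = gs ** gu \<and> g = gu ** gs \<and> semisimple gs \<and> unipotent gu"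

definition vertical_translation :: "('m::{finite,zero}) qmat \<Rightarrow> bool"
  where "vertical_translation g \<longleftrightarrow> parabolic g \<and> unipotent g \<and> is_min_poly g ([:-1, 1:] ^ 2)"

definition nonvertical_translation :: "('m::{finite,zero}) qmat \<Rightarrow> bool"
  where "nonvertical_translation g \<longleftrightarrow> parabolic g \<and> unipotent g \<and> is_min_poly g ([:-1, 1:] ^ 3)"

end

theory Submission
  imports Defs "HOL-Computational_Algebra.Fundamental_Theorem_Algebra"
begin

text \<open>
  An involution \<open>x\<close> with \<open>x g x = g\<^sup>-\<^sup>1\<close> is self-adjoint for \<open>\<Phi>\<close> and maps the eigenspace
  \<open>V\<^sub>a\<close> to the eigenspace of \<open>a\<^sup>-\<^sup>1\<close>. For a
  unit \<open>a\<close> that is not real, choose a unit \<open>u\<close> with \<open>u\<^sup>2 = -1\<close> and \<open>u\<^sup>-\<^sup>1 a u = a\<^sup>-\<^sup>1\<close>; then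
  \<open>T v = x v u\<close> maps \<open>V\<^sub>a\<close> to itself with \<open>T\<^sup>2 = -1\<close> and \<open>\<Phi>(v, T v) = 0\<close>. So a positive class
  has even multiplicity, and \<open>V\<^sub>a\<close> contains no negative vector, because \<open>v\<close> and \<open>T v\<close> would be two
  orthogonal ones. If \<open>v \<in> V\<^sub>a\<close> is null, then \<open>\<Phi>(v, x v)\<close> is real, and comparing it with
  \<open>\<Phi>(g v, g x v)\<close> shows that \<open>a\<close> is real.

  Conversely, \<open>V\<close> is decomposed orthogonally into \<open>g\<close>-invariant pieces on each of which a
  reflection or the identity reverses \<open>g\<close>: one nondegenerate piece containing a negative vector (a
  negative eigenline, a hyperbolic plane, or the span of \<open>v\<close>, \<open>X v\<close>, \<open>X\<^sup>2 v\<close> with \<open>X\<close> the logarithm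
  of the unipotent part), and inside its positive definite complement pairs of orthonormal vectors
  of a common eigenspace, or single eigenvectors with eigenvalue \<open>1\<close> or \<open>-1\<close>.
\<close>

section \<open>Quaternions\<close>

text \<open>The single negative coordinate acts through one fact: orthogonal vectors that are both
  null or negative are proportional. It bounds the Jordan structure, since
  \<open>(gu - 1)^3 = 0\<close> for every unipotent isometry \<open>gu\<close>, and so leaves blocks
  of size two and three. In a block of size three the middle vector \<open>X v\<close> is positive,
  and the reflection in it changes the sign of \<open>X\<close>. A block of size two offers no such
  vector: a reversing involution acts by a sign \<open>c\<close> on its null line, hence by
  \<open>-c\<close> on the top vector modulo eigenvectors, and this contradicts self-adjointness.
  Null eigenvalues may be any reals for hyperbolic \<open>g\<close> but only \<open>1\<close> and
  \<open>-1\<close> for parabolic \<open>g\<close>, because the involution can exchange two fixed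
  boundary points, whereas it must preserve a single one. The obstacle in the converse is that
  evenness concerns a whole eigenvalue class, while the pieces are split off successively; no step
  may cut a non-real eigenspace in two.\<close>

lemmas quat_simps = quat_eq_iff zero_quat_def one_quat_def plus_quat_def minus_quat_def
  uminus_quat_def times_quat_def scaleR_quat_def qcnj_def of_real_def

lemma qcnj_add [simp]: "qcnj (x + y) = qcnj x + qcnj y"
  and qcnj_diff [simp]: "qcnj (x - y) = qcnj x - qcnj y"
  and qcnj_minus [simp]: "qcnj (- x) = - qcnj x"
  and qcnj_mult [simp]: "qcnj (x * y) = qcnj y * qcnj x"
  and qcnj_qcnj [simp]: "qcnj (qcnj x) = x"
  and qcnj_0 [simp]: "qcnj 0 = 0"
  and qcnj_1 [simp]: "qcnj 1 = 1"
  and qcnj_of_real [simp]: "qcnj (of_real r) = of_real r"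
  and qcnj_scaleR [simp]: "qcnj (r *\<^sub>R x) = r *\<^sub>R qcnj x"
  by (simp_all add: quat_simps algebra_simps)

lemma qRe_simps [simp]:
  "qRe 0 = 0" "qRe 1 = 1" "qRe (x + y) = qRe x + qRe y" "qRe (x - y) = qRe x - qRe y"
  "qRe (- x) = - qRe x" "qRe (r *\<^sub>R x) = r * qRe x" "qRe (of_real r) = r" "qRe (qcnj x) = qRe x"
  by (simp_all add: quat_simps)

lemma qRe_numeral [simp]: "qRe (numeral k) = numeral k"
  by (metis of_real_numeral qRe_simps(7))

lemma qRe_sum: "qRe (sum f S) = (\<Sum>i\<in>S. qRe (f i))"
  by (induction S rule: infinite_finite_induct) auto

lemma qcnj_sum: "qcnj (sum f S) = (\<Sum>i\<in>S. qcnj (f i))"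
  by (induction S rule: infinite_finite_induct) auto

definition qnormsq :: "quat \<Rightarrow> real"
  where "qnormsq x = (qRe x)\<^sup>2 + (qI x)\<^sup>2 + (qJ x)\<^sup>2 + (qK x)\<^sup>2"

lemma qcnj_mult_self_qnormsq: "qcnj x * x = of_real (qnormsq x)" "x * qcnj x = of_real (qnormsq x)"
  by (simp_all add: qcnj_mult_self qnormsq_def)

lemma qnormsq_ge_0 [simp]: "qnormsq x \<ge> 0"
  by (simp add: qnormsq_def)

lemma qnormsq_eq_0_iff [simp]: "qnormsq x = 0 \<longleftrightarrow> x = 0"
  by (simp add: qnormsq_def quat_normsq_eq_0_iff)

lemma qnormsq_pos: "x \<noteq> 0 \<Longrightarrow> qnormsq x > 0"
  by (metis qnormsq_eq_0_iff qnormsq_ge_0 order_less_le)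

lemma of_real_quat_commute: "of_real r * x = x * (of_real r :: quat)"
  by (simp add: quat_simps)

lemma qnormsq_mult: "qnormsq (x * y) = qnormsq x * qnormsq y"
  by (simp add: qnormsq_def times_quat_def power2_eq_square algebra_simps)

lemma qnormsq_1 [simp]: "qnormsq 1 = 1"
  and qnormsq_qcnj [simp]: "qnormsq (qcnj x) = qnormsq x"
  and qnormsq_minus [simp]: "qnormsq (- x) = qnormsq x"
  and qnormsq_of_real [simp]: "qnormsq (of_real r) = r\<^sup>2"
  by (simp_all add: qnormsq_def quat_simps)

lemma quat_Reals_iff: "x \<in> \<real> \<longleftrightarrow> qI x = 0 \<and> qJ x = 0 \<and> qK x = 0"
proof
  assume "qI x = 0 \<and> qJ x = 0 \<and> qK x = 0"
  then have "x = of_real (qRe x)"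
    by (simp add: quat_simps)
  then show "x \<in> \<real>"
    by (metis Reals_of_real)
qed (auto simp: Reals_def quat_simps)

lemma qcnj_fixed_iff: "qcnj x = x \<longleftrightarrow> x \<in> \<real>"
  by (auto simp: quat_Reals_iff quat_simps)

lemma quat_real_eq: "x \<in> \<real> \<Longrightarrow> x = of_real (qRe x)"
  by (auto simp: Reals_def)

lemma quat_square_eq_1: "x * x = 1 \<Longrightarrow> x = 1 \<or> x = (-1::quat)"
  by (metis mult.right_neutral mult_minus_left right_minus_eq square_diff_one_factored
      mult_eq_0_iff eq_neg_iff_add_eq_0)

lemma quat_real_unit: "\<lbrakk>x \<in> \<real>; qnormsq x = 1\<rbrakk> \<Longrightarrow> x = 1 \<or> x = -1"
  by (auto simp: Reals_def power2_eq_1_iff)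

lemma qcnj_unit: "qnormsq a = 1 \<Longrightarrow> qcnj a * a = 1" "qnormsq a = 1 \<Longrightarrow> a * qcnj a = 1"
  by (simp_all add: qcnj_mult_self_qnormsq)

lemma inverse_unit_quat: "qnormsq a = 1 \<Longrightarrow> inverse a = qcnj a"
  by (metis qcnj_unit(2) inverse_unique)

text \<open>An imaginary unit \<open>u\<close> anticommutes with every imaginary quaternion
  orthogonal to it in 3-space and commutes with reals, so it conjugates \<open>a\<close> to
  \<open>qcnj a\<close> as soon as it is orthogonal to the imaginary part of \<open>a\<close>. The
  witness is a quarter turn of the projection of that part to the first two coordinates, normalized;
  if the projection vanishes, the first basis vector is orthogonal already.\<close>

lemma exists_conjugating_unit:
  obtains u where "u * u = -1" "qcnj u = - u" "qnormsq u = 1" "u * a = qcnj a * u" "a * u = u * qcnj a"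
proof -
  obtain b c d where bcd: "b\<^sup>2 + c\<^sup>2 + d\<^sup>2 = 1" "b * qI a + c * qJ a + d * qK a = 0"
  proof (cases "qI a = 0 \<and> qJ a = 0")
    case True
    then show ?thesis
      using that[of 1 0 0] by simp
  next
    case False
    define s where "s = sqrt ((qI a)\<^sup>2 + (qJ a)\<^sup>2)"
    have s2: "s\<^sup>2 = (qI a)\<^sup>2 + (qJ a)\<^sup>2"
      by (simp add: s_def)
    have "s \<noteq> 0"
      using False by (simp add: s_def sum_power2_eq_zero_iff)
    then have "(- qJ a / s)\<^sup>2 + (qI a / s)\<^sup>2 + 0\<^sup>2 = 1"
      using s2 False by (simp add: power_divide add.commute sum_power2_eq_zero_iff flip: add_divide_distrib)
    then show ?thesis
      by (rule that) simp
  qed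
  show ?thesis
    by (rule that[of "Quat 0 b c d"])
      (use bcd in \<open>simp_all add: quat_simps qnormsq_def power2_eq_square algebra_simps\<close>)
qed

text \<open>A commutative subfield over which polynomials split; it lets complex polynomials act on
  vectors with their coefficients on the right.\<close>

definition quat_of_complex :: "complex \<Rightarrow> quat"
  where "quat_of_complex z = Quat (Re z) (Im z) 0 0"

lemma quat_of_complex_simps [simp]:
  "quat_of_complex 0 = 0"
  "quat_of_complex (z + w) = quat_of_complex z + quat_of_complex w"
  "quat_of_complex (z - w) = quat_of_complex z - quat_of_complex w"
  "quat_of_complex (- z) = - quat_of_complex z" "quat_of_complex (of_real r) = of_real r"
  "quat_of_complex (z * w) = quat_of_complex z * quat_of_complex w"
  by (simp_all add: quat_of_complex_def quat_simps)

lemma quat_of_complex_eq_0_iff [simp]: "quat_of_complex z = 0 \<longleftrightarrow> z = 0"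
  by (simp add: quat_of_complex_def zero_quat_def complex_eq_iff)

section \<open>The right vector space and the Hermitian form\<close>

lemma rscale_simps [simp]: "v *\<^sub>H 1 = v" "v *\<^sub>H 0 = 0" "0 *\<^sub>H a = 0" "v *\<^sub>H (- a) = - (v *\<^sub>H a)"
  "(- v) *\<^sub>H a = - (v *\<^sub>H a)" "(v *\<^sub>H a) *\<^sub>H b = v *\<^sub>H (a * b)" "(v *\<^sub>H a) $ i = v $ i * a"
  by (simp_all add: rscale_def vec_eq_iff mult.assoc)

lemma rscale_algebra: "(v + w) *\<^sub>H a = v *\<^sub>H a + w *\<^sub>H a" "(v - w) *\<^sub>H a = v *\<^sub>H a - w *\<^sub>H a"
  "v *\<^sub>H (a + b) = v *\<^sub>H a + v *\<^sub>H b" "v *\<^sub>H (a - b) = v *\<^sub>H a - v *\<^sub>H b"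
  by (simp_all add: rscale_def vec_eq_iff algebra_simps)

lemma rscale_sum: "(\<Sum>i\<in>S. f i) *\<^sub>H a = (\<Sum>i\<in>S. f i *\<^sub>H a)"
  by (induction S rule: infinite_finite_induct) (auto simp: rscale_algebra)

lemma rscale_sum_right: "v *\<^sub>H (\<Sum>i\<in>S. f i) = (\<Sum>i\<in>S. v *\<^sub>H f i)"
  by (induction S rule: infinite_finite_induct) (auto simp: rscale_algebra)

lemma rscale_of_real: "v *\<^sub>H of_real r = r *\<^sub>R v"
  by (simp add: rscale_def vec_eq_iff scaleR_conv_of_real[where 'a = quat] of_real_quat_commute)

lemma rscale_scaleR: "v *\<^sub>H (r *\<^sub>R a) = r *\<^sub>R (v *\<^sub>H a)" "(r *\<^sub>R v) *\<^sub>H a = r *\<^sub>R (v *\<^sub>H a)"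
  by (simp_all add: rscale_def vec_eq_iff)

lemma rscale_eq_0_iff [simp]: "v *\<^sub>H a = 0 \<longleftrightarrow> v = 0 \<or> a = 0"
  by (auto simp: rscale_def vec_eq_iff)

lemma mult_vec_rscale: "(A::'m::finite qmat) *v (v *\<^sub>H a) = (A *v v) *\<^sub>H a"
  by (simp add: rscale_def vec_eq_iff matrix_vector_mult_def sum_distrib_right mult.assoc)

lemma mult_vec_minus: "(A::'m::finite qmat) *v (- v) = - (A *v v)"
  by (simp add: vec_eq_iff matrix_vector_mult_def sum_negf)

lemma mult_vec_scaleR: "(A::'m::finite qmat) *v (r *\<^sub>R v) = r *\<^sub>R (A *v v)"
  by (simp add: vec_eq_iff matrix_vector_mult_def scaleR_sum_right)

lemmas mult_vec_algebra = matrix_vector_right_distrib matrix_vector_mult_diff_distrib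
  mult_vec_rscale mult_vec_minus

lemma mult_vec_sum: "(A::'m::finite qmat) *v (\<Sum>i\<in>S. f i) = (\<Sum>i\<in>S. A *v f i)"
  by (induction S rule: infinite_finite_induct) (auto simp: matrix_vector_right_distrib)

lemma vec_eq_sum_axis: "v = (\<Sum>j\<in>UNIV. axis j 1 *\<^sub>H (v $ j))" for v :: "'m::finite qvec"
  by (simp add: vec_eq_iff axis_def if_distrib[of "\<lambda>x. x * _"] cong: if_cong)

lemma exists_matrix_of_hlinear:
  fixes f :: "'m::finite qvec \<Rightarrow> 'm qvec"
  assumes add: "\<And>v w. f (v + w) = f v + f w" and scale: "\<And>v a. f (v *\<^sub>H a) = f v *\<^sub>H a"
  obtains A :: "'m qmat" where "\<And>v. A *v v = f v"
proof
  have f0: "f 0 = 0"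
    using scale[of 0 0] by simp
  have fsum: "f (sum h S) = (\<Sum>i\<in>S. f (h i))" for h :: "'m \<Rightarrow> 'm qvec" and S
    by (induction S rule: infinite_finite_induct) (auto simp: f0 add)
  show "(\<chi> i j. f (axis j 1) $ i) *v v = f v" for v
    by (subst (2) vec_eq_sum_axis) (simp add: fsum scale vec_eq_iff matrix_vector_mult_def)
qed

lemma herm_add [simp]: "herm (v + w) z = herm v z + herm w z" "herm z (v + w) = herm z v + herm z w"
  by (simp_all add: herm_def algebra_simps sum.distrib)

lemma herm_diff [simp]: "herm (v - w) z = herm v z - herm w z" "herm z (v - w) = herm z v - herm z w"
  by (simp_all add: herm_def algebra_simps sum_subtractf)

lemma herm_minus [simp]: "herm (- v) z = - herm v z" "herm z (- v) = - herm z v"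
  by (simp_all add: herm_def algebra_simps sum_negf)

lemma herm_0 [simp]: "herm 0 z = 0" "herm z 0 = 0"
  by (simp_all add: herm_def)

lemma herm_rscale [simp]: "herm (v *\<^sub>H a) w = qcnj a * herm v w" "herm v (w *\<^sub>H a) = herm v w * a"
  by (simp_all add: herm_def algebra_simps sum_distrib_left sum_distrib_right)

lemma herm_scaleR [simp]: "herm (r *\<^sub>R v) w = r *\<^sub>R herm v w" "herm v (r *\<^sub>R w) = r *\<^sub>R herm v w"
  by (simp_all add: herm_def algebra_simps scaleR_sum_right)

lemma herm_sum: "herm (\<Sum>i\<in>S. f i) w = (\<Sum>i\<in>S. herm (f i) w)" "herm w (\<Sum>i\<in>S. f i) = (\<Sum>i\<in>S. herm w (f i))"
  by (induction S rule: infinite_finite_induct; simp)+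

lemma herm_commute: "herm w v = qcnj (herm v w)"
  by (simp add: herm_def qcnj_sum)

lemma herm_eq_0_commute: "herm w v = 0 \<longleftrightarrow> herm v w = 0"
  by (metis herm_commute qcnj_0)

lemma herm_axis: "herm (axis i 1) v = (if i = 0 then - v $ i else v $ i)"
proof -
  have *: "qcnj (axis i 1 $ j) * v $ j = (if j = i then v $ i else 0)" for j
    by (simp add: axis_def)
  show ?thesis
    unfolding herm_def * by (cases "i = 0") (simp_all add: if_distrib cong: if_cong)
qed

lemma herm_nondegenerate: "(\<And>w. herm w v = 0) \<Longrightarrow> v = 0"
  by (metis herm_axis vec_eq_iff zero_index neg_equal_0_iff_equal)

lemma herm_self_eq_0_iff: "herm v v = 0 \<longleftrightarrow> qRe (herm v v) = 0"
  by (metis herm_self_real of_real_0 qRe_simps(1))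

lemma qRe_herm_rscale: "qRe (herm (v *\<^sub>H a) (v *\<^sub>H a)) = qnormsq a * qRe (herm v v)"
proof -
  have "herm (v *\<^sub>H a) (v *\<^sub>H a) = qcnj a * (of_real (qRe (herm v v)) * a)"
    using herm_self_real[of v] by (simp add: mult.assoc)
  also have "\<dots> = of_real (qnormsq a) * of_real (qRe (herm v v))"
    by (simp add: of_real_quat_commute[of _ a] qcnj_mult_self_qnormsq flip: mult.assoc)
  finally show ?thesis
    by (metis of_real_mult qRe_simps(7))
qed

text \<open>The signature \<open>(n, 1)\<close> enters only here: some multiple of \<open>v\<close> has the same negative coordinate
  as \<open>w\<close>, and vectors without negative coordinate are positive.\<close>

lemma orthogonal_nonpositive_proportional:
  fixes v w :: "'m::{finite,zero} qvec"
  assumes "v \<noteq> 0" "qRe (herm v v) \<le> 0" "herm v w = 0" "qRe (herm w w) \<le> 0"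
  obtains c where "w = v *\<^sub>H c"
proof -
  have pos: "u = 0" if "u $ 0 = 0" "qRe (herm u u) \<le> 0" for u :: "'m qvec"
  proof -
    have "qRe (herm u u) = (\<Sum>i\<in>UNIV - {0}. qnormsq (u $ i))"
      using that(1) by (simp add: herm_def qRe_sum qcnj_mult_self_qnormsq)
    moreover have "(\<Sum>i\<in>UNIV - {0}. qnormsq (u $ i)) \<ge> 0"
      by (intro sum_nonneg) simp
    ultimately have "(\<Sum>i\<in>UNIV - {0}. qnormsq (u $ i)) = 0"
      using that(2) by linarith
    then have "\<forall>i\<in>UNIV - {0}. qnormsq (u $ i) = 0"
      by (subst (asm) sum_nonneg_eq_0_iff) auto
    then show "u = 0"
      using that(1) by (metis DiffI UNIV_I qnormsq_eq_0_iff singletonD vec_eq_iff zero_index)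
  qed
  have v0: "v $ 0 \<noteq> 0"
    using pos assms(1,2) by blast
  define c where "c = inverse (v $ 0) * w $ 0"
  have c: "herm w v = 0"
    using assms(3) herm_eq_0_commute by blast
  have "(w - v *\<^sub>H c) $ 0 = 0"
    using v0 by (simp add: c_def flip: mult.assoc)
  moreover have "herm (w - v *\<^sub>H c) (w - v *\<^sub>H c) = herm w w + herm (v *\<^sub>H c) (v *\<^sub>H c)"
    using assms(3) c by simp
  then have "qRe (herm (w - v *\<^sub>H c) (w - v *\<^sub>H c)) \<le> 0"
    using assms(2,4) qRe_herm_rscale[of v c] mult_nonneg_nonpos[OF qnormsq_ge_0[of c] assms(2)]
    by (metis add_nonpos_nonpos qRe_simps(3))
  ultimately have "w - v *\<^sub>H c = 0"
    by (rule pos)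
  with that show ?thesis
    by (metis right_minus_eq)
qed

text \<open>A nonpositive \<open>w\<close> would be a nonzero multiple of \<open>v\<close>, which is
  not orthogonal to \<open>v\<close>. Hence the complement of any piece containing a negative vector
  is positive definite.\<close>

lemma orthogonal_to_negative_pos:
  assumes "qRe (herm v v) < 0" "herm v w = 0" "w \<noteq> 0"
  shows "qRe (herm w w) > 0"
proof (rule ccontr)
  assume "\<not> ?thesis"
  then obtain c where c: "w = v *\<^sub>H c"
    using orthogonal_nonpositive_proportional[of v w] assms by force
  with assms have "herm v v * c = 0" "c \<noteq> 0"
    by auto
  then show False
    using assms(1) by auto
qed

section \<open>Isometries\<close>

text \<open>The definite standard form. Its adjoint is \<open>cnj_transpose\<close>, so it
  translates the matrix equation in \<open>Sp_n1\<close> into invariance of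
  \<open>herm\<close>.\<close>

definition hdot :: "'m::finite qvec \<Rightarrow> 'm qvec \<Rightarrow> quat"
  where "hdot v w = (\<Sum>i\<in>UNIV. qcnj (v $ i) * w $ i)"

lemma hdot_mult_vec: "hdot (A *v v) w = hdot v (cnj_transpose A *v w)"
proof -
  have "hdot (A *v v) w = (\<Sum>i\<in>UNIV. \<Sum>j\<in>UNIV. qcnj (v $ j) * (qcnj (A $ i $ j) * w $ i))"
    by (simp add: hdot_def matrix_vector_mult_def qcnj_sum sum_distrib_right mult.assoc)
  also have "\<dots> = (\<Sum>j\<in>UNIV. \<Sum>i\<in>UNIV. qcnj (v $ j) * (qcnj (A $ i $ j) * w $ i))"
    by (rule sum.swap)
  also have "\<dots> = hdot v (cnj_transpose A *v w)"
    by (simp add: hdot_def matrix_vector_mult_def cnj_transpose_def sum_distrib_left)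
  finally show ?thesis .
qed

lemma hdot_axis: "hdot (axis i 1) w = w $ i"
proof -
  have *: "qcnj (axis i 1 $ j) * w $ j = (if j = i then w $ i else 0)" for j
    by (simp add: axis_def)
  show ?thesis
    unfolding hdot_def * by simp
qed

lemma herm_eq_hdot: "herm v w = hdot v (J_mat *v w)"
proof -
  have J: "(J_mat *v w) $ i = (if i = 0 then - w $ 0 else w $ i)" for i
    by (simp add: J_mat_def matrix_vector_mult_def if_distrib[of "\<lambda>x. x * _"] cong: if_cong)
  have "hdot v (J_mat *v w) = qcnj (v $ 0) * (J_mat *v w) $ 0
      + (\<Sum>i\<in>UNIV - {0}. qcnj (v $ i) * (J_mat *v w) $ i)"
    unfolding hdot_def by (rule sum.remove) auto
  then show ?thesis
    by (simp add: J herm_def)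
qed

lemma Sp_n1_herm: "g \<in> Sp_n1 \<Longrightarrow> herm (g *v v) (g *v w) = herm v w"
  by (simp add: herm_eq_hdot hdot_mult_vec Sp_n1_def matrix_vector_mul_assoc)
    (simp flip: matrix_mul_assoc)

lemma Sp_n1I:
  assumes "invertible g" and "\<And>v w. herm (g *v v) (g *v w) = herm v w"
  shows "g \<in> Sp_n1"
proof -
  have "((cnj_transpose g ** J_mat ** g) *v w) $ i = (J_mat *v w) $ i" for w i
    using assms(2)[of "axis i 1" w]
    by (simp add: herm_eq_hdot hdot_mult_vec hdot_axis matrix_vector_mul_assoc matrix_mul_assoc)
  then show ?thesis
    using assms(1) by (simp add: Sp_n1_def matrix_eq vec_eq_iff)
qed

lemma mat_1_in_Sp_n1: "mat 1 \<in> Sp_n1"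
  by (rule Sp_n1I) (auto simp: invertible_def intro: exI[of _ "mat 1"])

section \<open>Inverses, products and reflections in the isometry group\<close>

lemma matrix_inv_eqI:
  fixes A B :: "'m::finite qmat"
  assumes "A ** B = mat 1" "B ** A = mat 1"
  shows "matrix_inv A = B"
proof -
  have "\<exists>A'. A ** A' = mat 1 \<and> A' ** A = mat 1"
    using assms by blast
  then have "A ** matrix_inv A = mat 1 \<and> matrix_inv A ** A = mat 1"
    unfolding matrix_inv_def by (rule someI_ex)
  then show ?thesis
    by (metis assms matrix_mul_assoc matrix_mul_lid matrix_mul_rid)
qed

lemma matrix_inv_mult:
  fixes A :: "'m::finite qmat"
  assumes "invertible A"
  shows "A ** matrix_inv A = mat 1" "matrix_inv A ** A = mat 1"
  using assms matrix_inv_eqI unfolding invertible_def by metis+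

lemma Sp_n1_inv_cancel:
  assumes "g \<in> Sp_n1"
  shows "g *v (matrix_inv g *v v) = v" "matrix_inv g *v (g *v v) = v"
  using assms matrix_inv_mult[of g] by (auto simp: Sp_n1_def matrix_vector_mul_assoc)

lemma Sp_n1_mult_vec_eq_iff: "g \<in> Sp_n1 \<Longrightarrow> g *v v = g *v w \<longleftrightarrow> v = w"
  by (metis Sp_n1_inv_cancel(2))

lemma Sp_n1_mult_vec_eq_0_iff: "g \<in> Sp_n1 \<Longrightarrow> g *v v = 0 \<longleftrightarrow> v = 0"
  by (metis Sp_n1_mult_vec_eq_iff matrix_vector_mult_0_right)

lemma Sp_n1_mult:
  assumes "g \<in> Sp_n1" "h \<in> Sp_n1"
  shows "g ** h \<in> Sp_n1"
proof (rule Sp_n1I)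
  have "(g ** h) ** (matrix_inv h ** matrix_inv g) = g ** (h ** matrix_inv h) ** matrix_inv g"
    by (simp add: matrix_mul_assoc)
  moreover have "(matrix_inv h ** matrix_inv g) ** (g ** h) = matrix_inv h ** (matrix_inv g ** g) ** h"
    by (simp add: matrix_mul_assoc)
  ultimately show "invertible (g ** h)"
    using assms matrix_inv_mult[of g] matrix_inv_mult[of h]
    unfolding invertible_def Sp_n1_def by auto
  show "herm ((g ** h) *v v) ((g ** h) *v w) = herm v w" for v w
    using assms by (simp add: Sp_n1_herm flip: matrix_vector_mul_assoc)
qed

lemma exists_reflection:
  fixes r :: "'m::{finite,zero} qvec"
  assumes r: "qRe (herm r r) = d" "d \<noteq> 0"
  obtains x where "x \<in> Sp_n1" "x ** x = mat 1"
    "\<And>v. x *v v = v - r *\<^sub>H ((2 / d) *\<^sub>R herm r v)"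
proof -
  define f where "f v = v - r *\<^sub>H ((2 / d) *\<^sub>R herm r v)" for v
  have hrr: "herm r r = of_real d"
    using r herm_self_real by metis
  obtain x where x: "\<And>v. x *v v = f v"
    by (rule exists_matrix_of_hlinear[of f])
      (auto simp: f_def rscale_algebra algebra_simps)
  have fr: "herm r (f v) = - herm r v" for v
    using r(2) by (simp add: f_def hrr of_real_def scaleR_2)
  have ff: "f (f v) = v" for v
    unfolding f_def[of "f v"] fr by (simp add: f_def)
  have xx: "x ** x = mat 1"
    by (simp add: matrix_eq x ff flip: matrix_vector_mul_assoc)
  have "herm (f v) (f w) = herm v w" for v w
  proof -
    have "herm (f v) (f w) = herm v (f w) - ((2 / d) *\<^sub>R qcnj (herm r v)) * herm r (f w)"
      by (simp add: f_def[of v])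
    also have "\<dots> = herm v (f w) + ((2 / d) *\<^sub>R qcnj (herm r v)) * herm r w"
      by (simp add: fr)
    also have "\<dots> = herm v w"
      by (simp add: f_def herm_commute[of r v])
    finally show ?thesis .
  qed
  then have "x \<in> Sp_n1"
    using xx by (intro Sp_n1I) (auto simp: x invertible_def)
  with xx x that show ?thesis
    by (simp add: f_def)
qed

section \<open>Subspaces and orthonormal sets\<close>

definition hsubspace :: "'m::finite qvec set \<Rightarrow> bool"
  where "hsubspace W \<longleftrightarrow> 0 \<in> W \<and> (\<forall>v\<in>W. \<forall>w\<in>W. v + w \<in> W) \<and> (\<forall>v\<in>W. \<forall>a. v *\<^sub>H a \<in> W)"

lemma hsubspaceD:
  assumes "hsubspace W"
  shows "0 \<in> W" "v \<in> W \<Longrightarrow> w \<in> W \<Longrightarrow> v + w \<in> W" "v \<in> W \<Longrightarrow> v *\<^sub>H a \<in> W"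
    "v \<in> W \<Longrightarrow> - v \<in> W" "v \<in> W \<Longrightarrow> w \<in> W \<Longrightarrow> v - w \<in> W" "v \<in> W \<Longrightarrow> r *\<^sub>R v \<in> W"
proof -
  show *: "0 \<in> W" "v \<in> W \<Longrightarrow> w \<in> W \<Longrightarrow> v + w \<in> W" "v \<in> W \<Longrightarrow> v *\<^sub>H a \<in> W" for v w a
    using assms by (auto simp: hsubspace_def)
  show neg: "v \<in> W \<Longrightarrow> - v \<in> W" for v
    using *(3)[of v "-1"] by simp
  show "v \<in> W \<Longrightarrow> w \<in> W \<Longrightarrow> v - w \<in> W"
    using *(2)[OF _ neg, of v w] by simp
  show "v \<in> W \<Longrightarrow> r *\<^sub>R v \<in> W"
    using *(3)[of v "of_real r"] by (simp add: rscale_of_real)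
qed

lemma hsubspace_sum: "hsubspace W \<Longrightarrow> (\<And>i. i \<in> S \<Longrightarrow> f i \<in> W) \<Longrightarrow> sum f S \<in> W"
  by (induction S rule: infinite_finite_induct) (auto simp: hsubspaceD)

lemma hspan_minimal: "S \<subseteq> W \<Longrightarrow> hsubspace W \<Longrightarrow> hspan S \<subseteq> W"
  by (auto simp: hspan_def intro!: hsubspace_sum hsubspaceD(3))

lemma hspan_superset: "S \<subseteq> hspan S"
proof
  fix v assume "v \<in> S"
  then show "v \<in> hspan S"
    unfolding hspan_def mem_Collect_eq
    by (intro exI[of _ "{v}"] exI[of _ "\<lambda>_. 1"] conjI) auto
qed

lemma hsubspace_hspan: "hsubspace (hspan S)"
  unfolding hsubspace_def
proof (intro conjI ballI allI)
  show "0 \<in> hspan S"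
    unfolding hspan_def mem_Collect_eq
    by (intro exI[of _ "{}"] exI[of _ "\<lambda>_. 0"] conjI) auto
next
  fix v w
  assume "v \<in> hspan S" "w \<in> hspan S"
  then obtain T c T' c' where v: "v = (\<Sum>u\<in>T. u *\<^sub>H c u)" "finite T" "T \<subseteq> S"
    and w: "w = (\<Sum>u\<in>T'. u *\<^sub>H c' u)" "finite T'" "T' \<subseteq> S"
    unfolding hspan_def by blast
  define d where "d u = (if u \<in> T then c u else 0) + (if u \<in> T' then c' u else 0)" for u
  have "(\<Sum>u\<in>T. u *\<^sub>H c u) = (\<Sum>u\<in>T\<union>T'. u *\<^sub>H (if u \<in> T then c u else 0))"
    using v w by (intro sum.mono_neutral_cong_left) auto
  moreover have "(\<Sum>u\<in>T'. u *\<^sub>H c' u) = (\<Sum>u\<in>T\<union>T'. u *\<^sub>H (if u \<in> T' then c' u else 0))"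
    using v w by (intro sum.mono_neutral_cong_left) auto
  ultimately have "v + w = (\<Sum>u\<in>T\<union>T'. u *\<^sub>H d u)"
    by (simp add: v(1) w(1) d_def rscale_algebra sum.distrib)
  then show "v + w \<in> hspan S"
    unfolding hspan_def using v w by blast
next
  fix v a
  assume "v \<in> hspan S"
  then obtain T c where "v = (\<Sum>u\<in>T. u *\<^sub>H c u)" "finite T" "T \<subseteq> S"
    unfolding hspan_def by blast
  then have "v *\<^sub>H a = (\<Sum>u\<in>T. u *\<^sub>H (c u * a))"
    by (simp add: rscale_sum)
  with \<open>finite T\<close> \<open>T \<subseteq> S\<close> show "v *\<^sub>H a \<in> hspan S"
    unfolding hspan_def mem_Collect_eq
    by (intro exI[of _ T] exI[of _ "\<lambda>u. c u * a"] conjI)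
qed

lemma hspan_eqI: "\<lbrakk>S \<subseteq> hspan T; T \<subseteq> hspan S\<rbrakk> \<Longrightarrow> hspan S = hspan T"
  by (meson hspan_minimal hsubspace_hspan subset_antisym)

lemma hspan_hspan: "hspan (hspan S) = hspan S"
  by (rule hspan_eqI) (auto intro: hspan_superset[THEN subsetD])

definition orthc :: "'m::{finite,zero} qvec set \<Rightarrow> 'm qvec set"
  where "orthc S = {v. \<forall>s\<in>S. herm s v = 0}"

lemma hsubspace_orthc: "hsubspace (orthc S)"
  by (auto simp: hsubspace_def orthc_def)

lemma orthc_commute: "S \<subseteq> orthc T \<longleftrightarrow> T \<subseteq> orthc S"
  unfolding orthc_def using herm_eq_0_commute by blast

lemma orthc_hspan [simp]: "orthc (hspan S) = orthc S"
proof
  show "orthc (hspan S) \<subseteq> orthc S"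
    using hspan_superset by (auto simp: orthc_def)
  have "S \<subseteq> orthc (orthc S)"
    using orthc_commute by blast
  then have "hspan S \<subseteq> orthc (orthc S)"
    by (rule hspan_minimal) (rule hsubspace_orthc)
  then show "orthc S \<subseteq> orthc (hspan S)"
    using orthc_commute by blast
qed

definition orthonormal :: "'m::{finite,zero} qvec set \<Rightarrow> bool"
  where "orthonormal B \<longleftrightarrow>
    finite B \<and> (\<forall>b\<in>B. \<forall>c\<in>B. herm b c = (if b = c then 1 else 0))"

lemma orthonormal_herm_sum:
  assumes "orthonormal B" "b \<in> B"
  shows "herm b (\<Sum>u\<in>B. u *\<^sub>H c u) = c b"
proof -
  have "herm b (\<Sum>u\<in>B. u *\<^sub>H c u) = (\<Sum>u\<in>B. if b = u then c u else 0)"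
    unfolding herm_sum using assms by (intro sum.cong) (auto simp: orthonormal_def)
  then show ?thesis
    using assms by (simp add: orthonormal_def)
qed

lemma orthonormal_subset: "orthonormal B \<Longrightarrow> C \<subseteq> B \<Longrightarrow> orthonormal C"
  unfolding orthonormal_def by (meson finite_subset subsetD)

lemma orthonormal_Un:
  assumes "orthonormal B" "orthonormal C" "C \<subseteq> orthc B"
  shows "orthonormal (B \<union> C)" "B \<inter> C = {}"
proof -
  have 0: "herm b c = 0" "herm c b = 0" if "b \<in> B" "c \<in> C" for b c
    using assms(3) that herm_eq_0_commute unfolding orthc_def by blast+
  show "B \<inter> C = {}"
    using 0 assms(1) by (force simp: orthonormal_def)
  then show "orthonormal (B \<union> C)"
    using assms(1,2) 0 by (auto simp: orthonormal_def)
qed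

lemma orthonormal_hindependent: "orthonormal B \<Longrightarrow> hindependent B"
  unfolding hindependent_def
  by (metis orthonormal_subset orthonormal_herm_sum herm_0(2))

lemma orthonormal_decomposition:
  assumes "orthonormal B"
  shows "v - (\<Sum>b\<in>B. b *\<^sub>H herm b v) \<in> orthc B"
  using assms by (auto simp: orthc_def orthonormal_herm_sum)

section \<open>Quaternionic dimension computed through real dimension\<close>

definition quat_units :: "quat set"
  where "quat_units = {Quat 1 0 0 0, Quat 0 1 0 0, Quat 0 0 1 0, Quat 0 0 0 1}"

lemma card_quat_units: "finite quat_units" "card quat_units = 4"
  by (simp_all add: quat_units_def)

lemma sum_quat_units:
  "(\<Sum>q\<in>quat_units. f q *\<^sub>R q) = Quat (f (Quat 1 0 0 0)) (f (Quat 0 1 0 0)) (f (Quat 0 0 1 0)) (f (Quat 0 0 0 1))"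
  by (simp add: quat_units_def quat_simps)

lemma quat_eq_sum_units: obtains f where "a = (\<Sum>q\<in>quat_units. f q *\<^sub>R q)"
proof
  show "a = (\<Sum>q\<in>quat_units.
     (if q = Quat 1 0 0 0 then qRe a else if q = Quat 0 1 0 0 then qI a else
      if q = Quat 0 0 1 0 then qJ a else qK a) *\<^sub>R q)"
    unfolding sum_quat_units by simp
qed

lemma sum_quat_units_eq_0: "(\<Sum>q\<in>quat_units. f q *\<^sub>R q) = 0 \<Longrightarrow> q \<in> quat_units \<Longrightarrow> f q = 0"
  unfolding sum_quat_units by (auto simp: quat_units_def zero_quat_def)

lemma hspan_eq_span: "hspan B = span {b *\<^sub>H q |b q. b \<in> B \<and> q \<in> quat_units}" (is "_ = span ?S")
proof
  show "span ?S \<subseteq> hspan B"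
  proof (rule span_minimal)
    show "?S \<subseteq> hspan B"
      using hspan_superset hsubspaceD(3)[OF hsubspace_hspan] by fast
    show "subspace (hspan B)"
      using hsubspaceD[OF hsubspace_hspan[of B]] by (simp add: subspace_def)
  qed
  show "hspan B \<subseteq> span ?S"
  proof
    fix v assume "v \<in> hspan B"
    then obtain T c where T: "v = (\<Sum>u\<in>T. u *\<^sub>H c u)" "T \<subseteq> B"
      unfolding hspan_def by blast
    have "u *\<^sub>H a \<in> span ?S" if "u \<in> B" for u a
    proof -
      obtain f where "a = (\<Sum>q\<in>quat_units. f q *\<^sub>R q)"
        by (rule quat_eq_sum_units)
      then have "u *\<^sub>H a = (\<Sum>q\<in>quat_units. f q *\<^sub>R (u *\<^sub>H q))"
        by (simp add: rscale_sum_right rscale_scaleR)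
      also have "\<dots> \<in> span ?S"
        using that by (intro span_sum span_scale span_base) blast
      finally show ?thesis .
    qed
    with T show "v \<in> span ?S"
      by (auto intro!: span_sum)
  qed
qed

lemma hindependent_units:
  assumes "hindependent B" "finite B"
  shows "independent {b *\<^sub>H q |b q. b \<in> B \<and> q \<in> quat_units}" (is "independent ?S")
    and "card {b *\<^sub>H q |b q. b \<in> B \<and> q \<in> quat_units} = 4 * card B"
proof -
  have ind: "c v = 0" if "(\<Sum>v\<in>B. v *\<^sub>H c v) = 0" "v \<in> B" for c v
    using assms that unfolding hindependent_def by blast
  define h where "h = (\<lambda>(b, q). b *\<^sub>H q :: 'a qvec)"
  have S: "?S = h ` (B \<times> quat_units)"
    by (auto simp: h_def image_iff)
  have inj: "inj_on h (B \<times> quat_units)"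
  proof (rule inj_onI, clarify)
    fix b q b' q'
    assume *: "b \<in> B" "q \<in> quat_units" "b' \<in> B" "q' \<in> quat_units" "h (b, q) = h (b', q')"
    have q0: "q \<noteq> 0"
      using *(2) by (auto simp: quat_units_def zero_quat_def)
    \<comment> \<open>Coefficients of the relation \<open>b q - b' q' = 0\<close>. At
      \<open>b\<close> the coefficient is \<open>q\<close>, which is nonzero, when \<open>b\<close>
      and \<open>b'\<close> differ, and \<open>q - q'\<close> when they agree.\<close>
    define c where "c u = (if u = b then q else 0) - (if u = b' then q' else 0)" for u
    have "(\<Sum>u\<in>B. u *\<^sub>H c u) = (\<Sum>u\<in>B. if u = b then b *\<^sub>H q else 0) - (\<Sum>u\<in>B. if u = b' then b' *\<^sub>H q' else 0)"
      unfolding sum_subtractf[symmetric] by (intro sum.cong) (auto simp: c_def rscale_algebra)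
    also have "\<dots> = 0"
      using * assms(2) by (simp add: h_def)
    finally have "c b = 0"
      using ind *(1) by blast
    then show "b = b' \<and> q = q'"
      using q0 by (auto simp: c_def split: if_splits)
  qed
  show "card ?S = 4 * card B"
    unfolding S card_image[OF inj] by (simp add: card_cartesian_product card_quat_units)
  show "independent ?S"
  proof (rule independent_if_scalars_zero)
    show "finite ?S"
      unfolding S using assms(2) card_quat_units by simp
    fix f x
    assume f: "(\<Sum>x\<in>?S. f x *\<^sub>R x) = 0" and "x \<in> ?S"
    then obtain b q where bq: "x = b *\<^sub>H q" "b \<in> B" "q \<in> quat_units"
      by blast
    \<comment> \<open>A real relation among the products \<open>b q\<close> regroups into a
      quaternionic relation among the \<open>b\<close>, whose coefficients have the given real
      numbers as coordinates.\<close>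
    have "(\<Sum>b\<in>B. b *\<^sub>H (\<Sum>q\<in>quat_units. f (b *\<^sub>H q) *\<^sub>R q)) = 0"
      using f unfolding S sum.reindex[OF inj]
      by (simp add: h_def sum.cartesian_product split_def rscale_sum_right rscale_scaleR)
    then have "(\<Sum>q\<in>quat_units. f (b *\<^sub>H q) *\<^sub>R q) = 0"
      by (rule ind[where c = "\<lambda>b. \<Sum>q\<in>quat_units. f (b *\<^sub>H q) *\<^sub>R q", OF _ bq(2)])
    with bq show "f x = 0"
      using sum_quat_units_eq_0[of "\<lambda>q. f (b *\<^sub>H q)"] by simp
  qed
qed

lemma hspan_axes: "hspan (range (\<lambda>j. axis j 1)) = (UNIV :: 'm::finite qvec set)"
proof -
  have "v \<in> hspan (range (\<lambda>j. axis j 1))" for v :: "'m qvec"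
    by (subst vec_eq_sum_axis)
      (intro hsubspace_sum hsubspaceD(3) hsubspace_hspan hspan_superset[THEN subsetD] rangeI)
  then show ?thesis
    by blast
qed

lemma exists_finite_spanning:
  obtains F :: "'m::finite qvec set" where "finite F" "span F = UNIV"
proof
  define F where "F = {b *\<^sub>H q |b q. b \<in> range (\<lambda>j::'m. axis j 1) \<and> q \<in> quat_units}"
  show "span F = (UNIV :: 'm qvec set)"
    using hspan_axes hspan_eq_span unfolding F_def by blast
  have "F = (\<lambda>(b, q). b *\<^sub>H q) ` (range (\<lambda>j::'m. axis j 1) \<times> quat_units)"
    by (force simp: F_def)
  then show "finite F"
    using card_quat_units by simp
qed

lemma real_independent_bound:
  obtains K where "\<And>B :: 'm::finite qvec set. independent B \<Longrightarrow> finite B \<and> card B \<le> K"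
proof -
  obtain F :: "'m qvec set" where "finite F" "span F = UNIV"
    by (rule exists_finite_spanning)
  with that[of "card F"] show ?thesis
    using independent_span_bound by blast
qed

text \<open>Real scalars are special quaternions, so quaternionic independence implies real
  independence, and the ambient real dimension is finite.\<close>

lemma hindependent_finite: "hindependent B \<Longrightarrow> finite B"
proof -
  assume B: "hindependent B"
  have "independent B"
    unfolding independent_explicit_finite_subsets
  proof (intro allI impI ballI)
    fix S u v
    assume S: "S \<subseteq> B" "finite S" "(\<Sum>v\<in>S. u v *\<^sub>R v) = 0" "v \<in> S"
    then have "(\<Sum>v\<in>S. v *\<^sub>H of_real (u v)) = 0"
      by (simp add: rscale_of_real)
    with S have "of_real (u v) = (0::quat)"
      using B[unfolded hindependent_def, rule_format, of S "\<lambda>v. of_real (u v)" v] by simp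
    then show "u v = 0"
      by simp
  qed
  then show "finite B"
    by (metis real_independent_bound)
qed

lemma orthonormal_card_bound:
  obtains K where "\<And>B :: 'm::{finite,zero} qvec set. orthonormal B \<Longrightarrow> card B \<le> K"
proof -
  obtain K where K: "\<And>B :: 'm qvec set. independent B \<Longrightarrow> finite B \<and> card B \<le> K"
    by (rule real_independent_bound) blast
  have "card B \<le> K" if "orthonormal B" for B :: "'m qvec set"
  proof -
    have B: "hindependent B" "finite B"
      using that by (auto simp: orthonormal_hindependent hindependent_finite)
    have "4 * card B \<le> K"
      using K[OF hindependent_units(1)[OF B]] unfolding hindependent_units(2)[OF B] by blast
    then show ?thesis
      by simp
  qed
  with that show ?thesis
    by blast
qed

text \<open>\<open>hdim\<close> picks a basis by choice. The real dimension of the span is four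
  times the cardinality of any basis, so the choice does not matter.\<close>

lemma hdim_eq_card:
  assumes "hindependent B" "hspan B = hspan S"
  shows "hdim S = card B"
proof -
  define C where "C = (SOME B. hindependent B \<and> hspan B = hspan S)"
  have C: "hindependent C \<and> hspan C = hspan S"
    unfolding C_def by (rule someI[of _ B]) (use assms in simp)
  have "dim (hspan A) = 4 * card A" if "hindependent A" for A :: "'a qvec set"
  proof -
    let ?S = "{b *\<^sub>H q |b q. b \<in> A \<and> q \<in> quat_units}"
    have "dim (span ?S) = card ?S"
      using hindependent_units(1)[OF that hindependent_finite[OF that]]
      by (rule dim_eq_card[OF span_span[symmetric]])
    then show ?thesis
      using hindependent_units(2)[OF that hindependent_finite[OF that]] by (simp only: hspan_eq_span)
  qed
  then have "4 * card C = 4 * card B"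
    using C assms by metis
  then show ?thesis
    by (simp add: hdim_def C_def)
qed

lemma class_multiplicity_eq_card:
  assumes "orthonormal B" "B \<subseteq> eigenspace g a" "eigenspace g a \<subseteq> hspan B"
  shows "class_multiplicity g a = card B"
  unfolding class_multiplicity_def
proof (rule hdim_eq_card)
  show "hindependent B"
    using assms(1) by (rule orthonormal_hindependent)
  show "hspan B = hspan (hspan (eigenspace g a))"
    unfolding hspan_hspan using assms(2,3) hspan_superset by (intro hspan_eqI) blast+
qed

section \<open>Eigenvectors\<close>

text \<open>Right multiplication by a non-real coefficient is not quaternionic linear, so
  \<open>p(g)\<close> is not a matrix in general. It is therefore defined by its value on one
  vector.\<close>

definition poly_act :: "'m::finite qmat \<Rightarrow> complex poly \<Rightarrow> 'm qvec \<Rightarrow> 'm qvec"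
  where "poly_act g p v = (\<Sum>i\<le>degree p. (mat_pow g i *v v) *\<^sub>H quat_of_complex (coeff p i))"

lemma poly_act_bound:
  assumes "degree p \<le> n"
  shows "poly_act g p v = (\<Sum>i\<le>n. (mat_pow g i *v v) *\<^sub>H quat_of_complex (coeff p i))"
  unfolding poly_act_def using assms
  by (intro sum.mono_neutral_left) (auto simp: coeff_eq_0)

text \<open>Multiplication by the variable shifts the powers of \<open>g\<close>, which amounts to
  applying \<open>g\<close>; multiplication by \<open>z\<close> can be moved to the far right
  because complex coefficients commute.\<close>

lemma poly_act_linear_factor:
  "poly_act g ([:- z, 1:] * q) v = g *v (poly_act g q v) - (poly_act g q v) *\<^sub>H quat_of_complex z"
proof -
  define n where "n = degree q"
  let ?c = "\<lambda>i. quat_of_complex (coeff q i)"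
  let ?m = "\<lambda>i. mat_pow g i *v v"
  have cn: "coeff q (Suc n) = 0"
    by (simp add: n_def coeff_eq_0)
  have "degree ([:- z, 1:] * q) \<le> Suc n"
    using degree_mult_le[of "[:- z, 1:]" q] by (simp add: n_def)
  then have "poly_act g ([:- z, 1:] * q) v =
      (\<Sum>i\<le>Suc n. ?m i *\<^sub>H quat_of_complex (coeff ([:- z, 1:] * q) i))"
    by (rule poly_act_bound)
  also have "\<dots> = (\<Sum>i\<le>Suc n. ?m i *\<^sub>H (case i of 0 \<Rightarrow> 0 | Suc j \<Rightarrow> ?c j))
      - (\<Sum>i\<le>Suc n. ?m i *\<^sub>H (?c i * quat_of_complex z))"
    unfolding sum_subtractf[symmetric]
    by (intro sum.cong)
      (auto simp: coeff_pCons rscale_algebra[symmetric] mult.commute[of z]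
        simp flip: quat_of_complex_simps(6) split: nat.split)
  also have "(\<Sum>i\<le>Suc n. ?m i *\<^sub>H (case i of 0 \<Rightarrow> 0 | Suc j \<Rightarrow> ?c j)) = (\<Sum>i\<le>n. ?m (Suc i) *\<^sub>H ?c i)"
    by (subst sum.atMost_Suc_shift) simp
  also have "\<dots> = g *v (\<Sum>i\<le>n. ?m i *\<^sub>H ?c i)"
    by (simp add: mult_vec_sum mult_vec_rscale matrix_vector_mul_assoc)
  also have "(\<Sum>i\<le>Suc n. ?m i *\<^sub>H (?c i * quat_of_complex z))
      = (\<Sum>i\<le>n. ?m i *\<^sub>H ?c i) *\<^sub>H quat_of_complex z"
    using cn by (simp add: rscale_sum)
  finally show ?thesis
    by (simp add: poly_act_def n_def)
qed

lemma poly_act_in: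
  assumes "hsubspace W" "\<And>w. w \<in> W \<Longrightarrow> g *v w \<in> W" "v \<in> W"
  shows "poly_act g p v \<in> W"
proof -
  have "mat_pow g i *v v \<in> W" for i
    by (induction i) (auto simp: assms simp flip: matrix_vector_mul_assoc)
  then show ?thesis
    unfolding poly_act_def using assms(1) by (intro hsubspace_sum hsubspaceD(3))
qed

lemma exists_annihilating_poly:
  obtains p where "p \<noteq> 0" "poly_act g p v = 0"
proof -
  let ?m = "\<lambda>i. mat_pow g i *v v"
  obtain K where K: "\<And>B :: 'a qvec set. independent B \<Longrightarrow> finite B \<and> card B \<le> K"
    by (rule real_independent_bound) blast
  obtain c :: "nat \<Rightarrow> real" where c: "(\<Sum>i\<le>K. c i *\<^sub>R ?m i) = 0" "\<exists>i\<le>K. c i \<noteq> 0"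
  proof (cases "inj_on ?m {..K}")
    case True
    then have "card (?m ` {..K}) = Suc K"
      by (simp add: card_image)
    then have "dependent (?m ` {..K})"
      using K[of "?m ` {..K}"] by fastforce
    then obtain u where u: "\<exists>v\<in>?m ` {..K}. u v \<noteq> 0" "(\<Sum>v\<in>?m ` {..K}. u v *\<^sub>R v) = 0"
      by (auto simp: dependent_finite)
    then show ?thesis
      using that[of "\<lambda>i. u (?m i)"] by (auto simp: sum.reindex[OF True])
  next
    \<comment> \<open>If two powers agree on \<open>v\<close>, the set of values may still be
      independent; the difference of the two equal terms is then the required relation.\<close>
    case False
    then obtain i j where ij: "i \<le> K" "j \<le> K" "i \<noteq> j" "?m i = ?m j"
      by (auto simp: inj_on_def)
    have "(\<Sum>k\<le>K. ((if k = i then 1 else 0) - (if k = j then 1 else 0)) *\<^sub>R ?m k) =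
        (\<Sum>k\<le>K. if k = i then ?m i else 0) - (\<Sum>k\<le>K. if k = j then ?m j else 0)"
      unfolding sum_subtractf[symmetric] by (intro sum.cong) (auto simp: scaleR_diff_left)
    also have "\<dots> = 0"
      using ij by simp
    finally show ?thesis
      using that[of "\<lambda>k. (if k = i then 1 else 0) - (if k = j then 1 else 0)"] ij by force
  qed
  define p where "p = (\<Sum>i\<le>K. monom (complex_of_real (c i)) i)"
  have coeff: "coeff p i = (if i \<le> K then of_real (c i) else 0)" for i
    by (simp add: p_def coeff_sum if_distrib[of "\<lambda>x. x = _"] cong: if_cong)
  show ?thesis
  proof (rule that)
    show "p \<noteq> 0"
      using c(2) coeff by (metis coeff_0 of_real_eq_0_iff)
    have "degree p \<le> K"
      by (rule degree_le) (simp add: coeff)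
    then have "poly_act g p v = (\<Sum>i\<le>K. ?m i *\<^sub>H quat_of_complex (coeff p i))"
      by (rule poly_act_bound)
    also have "\<dots> = (\<Sum>i\<le>K. c i *\<^sub>R ?m i)"
      by (intro sum.cong) (auto simp: coeff rscale_of_real)
    also note c(1)
    finally show "poly_act g p v = 0" .
  qed
qed

text \<open>Split a complex root \<open>z\<close> off a polynomial annihilating \<open>v\<close>.
  Either the quotient \<open>q\<close> still annihilates \<open>v\<close> and has smaller degree, or
  \<open>poly_act g q v\<close> is an eigenvector for \<open>z\<close>; invariance keeps it in
  \<open>W\<close>.\<close>

lemma exists_eigenvector:
  assumes W: "hsubspace W" "\<And>w. w \<in> W \<Longrightarrow> g *v w \<in> W" and v: "v \<in> W" "v \<noteq> 0"
  obtains w a where "w \<in> W" "w \<noteq> 0" "g *v w = w *\<^sub>H a"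
proof -
  obtain p where p: "p \<noteq> 0" "poly_act g p v = 0"
    by (rule exists_annihilating_poly)
  have "\<exists>w\<in>W. \<exists>a. w \<noteq> 0 \<and> g *v w = w *\<^sub>H a"
    using p
  proof (induction "degree p" arbitrary: p)
    case 0
    then obtain c where "p = [:c:]"
      by (metis degree_eq_zeroE)
    with 0 v(2) show ?case
      by (simp add: poly_act_def)
  next
    case (Suc n)
    then have "\<not> constant (poly p)"
      by (simp add: constant_degree)
    then obtain z where "poly p z = 0"
      using fundamental_theorem_of_algebra by blast
    then obtain q where q: "p = [:- z, 1:] * q"
      by (metis poly_eq_0_iff_dvd dvd_def)
    with Suc have "q \<noteq> 0"
      by auto
    with q Suc(2) have deg: "n = degree q"
      by (simp add: degree_mult_eq del: mult_pCons_left)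
    show ?case
    proof (cases "poly_act g q v = 0")
      case True
      with Suc(1) deg \<open>q \<noteq> 0\<close> show ?thesis
        by blast
    next
      case False
      have "g *v (poly_act g q v) = (poly_act g q v) *\<^sub>H quat_of_complex z"
        using Suc(4) by (simp add: q poly_act_linear_factor del: mult_pCons_left)
      with False poly_act_in[OF W v(1)] show ?thesis
        by blast
    qed
  qed
  with that show ?thesis
    by blast
qed

section \<open>Eigenspaces of isometries\<close>

lemma eigenspace_iff: "v \<in> eigenspace g a \<longleftrightarrow> g *v v = v *\<^sub>H a"
  by (simp add: eigenspace_def)

lemma eigenspace_closed:
  shows "0 \<in> eigenspace g a"
    and "v \<in> eigenspace g a \<Longrightarrow> w \<in> eigenspace g a \<Longrightarrow> v + w \<in> eigenspace g a"
    and "v \<in> eigenspace g a \<Longrightarrow> w \<in> eigenspace g a \<Longrightarrow> v - w \<in> eigenspace g a"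
    and "v \<in> eigenspace g a \<Longrightarrow> r *\<^sub>R v \<in> eigenspace g a"
    and "v \<in> eigenspace g a \<Longrightarrow> a * c = c * a \<Longrightarrow> v *\<^sub>H c \<in> eigenspace g a"
  by (simp_all add: eigenspace_iff mult_vec_algebra mult_vec_scaleR rscale_algebra rscale_scaleR)

lemma eigenspace_sum: "(\<And>i. i \<in> S \<Longrightarrow> f i \<in> eigenspace g a) \<Longrightarrow> sum f S \<in> eigenspace g a"
  by (induction S rule: infinite_finite_induct) (auto intro: eigenspace_closed)

lemma eigenvector_herm:
  assumes "g \<in> Sp_n1" "g *v v = v *\<^sub>H a" "g *v w = w *\<^sub>H b"
  shows "qcnj a * herm v w * b = herm v w"
  using Sp_n1_herm[OF assms(1), of v w] assms(2,3) by (simp add: mult.assoc)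

text \<open>For a unit \<open>a\<close> the invariance of the form becomes an intertwining relation.
  With \<open>a = b\<close> it says that Gram entries centralize \<open>a\<close>; in general a
  nonzero entry shows that \<open>a\<close> and \<open>b\<close> are similar.\<close>

lemma eigenvector_herm_commute:
  assumes "g \<in> Sp_n1" "g *v v = v *\<^sub>H a" "g *v w = w *\<^sub>H b" "qnormsq a = 1"
  shows "a * herm v w = herm v w * b"
proof -
  have "a * herm v w = (a * qcnj a) * herm v w * b"
    using eigenvector_herm[OF assms(1-3)] by (simp add: mult.assoc)
  then show ?thesis
    using assms(4) by (simp add: qcnj_unit)
qed

lemma eigenvalue_nonnull_unit:
  assumes "g \<in> Sp_n1" "g *v v = v *\<^sub>H a" "herm v v \<noteq> 0"
  shows "qnormsq a = 1"
proof -
  have "qRe (herm v v) = qnormsq a * qRe (herm v v)"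
    using Sp_n1_herm[OF assms(1), of v v] assms(2) qRe_herm_rscale[of v a] by simp
  then show ?thesis
    using assms(3) by (simp add: herm_self_eq_0_iff)
qed

lemma eigenvalue_nonzero: "\<lbrakk>g \<in> Sp_n1; g *v v = v *\<^sub>H a; v \<noteq> 0\<rbrakk> \<Longrightarrow> a \<noteq> 0"
  by (metis Sp_n1_mult_vec_eq_0_iff rscale_simps(2))

section \<open>Orthonormal families in positive eigenspaces\<close>

lemma normalize_positive:
  assumes "qRe (herm v v) > 0"
  obtains r where "r > 0" "herm (r *\<^sub>R v) (r *\<^sub>R v) = 1"
proof
  show "1 / sqrt (qRe (herm v v)) > 0"
    using assms by simp
  show "herm ((1 / sqrt (qRe (herm v v))) *\<^sub>R v) ((1 / sqrt (qRe (herm v v))) *\<^sub>R v) = 1"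
    unfolding herm_scaleR using assms by (subst herm_self_real) (simp add: of_real_def)
qed

lemma orthonormal_insert:
  assumes "orthonormal B" "w \<in> orthc B" "herm w w = 1"
  shows "orthonormal (insert w B)" "w \<notin> B"
  using orthonormal_Un[of B "{w}"] assms by (auto simp: orthonormal_def)

text \<open>An eigenspace is closed under right multiplication only by scalars commuting with
  \<open>a\<close>. The projection coefficients are Gram entries of eigenvectors and do commute with
  \<open>a\<close>.\<close>

lemma eigenspace_projection:
  assumes "g \<in> Sp_n1" "qnormsq a = 1" "orthonormal B" "B \<subseteq> eigenspace g a" "v \<in> eigenspace g a"
  shows "v - (\<Sum>b\<in>B. b *\<^sub>H herm b v) \<in> eigenspace g a \<inter> orthc B"
proof -
  have "b *\<^sub>H herm b v \<in> eigenspace g a" if "b \<in> B" for b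
    using that assms eigenvector_herm_commute[of g b a v a]
    by (intro eigenspace_closed(5)) (auto simp: eigenspace_iff)
  then have "(\<Sum>b\<in>B. b *\<^sub>H herm b v) \<in> eigenspace g a"
    by (rule eigenspace_sum)
  then show ?thesis
    using assms(3,5) by (auto intro: eigenspace_closed orthonormal_decomposition)
qed

lemma combination_in_hspan: "(\<Sum>b\<in>B. b *\<^sub>H c b) \<in> hspan B"
  using hspan_superset by (intro hsubspace_sum hsubspaceD(3) hsubspace_hspan) blast

lemma exists_unit_orthogonal_eigenvector:
  assumes "g \<in> Sp_n1" "qnormsq a = 1" "orthonormal B" "B \<subseteq> eigenspace g a"
    and pos: "eigenspace g a - {0} \<subseteq> V_pos" and "\<not> eigenspace g a \<subseteq> hspan B"
  obtains w where "w \<in> eigenspace g a \<inter> orthc B" "herm w w = 1"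
proof -
  obtain v where v: "v \<in> eigenspace g a" "v \<notin> hspan B"
    using assms(6) by blast
  define z where "z = v - (\<Sum>b\<in>B. b *\<^sub>H herm b v)"
  have z: "z \<in> eigenspace g a \<inter> orthc B"
    unfolding z_def by (rule eigenspace_projection[OF assms(1-4) v(1)])
  have "z \<noteq> 0"
    using v(2) combination_in_hspan[of "\<lambda>b. herm b v" B] by (auto simp: z_def)
  then obtain r where "herm (r *\<^sub>R z) (r *\<^sub>R z) = 1"
    using z pos normalize_positive[of z] by (auto simp: V_pos_def)
  then show ?thesis
    using z that[of "r *\<^sub>R z"] by (auto intro: eigenspace_closed hsubspaceD[OF hsubspace_orthc])
qed

text \<open>Takes the place of an induction on dimension. The map \<open>f\<close> allows the
  maximized object to carry more data than the orthonormal family being counted.\<close>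

lemma exists_max_card_orthonormal:
  assumes "P X" and "\<And>X. P X \<Longrightarrow> orthonormal (f X)"
  obtains X where "P X" "\<And>Y. P Y \<Longrightarrow> card (f Y) \<le> card (f X)"
proof -
  obtain K where "\<And>B :: 'b qvec set. orthonormal B \<Longrightarrow> card B \<le> K"
    using orthonormal_card_bound by blast
  then have "\<forall>Y. P Y \<longrightarrow> card (f Y) < Suc K"
    using assms(2) by (simp add: less_Suc_eq_le)
  with assms(1) show ?thesis
    using ex_has_greatest_nat[of P X "\<lambda>Y. card (f Y)" "Suc K"] that by blast
qed

lemma exists_orthonormal_eigenbasis:
  assumes "g \<in> Sp_n1" "qnormsq a = 1" and pos: "eigenspace g a - {0} \<subseteq> V_pos"
  obtains B where "orthonormal B" "B \<subseteq> eigenspace g a" "eigenspace g a \<subseteq> hspan B"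
proof -
  let ?P = "\<lambda>B. orthonormal B \<and> B \<subseteq> eigenspace g a"
  obtain B where B: "?P B" "\<And>C. ?P C \<Longrightarrow> card C \<le> card B"
    by (rule exists_max_card_orthonormal[of ?P "{}" "\<lambda>B. B"]) (auto simp: orthonormal_def)
  have "eigenspace g a \<subseteq> hspan B"
  proof (rule ccontr)
    assume "\<not> ?thesis"
    then obtain w where w: "w \<in> eigenspace g a \<inter> orthc B" "herm w w = 1"
      using exists_unit_orthogonal_eigenvector assms B(1) by metis
    then have "orthonormal (insert w B)" "w \<notin> B"
      using B(1) orthonormal_insert by blast+
    then show False
      using B(2)[of "insert w B"] B(1) w by (auto simp: orthonormal_def)
  qed
  with B(1) that show ?thesis
    by blast
qed

section \<open>Necessary conditions for strong reversibility\<close>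

text \<open>For an involution \<open>x\<close>, reversing \<open>g\<close> means
  \<open>(x g)^2 = 1\<close>, a condition without inverses that can be checked on vectors.\<close>

lemma strongly_reversibleI:
  assumes "x \<in> Sp_n1" "x ** x = mat 1" and xgxg: "\<And>v. x *v (g *v (x *v (g *v v))) = v" and "g \<in> Sp_n1"
  shows "strongly_reversible_in Sp_n1 g"
proof -
  have 1: "(x ** g ** x) ** g = mat 1"
    by (simp add: matrix_eq xgxg flip: matrix_vector_mul_assoc)
  have inv: "matrix_inv x = x"
    using assms(2) by (intro matrix_inv_eqI)
  have "matrix_inv g = x ** g ** x"
    using 1 matrix_inv_mult[of g] assms(4)
    by (metis (mono_tags, lifting) Sp_n1_def matrix_mul_assoc matrix_mul_lid matrix_mul_rid mem_Collect_eq)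
  with assms(1,2) inv show ?thesis
    unfolding strongly_reversible_in_def by metis
qed

lemma strongly_reversibleE:
  assumes "strongly_reversible_in Sp_n1 g" "g \<in> Sp_n1"
  obtains x where "x \<in> Sp_n1" "\<And>v. x *v (x *v v) = v" "\<And>v. g *v (x *v (g *v v)) = x *v v"
    "\<And>v w. herm (x *v v) w = herm v (x *v w)"
proof -
  obtain x where x: "x \<in> Sp_n1" "x ** x = mat 1" "matrix_inv g = x ** g ** matrix_inv x"
    using assms(1) unfolding strongly_reversible_in_def by blast
  have inv: "matrix_inv x = x"
    using x(2) by (intro matrix_inv_eqI)
  have xx: "x *v (x *v v) = v" for v
    by (simp add: matrix_vector_mul_assoc x(2))
  have "matrix_inv g *v (x *v v) = x *v (g *v v)" for v
    unfolding x(3) inv by (simp add: xx flip: matrix_vector_mul_assoc)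
  then have "g *v (x *v (g *v v)) = x *v v" for v
    by (metis Sp_n1_inv_cancel(1)[OF assms(2)])
  moreover have "herm (x *v v) w = herm v (x *v w)" for v w
    using Sp_n1_herm[OF x(1), of v "x *v w"] by (simp add: xx)
  ultimately show ?thesis
    using that x(1) xx by blast
qed

lemma reversing_eigenvector:
  assumes "\<And>v. g *v (x *v (g *v v)) = x *v v" "g *v v = v *\<^sub>H a" "a \<noteq> 0"
  shows "g *v (x *v v) = (x *v v) *\<^sub>H inverse a"
proof -
  have "(g *v (x *v v)) *\<^sub>H a = x *v v"
    using assms(1)[of v] assms(2) by (simp add: mult_vec_rscale)
  then have "(x *v v) *\<^sub>H inverse a = (g *v (x *v v)) *\<^sub>H (a * inverse a)"
    by (metis rscale_simps(6))
  then show ?thesis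
    using assms(3) by simp
qed

lemma herm_selfadjoint_real: "(\<And>v w. herm (x *v v) w = herm v (x *v w)) \<Longrightarrow> herm v (x *v v) \<in> \<real>"
  by (metis herm_commute qcnj_fixed_iff)

text \<open>For a reversing involution \<open>x\<close>, following it by right multiplication with a unit that
  conjugates \<open>a\<close> to its inverse gives a quaternionic structure on the eigenspace of \<open>a\<close>.\<close>

lemma eigenspace_quaternionic_structure:
  assumes g: "g \<in> Sp_n1" "strongly_reversible_in Sp_n1 g" and a: "qnormsq a = 1" "a \<notin> \<real>"
  obtains T where "\<And>v. v \<in> eigenspace g a \<Longrightarrow> T v \<in> eigenspace g a"
    "\<And>v. v \<in> eigenspace g a \<Longrightarrow> herm v (T v) = 0"
    "\<And>v. T (T v) = - v" "\<And>v w. herm v w = 0 \<Longrightarrow> herm (T v) (T w) = 0"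
    "\<And>v. herm (T v) (T v) = herm v v"
proof -
  obtain x where x: "x \<in> Sp_n1" "\<And>v. x *v (x *v v) = v" "\<And>v. g *v (x *v (g *v v)) = x *v v"
    "\<And>v w. herm (x *v v) w = herm v (x *v w)"
    using strongly_reversibleE[OF g(2,1)] by blast
  obtain u where u: "u * u = -1" "qcnj u = - u" "qnormsq u = 1" "u * a = qcnj a * u" "a * u = u * qcnj a"
    using exists_conjugating_unit by blast
  define T where "T v = (x *v v) *\<^sub>H u" for v
  have a0: "a \<noteq> 0"
    using a(2) by auto
  have T: "T v \<in> eigenspace g a" if "v \<in> eigenspace g a" for v
    using reversing_eigenvector[OF x(3) _ a0, of v] that u(4)
    by (simp add: eigenspace_iff T_def mult_vec_rscale inverse_unit_quat[OF a(1)])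
  show ?thesis
  proof (rule that)
    show "T v \<in> eigenspace g a" if "v \<in> eigenspace g a" for v
      by (rule T[OF that])
    show "herm v (T v) = 0" if v: "v \<in> eigenspace g a" for v
    proof -
      define r where "r = herm v (x *v v)"
      have r: "r \<in> \<real>"
        unfolding r_def by (rule herm_selfadjoint_real[OF x(4)])
      then have rc: "r * y = y * r" for y
        by (auto simp: Reals_def of_real_quat_commute)
      \<comment> \<open>Since \<open>T v\<close> lies in the same eigenspace,
        \<open>herm v (T v) = r u\<close> commutes with \<open>a\<close>; but \<open>u\<close> turns
        \<open>a\<close> into \<open>qcnj a\<close> and \<open>r\<close> is real, so
        \<open>r (a - qcnj a) u = 0\<close>.\<close>
      have "a * herm v (T v) = herm v (T v) * a"
        using eigenvector_herm_commute[OF g(1) _ _ a(1)] v T[OF v] by (simp add: eigenspace_iff)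
      then have "a * (r * u) = r * (qcnj a * u)"
        by (simp add: T_def r_def mult.assoc u(4))
      then have "r * ((a - qcnj a) * u) = 0"
        by (metis (no_types) rc mult.assoc left_diff_distrib right_diff_distrib right_minus_eq)
      moreover have "u \<noteq> 0"
        using u(3) by (metis qnormsq_eq_0_iff zero_neq_one)
      ultimately have "r = 0"
        using a(2) qcnj_fixed_iff[of a] by auto
      then show ?thesis
        by (simp add: T_def r_def)
    qed
    show "T (T v) = - v" for v
      by (simp add: T_def mult_vec_rscale x(2) u(1))
    show "herm (T v) (T w) = 0" if "herm v w = 0" for v w
      using that by (simp add: T_def Sp_n1_herm[OF x(1)])
    show "herm (T v) (T v) = herm v v" for v
    proof -
      have "qRe (herm (T v) (T v)) = qRe (herm v v)"
        unfolding T_def qRe_herm_rscale by (simp add: u(3) Sp_n1_herm[OF x(1)])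
      then show ?thesis
        by (metis herm_self_real)
    qed
  qed
qed

lemma even_class_multiplicity:
  assumes g: "g \<in> Sp_n1" "strongly_reversible_in Sp_n1 g" and a: "qnormsq a = 1" "a \<notin> \<real>"
    and pos: "eigenspace g a - {0} \<subseteq> V_pos"
  shows "even (class_multiplicity g a)"
proof -
  obtain T where T: "\<And>v. v \<in> eigenspace g a \<Longrightarrow> T v \<in> eigenspace g a"
    "\<And>v. v \<in> eigenspace g a \<Longrightarrow> herm v (T v) = 0"
    "\<And>v. T (T v) = - v" "\<And>v w. herm v w = 0 \<Longrightarrow> herm (T v) (T w) = 0"
    "\<And>v. herm (T v) (T v) = herm v v"
    by (rule eigenspace_quaternionic_structure[OF g a]) blast
  \<comment> \<open>The family grows by pairs \<open>w\<close>, \<open>T w\<close>. Stability of its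
    complement under \<open>T\<close> is carried along, so that \<open>T w\<close> is again
    orthogonal to \<open>B\<close>.\<close>
  let ?P = "\<lambda>B. orthonormal B \<and> B \<subseteq> eigenspace g a \<and> even (card B) \<and>
    (\<forall>v\<in>eigenspace g a \<inter> orthc B. T v \<in> orthc B)"
  obtain B where B: "?P B" "\<And>C. ?P C \<Longrightarrow> card C \<le> card B"
    by (rule exists_max_card_orthonormal[of ?P "{}" "\<lambda>B. B"]) (auto simp: orthonormal_def orthc_def)
  have "eigenspace g a \<subseteq> hspan B"
  proof (rule ccontr)
    assume "\<not> ?thesis"
    then obtain w where w: "w \<in> eigenspace g a" "w \<in> orthc B" "herm w w = 1"
      using exists_unit_orthogonal_eigenvector g(1) a(1) pos B(1) by (metis IntE)
    have wT: "herm w (T w) = 0" "herm (T w) w = 0" "herm (T w) (T w) = 1" "w \<noteq> T w"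
      using T(2)[OF w(1)] T(5)[of w] w(3) herm_eq_0_commute[of "T w" w] by auto
    have Tw: "T w \<in> eigenspace g a" "T w \<in> orthc B"
      using T(1) B(1) w by auto
    have o1: "orthonormal (insert w B)" "w \<notin> B"
      using B(1) w(2,3) orthonormal_insert by blast+
    moreover have "T w \<in> orthc (insert w B)"
      using Tw(2) wT(1) by (simp add: orthc_def)
    ultimately have "orthonormal (insert (T w) (insert w B))" "T w \<notin> insert w B"
      using wT(3) orthonormal_insert by blast+
    then have o: "orthonormal (B \<union> {w, T w})" "B \<inter> {w, T w} = {}"
      using o1(2) by (simp_all add: insert_commute)
    have "T v \<in> orthc (B \<union> {w, T w})" if v: "v \<in> eigenspace g a" "v \<in> orthc (B \<union> {w, T w})" for v
    proof -
      have "herm w v = 0" "herm (T w) v = 0" "v \<in> orthc B"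
        using v(2) by (auto simp: orthc_def)
      \<comment> \<open>Because \<open>T (T w) = - w\<close>, orthogonality of \<open>v\<close> to
        \<open>T w\<close> gives orthogonality of \<open>T v\<close> to \<open>w\<close>.\<close>
      moreover have "herm (T (T w)) (T v) = 0"
        using \<open>herm (T w) v = 0\<close> by (rule T(4))
      ultimately show ?thesis
        using B(1) v(1) T(4)[of w v] T(3)[of w] by (auto simp: orthc_def)
    qed
    moreover have "card (B \<union> {w, T w}) = card B + 2"
      using o B(1) wT(4) by (subst card_Un_disjoint) (auto simp: orthonormal_def)
    ultimately have "?P (B \<union> {w, T w})"
      using o B(1) w(1) Tw(1) by auto
    then show False
      using B(2)[of "B \<union> {w, T w}"] \<open>card (B \<union> {w, T w}) = card B + 2\<close> by simp
  qed
  then show ?thesis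
    using class_multiplicity_eq_card[of B g a] B(1) by simp
qed

section \<open>Constraints on positive, null and negative eigenvalues\<close>

lemma sim_class_real: "a = 1 \<or> a = -1 \<Longrightarrow> sim_class a = {a}"
  by (auto simp: sim_class_def intro: exI[of _ 1])

lemma mem_sim_class: "a \<in> sim_class a"
  by (auto simp: sim_class_def intro!: exI[of _ 1])

lemma positive_type_unit:
  assumes "g \<in> Sp_n1" "positive_type g a"
  shows "qnormsq a = 1"
proof -
  obtain v where "g *v v = v *\<^sub>H a" "v \<noteq> 0" "v \<in> V_pos"
    using assms(2) by (auto simp: positive_type_def eigenvalue_def eigenspace_def)
  moreover from this have "herm v v \<noteq> 0"
    by (auto simp: V_pos_def)
  ultimately show ?thesis
    using eigenvalue_nonnull_unit[OF assms(1)] by blast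
qed

lemma positive_classes_if_nonreal_even:
  assumes "g \<in> Sp_n1" "positive_type g a" "a \<notin> \<real> \<Longrightarrow> even (class_multiplicity g a)"
  shows "sim_class a = {1} \<or> sim_class a = {-1} \<or> even (class_multiplicity g a)"
  using quat_real_unit[OF _ positive_type_unit[OF assms(1,2)]] assms(3) sim_class_real by metis

lemma positive_classes_of_strongly_reversible:
  assumes "g \<in> Sp_n1" "strongly_reversible_in Sp_n1 g" "positive_type g a"
  shows "sim_class a = {1} \<or> sim_class a = {-1} \<or> even (class_multiplicity g a)"
proof (rule positive_classes_if_nonreal_even[OF assms(1,3)])
  show "even (class_multiplicity g a)" if "a \<notin> \<real>"
    using assms that positive_type_unit[OF assms(1,3)]
    by (intro even_class_multiplicity) (auto simp: positive_type_def)
qed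

text \<open>If \<open>v\<close> and \<open>x v\<close> are orthogonal, both being null,
  \<open>x\<close> preserves the line of \<open>v\<close>, acts there by a sign, and
  \<open>a\<close> equals its inverse. Otherwise \<open>herm v (x v)\<close> is a nonzero real
  number, and cancelling it from the invariance relation leaves \<open>qcnj a = a\<close>.\<close>

lemma null_eigenvalue_real:
  assumes g: "g \<in> Sp_n1" "strongly_reversible_in Sp_n1 g"
    and v: "g *v v = v *\<^sub>H a" "v \<noteq> 0" "herm v v = 0"
  shows "a \<in> \<real>"
proof -
  obtain x where x: "x \<in> Sp_n1" "\<And>v. x *v (x *v v) = v" "\<And>v. g *v (x *v (g *v v)) = x *v v"
    "\<And>v w. herm (x *v v) w = herm v (x *v w)"
    using strongly_reversibleE[OF g(2,1)] by blast
  define h where "h = herm v (x *v v)"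
  have a0: "a \<noteq> 0"
    using eigenvalue_nonzero[OF g(1) v(1,2)] .
  have gx: "g *v (x *v v) = (x *v v) *\<^sub>H inverse a"
    using reversing_eigenvector[OF x(3) v(1) a0] .
  show ?thesis
  proof (cases "h = 0")
    case True
    then obtain c where c: "x *v v = v *\<^sub>H c"
      using orthogonal_nonpositive_proportional[of v "x *v v"] v(2,3) Sp_n1_herm[OF x(1), of v v]
      by (metis h_def order_refl qRe_simps(1))
    have "v *\<^sub>H (c * c) = v *\<^sub>H 1"
      using x(2)[of v] by (simp add: c mult_vec_rscale)
    then have "v *\<^sub>H (c * c - 1) = 0"
      by (simp add: rscale_algebra)
    then have "c * c = 1"
      using v(2) by simp
    then have "c = 1 \<or> c = -1"
      by (rule quat_square_eq_1)
    with gx have "v *\<^sub>H a = v *\<^sub>H inverse a"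
      by (auto simp: c mult_vec_algebra v(1))
    then have "v *\<^sub>H (a - inverse a) = 0"
      by (simp add: rscale_algebra)
    then have "a * a = 1"
      using v(2) a0 by (metis right_inverse right_minus_eq rscale_eq_0_iff)
    then show ?thesis
      using quat_square_eq_1 by fastforce
  next
    case False
    have "h \<in> \<real>"
      unfolding h_def by (rule herm_selfadjoint_real[OF x(4)])
    then obtain r where r: "h = of_real r"
      by (rule Reals_cases)
    have "qcnj a * h * inverse a = h"
      unfolding h_def using eigenvector_herm[OF g(1) v(1) gx] .
    then have "qcnj a * h = h * a"
      using a0 by (metis left_inverse mult.assoc mult.right_neutral)
    then have "(qcnj a - a) * h = 0"
      by (simp add: r of_real_quat_commute left_diff_distrib)
    then show ?thesis
      using False qcnj_fixed_iff[of a] by simp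
  qed
qed

lemma null_typeE:
  assumes "null_type g a"
  obtains v where "g *v v = v *\<^sub>H a" "v \<noteq> 0" "herm v v = 0"
  using assms by (auto simp: null_type_def degenerate_on_def eigenspace_def)

lemma negative_eigenvalue_of_strongly_reversible:
  assumes g: "g \<in> Sp_n1" "strongly_reversible_in Sp_n1 g"
    and v: "g *v v = v *\<^sub>H a" "qRe (herm v v) < 0"
  shows "a = 1 \<or> a = -1"
proof -
  have a: "qnormsq a = 1"
    using v by (intro eigenvalue_nonnull_unit[OF g(1)]) auto
  have "a \<in> \<real>"
  proof (rule ccontr)
    assume "a \<notin> \<real>"
    then obtain T where T: "\<And>v. v \<in> eigenspace g a \<Longrightarrow> herm v (T v) = 0"
      "\<And>v. herm (T v) (T v) = herm v v"
      by (rule eigenspace_quaternionic_structure[OF g a]) blast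
    have "herm v (T v) = 0"
      using T(1) v(1) by (simp add: eigenspace_def)
    moreover have "T v \<noteq> 0"
      using T(2)[of v] v(2) by auto
    ultimately have "qRe (herm (T v) (T v)) > 0"
      by (rule orthogonal_to_negative_pos[OF v(2)])
    then show False
      using T(2)[of v] v(2) by simp
  qed
  with a show ?thesis
    using quat_real_unit by blast
qed

text \<open>The obstruction for vertical translations: comparing \<open>herm (x w) p\<close> with \<open>herm w (x p)\<close> for a
  reversing involution \<open>x\<close> gives two opposite values.\<close>

lemma jordan_block_2_not_reversible:
  assumes g: "g \<in> Sp_n1" and p: "p \<noteq> 0" "herm p p = 0" "g *v p = p *\<^sub>H e"
    and w: "g *v w = (w + p) *\<^sub>H e" "herm w p \<noteq> 0" and e: "e = 1 \<or> e = -1"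
  shows "\<not> strongly_reversible_in Sp_n1 g"
proof
  assume "strongly_reversible_in Sp_n1 g"
  then obtain x where x: "x \<in> Sp_n1" "\<And>v. x *v (x *v v) = v" "\<And>v. g *v (x *v (g *v v)) = x *v v"
    "\<And>v w. herm (x *v v) w = herm v (x *v w)"
    using strongly_reversibleE[OF _ g] by blast
  have e0: "e \<noteq> 0" "inverse e = e" "qcnj e = e" "e * e = 1"
    using e by auto
  \<comment> \<open>Invariance of \<open>herm v w\<close> under \<open>g\<close> adds the term
    \<open>herm v p\<close>, which must vanish.\<close>
  have orth: "herm v p = 0" if "g *v v = v *\<^sub>H e" for v
  proof -
    have "herm v w = herm (g *v v) (g *v w)"
      using Sp_n1_herm[OF g] by metis
    also have "\<dots> = herm v w + herm v p"
      using e by (auto simp: that w(1))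
    finally show ?thesis
      by simp
  qed
  have "g *v (x *v p) = (x *v p) *\<^sub>H e"
    using reversing_eigenvector[OF x(3) p(3) e0(1)] e0(2) by simp
  then have "herm p (x *v p) = 0"
    using orth herm_eq_0_commute by blast
  then obtain c where c: "x *v p = p *\<^sub>H c"
    using orthogonal_nonpositive_proportional[of p "x *v p"] p(1,2) Sp_n1_herm[OF x(1), of p p]
    by (metis order_refl qRe_simps(1))
  have "p *\<^sub>H (c * c - 1) = 0"
    using x(2)[of p] by (simp add: c mult_vec_rscale rscale_algebra)
  then have "c * c = 1"
    using p(1) by simp
  then have c1: "c = 1 \<or> c = -1"
    by (rule quat_square_eq_1)
  have "(g *v (x *v w) + (p *\<^sub>H c) *\<^sub>H e) *\<^sub>H e = x *v w"
    using x(3)[of w] c p(3) c1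
    by (auto simp: w(1) mult_vec_algebra rscale_algebra)
  then have "(g *v (x *v w) + (p *\<^sub>H c) *\<^sub>H e) *\<^sub>H (e * e) = (x *v w) *\<^sub>H e"
    by (metis rscale_simps(6))
  then have gxw: "g *v (x *v w) = (x *v w - p *\<^sub>H c) *\<^sub>H e"
    by (simp add: e0 rscale_algebra eq_diff_eq)
  \<comment> \<open>The multiples of \<open>p\<close> in \<open>g (x w)\<close> and
    \<open>g (w c)\<close> cancel, so \<open>k\<close> is an eigenvector: modulo eigenvectors
    \<open>x\<close> acts on \<open>w\<close> by \<open>-c\<close>, while it acts on
    \<open>p\<close> by \<open>c\<close>.\<close>
  define k where "k = x *v w + w *\<^sub>H c"
  have "g *v k = k *\<^sub>H e"
    using c1 e by (auto simp: k_def mult_vec_algebra gxw w(1) rscale_algebra)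
  then have "herm k p = 0"
    by (rule orth)
  moreover have "herm (x *v w) p = herm w p * c"
    by (simp add: x(4) c)
  then have "herm k p = 2 *\<^sub>R (herm w p * c)"
    using c1 by (elim disjE) (simp_all add: k_def scaleR_2)
  ultimately show False
    using w(2) c1 by auto
qed

section \<open>Gluing reversing involutions\<close>

text \<open>A nondegenerate invariant subspace, nondegeneracy being stated as the existence of
  orthogonal projections. The involution is global and trivial on the complement, so that the
  involutions of orthogonal pieces can simply be multiplied.\<close>

definition reversed_on :: "('m::{finite,zero}) qmat \<Rightarrow> 'm qvec set \<Rightarrow> bool"
  where "reversed_on g A \<longleftrightarrow> hsubspace A \<and> (\<forall>v. \<exists>a\<in>A. v - a \<in> orthc A) \<and> (\<forall>a\<in>A. g *v a \<in> A) \<and>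
    (\<exists>x\<in>Sp_n1. x ** x = mat 1 \<and> (\<forall>v\<in>orthc A. x *v v = v) \<and>
      (\<forall>a\<in>A. x *v (g *v (x *v (g *v a))) = a))"

lemma in_split_orthc_eq_0:
  assumes "\<And>v. \<exists>a\<in>A. v - a \<in> orthc A" "z \<in> orthc A" "\<And>b. b \<in> orthc A \<Longrightarrow> herm b z = 0"
  shows "z = 0"
proof (rule herm_nondegenerate)
  fix w
  obtain a where a: "a \<in> A" "w - a \<in> orthc A"
    using assms(1) by blast
  have "herm a z = 0"
    using assms(2) a(1) by (simp add: orthc_def)
  moreover have "herm (w - a) z = 0"
    using assms(3) a(2) .
  ultimately show "herm w z = 0"
    by simp
qed

lemma reversed_on_Int_orthc: "reversed_on g A \<Longrightarrow> v \<in> A \<Longrightarrow> v \<in> orthc A \<Longrightarrow> v = 0"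
  by (rule in_split_orthc_eq_0[of A]) (auto simp: reversed_on_def orthc_def herm_eq_0_commute)

text \<open>For \<open>b\<close> in the complement, \<open>x\<close> fixes \<open>b\<close>, so
  \<open>x a\<close> is orthogonal to \<open>b\<close> just as \<open>a\<close> is. The complement
  component of \<open>x a\<close> is thus orthogonal to the whole complement, where the form is
  nondegenerate.\<close>

lemma fixing_orthc_preserves:
  assumes "hsubspace A" "\<And>v. \<exists>a\<in>A. v - a \<in> orthc A" "x \<in> Sp_n1"
    and fix_x: "\<And>v. v \<in> orthc A \<Longrightarrow> x *v v = v" and "a \<in> A"
  shows "x *v a \<in> A"
proof -
  obtain a' where a': "a' \<in> A" "x *v a - a' \<in> orthc A"
    using assms(2) by blast
  have "x *v a - a' = 0"
  proof (rule in_split_orthc_eq_0[OF assms(2) a'(2)])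
    fix b assume b: "b \<in> orthc A"
    then have "herm b (x *v a) = herm b a"
      using Sp_n1_herm[OF assms(3), of b a] fix_x by simp
    moreover have "herm b a = 0" "herm b a' = 0"
      using b a'(1) assms(5) herm_eq_0_commute unfolding orthc_def by blast+
    ultimately show "herm b (x *v a - a') = 0"
      by simp
  qed
  with a'(1) show ?thesis
    by simp
qed

text \<open>Invariance of the complement requires that \<open>g\<close> maps \<open>A\<close> onto
  \<open>A\<close>. The involution provides the preimage \<open>x g x a\<close> of
  \<open>a\<close>.\<close>

lemma reversed_on_orthc_invariant:
  assumes g: "g \<in> Sp_n1" "reversed_on g A" and v: "v \<in> orthc A"
  shows "g *v v \<in> orthc A"
  unfolding orthc_def mem_Collect_eq
proof
  fix a assume a: "a \<in> A"
  obtain x where x: "x \<in> Sp_n1" "x ** x = mat 1" "\<And>v. v \<in> orthc A \<Longrightarrow> x *v v = v"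
    "\<And>a. a \<in> A \<Longrightarrow> x *v (g *v (x *v (g *v a))) = a"
    using g(2) by (auto simp: reversed_on_def)
  have xA: "x *v b \<in> A" if "b \<in> A" for b
    using fixing_orthc_preserves[of A x b] g(2) x that by (auto simp: reversed_on_def)
  have gA: "g *v b \<in> A" if "b \<in> A" for b
    using g(2) that by (simp add: reversed_on_def)
  define b where "b = x *v (g *v (x *v a))"
  have xx: "x *v (x *v v) = v" for v
    by (simp add: matrix_vector_mul_assoc x(2))
  have "x *v (g *v b) = x *v a"
    using x(4)[OF xA[OF a]] by (simp add: b_def)
  then have "g *v b = a"
    by (metis xx)
  moreover have "b \<in> A"
    unfolding b_def using a xA gA by blast
  ultimately show "herm a (g *v v) = 0"
    using Sp_n1_herm[OF g(1), of b v] v by (auto simp: orthc_def)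
qed

section \<open>Orthogonal sums of reversed pieces\<close>

lemma hspan_Un:
  assumes "hsubspace A" "hsubspace B"
  shows "hspan (A \<union> B) = {a + b |a b. a \<in> A \<and> b \<in> B}" (is "_ = ?C")
proof
  have "hsubspace ?C"
    unfolding hsubspace_def
  proof (intro conjI ballI allI)
    show "0 \<in> ?C"
      using hsubspaceD(1)[OF assms(1)] hsubspaceD(1)[OF assms(2)] by force
    show "v + w \<in> ?C" if vw: "v \<in> ?C" "w \<in> ?C" for v w
    proof -
      obtain a b a' b' where "v = a + b" "w = a' + b'" "a \<in> A" "b \<in> B" "a' \<in> A" "b' \<in> B"
        using vw by blast
      then have "v + w = (a + a') + (b + b')" "a + a' \<in> A" "b + b' \<in> B"
        using assms by (auto simp: hsubspaceD)
      then show ?thesis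
        by blast
    qed
    show "v *\<^sub>H c \<in> ?C" if "v \<in> ?C" for v c
      using that assms by (auto simp: rscale_algebra) (metis hsubspaceD(3))
  qed
  moreover have "A \<union> B \<subseteq> ?C"
    using hsubspaceD(1)[OF assms(1)] hsubspaceD(1)[OF assms(2)] by force
  ultimately show "hspan (A \<union> B) \<subseteq> ?C"
    by (intro hspan_minimal)
  show "?C \<subseteq> hspan (A \<union> B)"
    using hspan_superset[of "A \<union> B"] hsubspaceD(2)[OF hsubspace_hspan] by blast
qed

lemma orthc_Un: "orthc (A \<union> B) = orthc A \<inter> orthc B"
  by (auto simp: orthc_def)

text \<open>Each involution is trivial on the other piece, so the product acts as \<open>x\<close>
  on \<open>A\<close>, as \<open>y\<close> on \<open>B\<close>, and as the identity on the common
  complement.\<close>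

lemma reversed_on_Un:
  assumes A: "reversed_on g A" and B: "reversed_on g B" and AB: "B \<subseteq> orthc A"
  shows "reversed_on g (hspan (A \<union> B))"
proof -
  have hA: "hsubspace A" and hB: "hsubspace B"
    using A B by (auto simp: reversed_on_def)
  note C = hspan_Un[OF hA hB]
  have sA: "\<exists>a\<in>A. v - a \<in> orthc A" and sB: "\<exists>b\<in>B. v - b \<in> orthc B" for v
    using A B by (auto simp: reversed_on_def)
  have BA: "A \<subseteq> orthc B"
    using AB orthc_commute by blast
  obtain x where x: "x \<in> Sp_n1" "x ** x = mat 1" "\<And>v. v \<in> orthc A \<Longrightarrow> x *v v = v"
    "\<And>a. a \<in> A \<Longrightarrow> x *v (g *v (x *v (g *v a))) = a"
    using A by (auto simp: reversed_on_def)
  obtain y where y: "y \<in> Sp_n1" "y ** y = mat 1" "\<And>v. v \<in> orthc B \<Longrightarrow> y *v v = v"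
    "\<And>b. b \<in> B \<Longrightarrow> y *v (g *v (y *v (g *v b))) = b"
    using B by (auto simp: reversed_on_def)
  have xA: "x *v a \<in> A" if "a \<in> A" for a
    by (rule fixing_orthc_preserves[OF hA sA x(1) x(3) that])
  have yB: "y *v b \<in> B" if "b \<in> B" for b
    by (rule fixing_orthc_preserves[OF hB sB y(1) y(3) that])
  have gA: "g *v a \<in> A" if "a \<in> A" for a
    using A that by (simp add: reversed_on_def)
  have gB: "g *v b \<in> B" if "b \<in> B" for b
    using B that by (simp add: reversed_on_def)
  have split: "\<exists>a\<in>A. \<exists>b\<in>B. v - (a + b) \<in> orthc A \<inter> orthc B" for v
  proof -
    obtain a where a: "a \<in> A" "v - a \<in> orthc A"
      using sA by blast
    obtain b where b: "b \<in> B" "v - a - b \<in> orthc B"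
      using sB by blast
    have "v - a - b \<in> orthc A"
      using a(2) b(1) AB hsubspaceD(5)[OF hsubspace_orthc] by blast
    then show ?thesis
      using a b by (auto simp: diff_diff_eq)
  qed
  have xx: "x *v (x *v v) = v" and yy: "y *v (y *v v) = v" for v
    by (simp_all add: matrix_vector_mul_assoc x(2) y(2))
  have act: "(x ** y) *v (a + b + c) = x *v a + y *v b + c"
    if "a \<in> A" "b \<in> B" "c \<in> orthc A \<inter> orthc B" for a b c
  proof -
    have "y *v a = a" "y *v c = c" "x *v (y *v b) = y *v b" "x *v c = c"
      using that BA AB yB x(3) y(3) by blast+
    then show ?thesis
      by (simp add: matrix_vector_right_distrib flip: matrix_vector_mul_assoc)
  qed
  have 0: "0 \<in> orthc A \<inter> orthc B"
    by (simp add: orthc_def)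
  have act0: "(x ** y) *v (a + b) = x *v a + y *v b" if "a \<in> A" "b \<in> B" for a b
    using act[OF that 0] by simp
  have "x ** y \<in> Sp_n1"
    using x(1) y(1) by (rule Sp_n1_mult)
  moreover have "(x ** y) ** (x ** y) = mat 1"
    unfolding matrix_eq
  proof
    fix v
    obtain a b where ab: "a \<in> A" "b \<in> B" "v - (a + b) \<in> orthc A \<inter> orthc B"
      using split by blast
    have "(x ** y) *v ((x ** y) *v (a + b + (v - (a + b)))) = a + b + (v - (a + b))"
      using ab xA yB by (simp only: act xx yy)
    then show "((x ** y) ** (x ** y)) *v v = mat 1 *v v"
      by (simp flip: matrix_vector_mul_assoc)
  qed
  moreover have "(x ** y) *v v = v" if "v \<in> orthc A \<inter> orthc B" for v
    using act[OF hsubspaceD(1)[OF hA] hsubspaceD(1)[OF hB] that] by simp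
  moreover have "(x ** y) *v (g *v ((x ** y) *v (g *v (a + b)))) = a + b" if "a \<in> A" "b \<in> B" for a b
    using that xA yB gA gB by (simp only: act0 matrix_vector_right_distrib[of g] x(4) y(4))
  moreover have "g *v (a + b) \<in> hspan (A \<union> B)" if "a \<in> A" "b \<in> B" for a b
    using that gA gB by (auto simp: C matrix_vector_right_distrib)
  moreover have "\<exists>c\<in>hspan (A \<union> B). v - c \<in> orthc A \<inter> orthc B" for v
    using split[of v] by (auto simp: C)
  moreover have "hsubspace (hspan (A \<union> B))"
    by (rule hsubspace_hspan)
  ultimately show ?thesis
    unfolding reversed_on_def orthc_hspan orthc_Un
    by (auto simp: C intro!: bexI[of _ "x ** y"])
qed

section \<open>Lines, pairs and even eigenbases\<close>

lemma reversed_on_hspanI: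
  assumes split: "\<And>v. \<exists>a\<in>hspan S. v - a \<in> orthc S" and gS: "\<And>s. s \<in> S \<Longrightarrow> g *v s \<in> hspan S"
    and x: "x \<in> Sp_n1" "x ** x = mat 1" "\<And>v. v \<in> orthc S \<Longrightarrow> x *v v = v"
      "\<And>s. s \<in> S \<Longrightarrow> x *v (g *v (x *v (g *v s))) = s"
  shows "reversed_on g (hspan S)"
proof -
  have "hspan S \<subseteq> {v. g *v v \<in> hspan S}"
    using gS hsubspaceD[OF hsubspace_hspan[of S]]
    by (intro hspan_minimal) (auto simp: hsubspace_def mult_vec_algebra)
  moreover have "hspan S \<subseteq> {v. x *v (g *v (x *v (g *v v))) = v}"
    using x(4) by (intro hspan_minimal) (auto simp: hsubspace_def mult_vec_algebra)
  ultimately show ?thesis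
    unfolding reversed_on_def orthc_hspan using split x(1-3) hsubspace_hspan by blast
qed

lemma reversed_on_line:
  assumes "herm e e \<noteq> 0" "g *v e = e *\<^sub>H a" "a = 1 \<or> a = -1"
  shows "reversed_on g (hspan {e})"
proof (rule reversed_on_hspanI[where x = "mat 1"])
  have e: "e \<in> hspan {e}"
    using hspan_superset by blast
  show "\<exists>a\<in>hspan {e}. v - a \<in> orthc {e}" for v
    using assms(1) e
    by (intro bexI[of _ "e *\<^sub>H (inverse (herm e e) * herm e v)"])
      (auto simp: orthc_def hsubspaceD(3)[OF hsubspace_hspan] simp flip: mult.assoc)
  show "g *v s \<in> hspan {e}" if "s \<in> {e}" for s
    using that assms(2) e hsubspaceD(3)[OF hsubspace_hspan] by auto
  show "mat 1 \<in> Sp_n1"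
    by (rule mat_1_in_Sp_n1)
  show "mat 1 *v (g *v (mat 1 *v (g *v s))) = s" if "s \<in> {e}" for s
    using that assms(2,3) by (auto simp: mult_vec_algebra)
qed auto

lemma reversed_on_empty: "reversed_on g (hspan {})"
proof (rule reversed_on_hspanI[where x = "mat 1"])
  show "\<exists>a\<in>hspan {}. v - a \<in> orthc {}" for v
    using hsubspaceD(1)[OF hsubspace_hspan] by (auto simp: orthc_def)
  show "mat 1 \<in> Sp_n1"
    by (rule mat_1_in_Sp_n1)
qed auto

text \<open>The reflection in \<open>d + e u\<close>, where \<open>u\<close> conjugates \<open>a\<close> to its inverse, exchanges \<open>d\<close> and
  \<open>e\<close> up to right multiplication by \<open>u\<close>.\<close>

lemma reversed_on_pair:
  assumes de: "herm d d = 1" "herm e e = 1" "herm d e = 0"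
    and g: "g *v d = d *\<^sub>H a" "g *v e = e *\<^sub>H a" "qnormsq a = 1"
  shows "reversed_on g (hspan {d, e})"
proof -
  obtain u where u: "u * u = -1" "qcnj u = - u" "qnormsq u = 1" "u * a = qcnj a * u" "a * u = u * qcnj a"
    using exists_conjugating_unit by blast
  have ed: "herm e d = 0"
    using de(3) herm_eq_0_commute by blast
  define r where "r = d + e *\<^sub>H u"
  have rr: "herm r r = of_real 2"
    by (simp add: r_def de ed u(1,2) mult.assoc)
  then have "qRe (herm r r) = 2"
    by (simp only: qRe_simps)
  then obtain x where x: "x \<in> Sp_n1" "x ** x = mat 1"
    "\<And>v. x *v v = v - r *\<^sub>H ((2 / 2) *\<^sub>R herm r v)"
    using exists_reflection[of r 2] by auto
  have mem: "d \<in> hspan {d, e}" "e \<in> hspan {d, e}"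
    using hspan_superset by blast+
  have xd: "x *v d = - (e *\<^sub>H u)" and xe: "x *v e = d *\<^sub>H u"
    by (simp_all add: x(3) r_def de ed u(1,2) rscale_algebra)
  \<comment> \<open>Two applications of \<open>x g\<close> produce the factor \<open>a u a\<close>,
    which reduces to \<open>u\<close>; the remaining \<open>u^2 = -1\<close> cancels the sign in
    \<open>xd\<close>.\<close>
  have aua: "a * (u * a) = u"
    using qcnj_unit(2)[OF g(3)] by (simp add: u(4) flip: mult.assoc)
  show ?thesis
  proof (rule reversed_on_hspanI[where x = x])
    show "\<exists>a\<in>hspan {d, e}. v - a \<in> orthc {d, e}" for v
      by (intro bexI[of _ "d *\<^sub>H herm d v + e *\<^sub>H herm e v"] hsubspaceD[OF hsubspace_hspan] mem)
        (auto simp: orthc_def de ed)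
    show "g *v s \<in> hspan {d, e}" if "s \<in> {d, e}" for s
      using that g mem hsubspaceD(3)[OF hsubspace_hspan] by auto
    show "x *v v = v" if "v \<in> orthc {d, e}" for v
      using that by (auto simp: x(3) r_def orthc_def)
    show "x *v (g *v (x *v (g *v s))) = s" if "s \<in> {d, e}" for s
      using that u(1) aua
      by (auto simp: g(1,2) mult_vec_algebra xd xe mult.assoc)
  qed (use x in auto)
qed

lemma reversed_on_eigenbasis:
  assumes "orthonormal B" "B \<subseteq> eigenspace g a" "qnormsq a = 1" "even (card B)"
  shows "reversed_on g (hspan B)"
proof -
  have "card B = 2 * k \<Longrightarrow> orthonormal B \<Longrightarrow> B \<subseteq> eigenspace g a \<Longrightarrow> reversed_on g (hspan B)" for k B
  proof (induction k arbitrary: B)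
    case 0
    then show ?case
      using reversed_on_empty by (simp add: orthonormal_def)
  next
    case (Suc k)
    then obtain d B1 where d: "B = insert d B1" "d \<notin> B1" "card B1 = Suc (2 * k)"
      by (auto simp: card_Suc_eq)
    then obtain e B2 where e: "B1 = insert e B2" "e \<notin> B2" "card B2 = 2 * k"
      by (auto simp: card_Suc_eq)
    have o: "\<forall>b\<in>B. \<forall>c\<in>B. herm b c = (if b = c then 1 else 0)"
      using Suc(3) by (simp add: orthonormal_def)
    have "reversed_on g (hspan {d, e})"
      using Suc(4) o d e assms(3) by (intro reversed_on_pair[of d e g a]) (auto simp: eigenspace_def)
    moreover have "reversed_on g (hspan B2)"
      using Suc(3,4) d e by (intro Suc.IH) (auto intro: orthonormal_subset)
    moreover have "herm d b = 0" "herm e b = 0" if "b \<in> B2" for b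
      using that o d(1,2) e(1,2) by (metis insert_iff)+
    then have "B2 \<subseteq> orthc (hspan {d, e})"
      unfolding orthc_hspan by (auto simp: orthc_def)
    then have "hspan B2 \<subseteq> orthc (hspan {d, e})"
      by (intro hspan_minimal hsubspace_orthc)
    ultimately have "reversed_on g (hspan (hspan {d, e} \<union> hspan B2))"
      by (rule reversed_on_Un)
    moreover have "hspan (hspan {d, e} \<union> hspan B2) = hspan B"
    proof (rule antisym)
      have "hspan {d, e} \<subseteq> hspan B" "hspan B2 \<subseteq> hspan B"
        unfolding d(1) e(1)
        by (intro hspan_minimal hsubspace_hspan order_trans[OF _ hspan_superset]; blast)+
      then show "hspan (hspan {d, e} \<union> hspan B2) \<subseteq> hspan B"
        by (intro hspan_minimal hsubspace_hspan) blast
      have "B \<subseteq> hspan {d, e} \<union> hspan B2"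
        unfolding d(1) e(1) using hspan_superset[of "{d, e}"] hspan_superset[of B2] by blast
      then show "hspan B \<subseteq> hspan (hspan {d, e} \<union> hspan B2)"
        using hspan_superset by (intro hspan_minimal hsubspace_hspan) blast
    qed
    ultimately show ?case
      by simp
  qed
  with assms show ?thesis
    by (auto elim!: evenE)
qed

text \<open>It remains to exhaust the positive definite complement of \<open>A\<^sub>0\<close>. Non-real eigenspaces are
  absorbed as a whole, so each is contained in the part already treated or orthogonal to it.\<close>

lemma strongly_reversible_if_reversed_on:
  assumes g: "g \<in> Sp_n1" and A0: "reversed_on g A\<^sub>0"
    and pos: "orthc A\<^sub>0 - {0} \<subseteq> V_pos"
    and nonreal: "\<And>a. a \<notin> \<real> \<Longrightarrow> eigenspace g a \<subseteq> orthc A\<^sub>0"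
    and even: "\<And>a. positive_type g a \<Longrightarrow>
      sim_class a = {1} \<or> sim_class a = {-1} \<or> even (class_multiplicity g a)"
  shows "strongly_reversible_in Sp_n1 g"
proof -
  \<comment> \<open>The family \<open>E\<close> only measures progress: every enlargement of
    \<open>A\<close> supplies a further unit vector orthogonal to \<open>E\<close>.\<close>
  let ?P = "\<lambda>(A, E). reversed_on g A \<and> A\<^sub>0 \<subseteq> A \<and> orthonormal E \<and> E \<subseteq> A \<and>
    (\<forall>a. a \<notin> \<real> \<longrightarrow> eigenspace g a \<subseteq> A \<or> eigenspace g a \<subseteq> orthc A)"
  obtain X where X: "?P X" and max: "\<And>Y. ?P Y \<Longrightarrow> card (snd Y) \<le> card (snd X)"
    by (rule exists_max_card_orthonormal[of ?P "(A\<^sub>0, {})" snd])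
      (use A0 nonreal in \<open>auto simp: orthonormal_def\<close>)
  obtain A E where X_eq: "X = (A, E)"
    by (cases X)
  have A: "reversed_on g A" "A\<^sub>0 \<subseteq> A" "orthonormal E" "E \<subseteq> A"
    and sat: "\<And>a. a \<notin> \<real> \<Longrightarrow> eigenspace g a \<subseteq> A \<or> eigenspace g a \<subseteq> orthc A"
    using X by (auto simp: X_eq)
  have hA: "hsubspace A" and sA: "\<And>v. \<exists>a\<in>A. v - a \<in> orthc A"
    using A(1) by (auto simp: reversed_on_def)
  have posA: "orthc A - {0} \<subseteq> V_pos"
    using pos A(2) by (auto simp: orthc_def)
  have extend: False
    if B: "reversed_on g (hspan B)" "B \<subseteq> orthc A" and e: "e \<in> hspan B" "herm e e = 1"
      and satB: "\<And>b. b \<notin> \<real> \<Longrightarrow> eigenspace g b \<subseteq> hspan B \<or> eigenspace g b \<subseteq> orthc B" for B e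
  proof -
    have BA: "hspan B \<subseteq> orthc A"
      using B(2) by (intro hspan_minimal hsubspace_orthc)
    let ?A = "hspan (A \<union> hspan B)"
    have sub: "A \<subseteq> ?A" "hspan B \<subseteq> ?A"
      using hspan_superset by blast+
    have "reversed_on g ?A"
      using A(1) B(1) BA by (rule reversed_on_Un)
    moreover have "e \<in> orthc E"
      using e(1) BA A(4) by (auto simp: orthc_def)
    then have "orthonormal (insert e E)" "e \<notin> E"
      using orthonormal_insert[OF A(3)] e(2) by blast+
    moreover have "insert e E \<subseteq> ?A" "A\<^sub>0 \<subseteq> ?A"
      using A(2,4) e(1) sub by blast+
    moreover have "eigenspace g b \<subseteq> ?A \<or> eigenspace g b \<subseteq> orthc ?A" if "b \<notin> \<real>" for b
      using sat[OF that] satB[OF that] sub by (auto simp: orthc_Un)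
    ultimately have "card (insert e E) \<le> card E"
      using max[of "(?A, insert e E)"] by (simp add: X_eq)
    with \<open>e \<notin> E\<close> A(3) show False
      by (simp add: orthonormal_def)
  qed
  have "orthc A \<subseteq> {0}"
  proof (rule ccontr)
    assume "\<not> ?thesis"
    then obtain v where v: "v \<in> orthc A" "v \<noteq> 0"
      by blast
    obtain e0 a where e0: "e0 \<in> orthc A" "e0 \<noteq> 0" "g *v e0 = e0 *\<^sub>H a"
      using exists_eigenvector[OF hsubspace_orthc reversed_on_orthc_invariant[OF g A(1)] v] by blast
    then obtain r where r: "herm (r *\<^sub>R e0) (r *\<^sub>R e0) = 1"
      using posA normalize_positive[of e0] by (auto simp: V_pos_def)
    define e where "e = r *\<^sub>R e0"
    have e: "herm e e = 1" "e \<in> orthc A" "g *v e = e *\<^sub>H a"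
      using r e0 by (auto simp: e_def hsubspaceD[OF hsubspace_orthc] mult_vec_scaleR rscale_scaleR)
    have a: "qnormsq a = 1"
      using eigenvalue_nonnull_unit[OF g e(3)] e(1) by simp
    show False
    proof (cases "a \<in> \<real>")
      case True
      then have a1: "a = 1 \<or> a = -1"
        using a quat_real_unit by blast
      show False
      proof (rule extend[of "{e}" e])
        show "reversed_on g (hspan {e})"
          using e(1) by (intro reversed_on_line[OF _ e(3) a1]) auto
        \<comment> \<open>Eigenvectors for a real and a non-real eigenvalue are orthogonal, so
          adding a real eigenline cuts no non-real eigenspace.\<close>
        show "eigenspace g b \<subseteq> hspan {e} \<or> eigenspace g b \<subseteq> orthc {e}" if "b \<notin> \<real>" for b
        proof -
          have "herm e w = 0" if "w \<in> eigenspace g b" for w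
          proof -
            have "a * herm e w = herm e w * b"
              using eigenvector_herm_commute[OF g e(3) _ a] that by (simp add: eigenspace_def)
            moreover have "a * herm e w = herm e w * a"
              using a1 by auto
            ultimately have "herm e w * b = herm e w * a"
              by metis
            moreover have "b \<noteq> a"
              using True \<open>b \<notin> \<real>\<close> by auto
            ultimately show ?thesis
              by (metis mult_left_cancel)
          qed
          then show ?thesis
            by (auto simp: orthc_def)
        qed
      qed (use e hspan_superset in auto)
    next
      case False
      have "e \<notin> A"
        using reversed_on_Int_orthc[OF A(1) _ e(2)] e(1) by auto
      then have VA: "eigenspace g a \<subseteq> orthc A"
        using sat[OF False] e(3) by (auto simp: eigenspace_def)
      then have posV: "eigenspace g a - {0} \<subseteq> V_pos"
        using posA by blast
      have "positive_type g a"
        unfolding positive_type_def eigenvalue_def using posV e(1,3) by force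
      then have ev: "even (class_multiplicity g a)"
        using even False mem_sim_class by (metis Reals_1 Reals_minus_iff singletonD)
      obtain B where B: "orthonormal B" "B \<subseteq> eigenspace g a" "eigenspace g a \<subseteq> hspan B"
        using exists_orthonormal_eigenbasis[OF g a posV] by blast
      show False
      proof (rule extend[of B e])
        show "reversed_on g (hspan B)"
          using ev class_multiplicity_eq_card[OF B] by (intro reversed_on_eigenbasis[OF B(1,2) a]) simp
        \<comment> \<open>A nonzero Gram entry \<open>h\<close> between the two eigenspaces makes
          \<open>b\<close> similar to \<open>a\<close>; right multiplication by the inverse of
          \<open>h\<close> then carries the eigenspace of \<open>b\<close> into that of
          \<open>a\<close>, which \<open>B\<close> spans.\<close>
        show "eigenspace g b \<subseteq> hspan B \<or> eigenspace g b \<subseteq> orthc B" for b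
        proof (cases "eigenspace g b \<subseteq> orthc B")
          case False
          then obtain w c where w: "w \<in> eigenspace g b" "c \<in> B" "herm c w \<noteq> 0"
            by (auto simp: orthc_def)
          define h where "h = herm c w"
          have h: "a * h = h * b" "h \<noteq> 0"
            using w B(2) eigenvector_herm_commute[OF g _ _ a, of c w b]
            by (auto simp: h_def eigenspace_def)
          have "z \<in> hspan B" if z: "z \<in> eigenspace g b" for z
          proof -
            have "b * inverse h = inverse h * (h * b) * inverse h"
              using h(2) by (simp flip: mult.assoc)
            also have "\<dots> = inverse h * (a * h) * inverse h"
              by (simp only: h(1))
            also have "\<dots> = inverse h * a"
              using h(2) by (simp add: mult.assoc)
            finally have "b * inverse h = inverse h * a" .
            then have "z *\<^sub>H inverse h \<in> eigenspace g a"
              using z by (simp add: eigenspace_def mult_vec_rscale)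
            then have "(z *\<^sub>H inverse h) *\<^sub>H h \<in> hspan B"
              using B(3) by (blast intro: hsubspaceD(3)[OF hsubspace_hspan])
            then show ?thesis
              using h(2) by simp
          qed
          then show ?thesis
            by blast
        qed simp
      qed (use e B VA in \<open>auto simp: eigenspace_def\<close>)
    qed
  qed
  have "v \<in> A" for v
  proof -
    obtain a where "a \<in> A" "v - a \<in> orthc A"
      using sA by blast
    with \<open>orthc A \<subseteq> {0}\<close> show ?thesis
      by auto
  qed
  then show ?thesis
    using A(1) strongly_reversibleI[OF _ _ _ g] by (auto simp: reversed_on_def)
qed

section \<open>Unipotent isometries\<close>

lemma mult_vec_minus_one: "(A - mat 1) *v v = A *v v - v" for A :: "'m::finite qmat"
  by (simp add: matrix_vector_mult_diff_rdistrib)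

text \<open>With \<open>N = g - mat 1\<close> and \<open>k\<close> its nilpotency index, the images
  of \<open>N^i\<close> and \<open>N^j\<close> are orthogonal once \<open>i + j\<close> is at least
  \<open>k\<close>. If \<open>k\<close> were at least 4, then \<open>N^(k-1) v\<close> and
  \<open>N^(k-2) v\<close> would be null and orthogonal, hence proportional, and applying
  \<open>N\<close> would kill \<open>N^(k-1) v\<close>.\<close>

lemma unipotent_cube_eq_0:
  fixes g :: "'m::{finite,zero} qmat"
  assumes g: "g \<in> Sp_n1" and "unipotent g"
  shows "(g - mat 1) *v ((g - mat 1) *v ((g - mat 1) *v v)) = 0"
proof -
  define N where "N = g - mat 1"
  define P where "P i v = mat_pow N i *v v" for i v
  have P_Suc: "P (Suc i) v = N *v P i v" and P_0: "P 0 v = v" for i v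
    by (simp_all add: P_def flip: matrix_vector_mul_assoc)
  have Ng: "N *v v = g *v v - v" for v
    by (simp add: N_def mult_vec_minus_one)
  define k where "k = (LEAST k. mat_pow N k = 0)"
  have k: "mat_pow N k = 0"
    using assms(2) unfolding k_def unipotent_def N_def by (rule LeastI_ex)
  have k_min: "mat_pow N i \<noteq> 0" if "i < k" for i
    using that not_less_Least unfolding k_def by blast
  have Pk: "P i v = 0" if "i \<ge> k" for i v
    using that by (induction rule: dec_induct) (simp_all add: P_Suc, simp add: P_def k)
  have Pg: "P i (g *v w) = g *v P i w" for i w
    by (induction i) (simp_all add: P_0 P_Suc Ng mult_vec_algebra)
  have orth: "herm (P i v) (P j w) = 0" if "i + j \<ge> k" for i j v w
    using that
  proof (induction i arbitrary: j w)
    case 0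
    then show ?case
      by (simp add: Pk)
  next
    case (Suc i)
    \<comment> \<open>Writing the second argument as an image under \<open>g\<close> allows one
      factor \<open>N\<close> to cross the form, at the cost of a sign.\<close>
    define w' where "w' = matrix_inv g *v w"
    have "P j w = g *v P j w'"
      by (simp add: w'_def Sp_n1_inv_cancel[OF g] flip: Pg)
    then have "herm (P (Suc i) v) (P j w) = herm (P i v) (P j w') - herm (P i v) (g *v P j w')"
      by (simp add: P_Suc Ng Sp_n1_herm[OF g])
    also have "\<dots> = - herm (P i v) (P (Suc j) w')"
      by (simp add: P_Suc Ng)
    finally show ?case
      using Suc by simp
  qed
  have "k \<le> 3"
  proof (rule ccontr)
    assume "\<not> ?thesis"
    then obtain m where m: "k = Suc (Suc m)" "m \<ge> 2"
      by (metis Suc_le_D not_less_eq_eq numeral_2_eq_2 numeral_3_eq_3 Suc_le_mono)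
    obtain v where v: "P (Suc m) v \<noteq> 0"
      using k_min[of "Suc m"] m(1) by (auto simp: P_def matrix_eq)
    have "herm (P (Suc m) v) (P (Suc m) v) = 0" "herm (P (Suc m) v) (P m v) = 0"
      "herm (P m v) (P m v) = 0"
      using m by (auto intro!: orth)
    then obtain c where "P m v = P (Suc m) v *\<^sub>H c"
      using orthogonal_nonpositive_proportional[OF v] by (metis order_refl qRe_simps(1))
    then have "P (Suc m) v = P (Suc (Suc m)) v *\<^sub>H c"
      by (metis P_Suc mult_vec_rscale)
    with v Pk m(1) show False
      by simp
  qed
  then have "P (Suc (Suc (Suc 0))) v = 0"
    by (intro Pk) simp
  then show ?thesis
    by (simp add: P_Suc P_0 N_def)
qed

lemma isometry_minus_one:
  assumes "g \<in> Sp_n1"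
  defines "N \<equiv> g - mat 1"
  shows "herm (N *v v) w + herm v (N *v w) + herm (N *v v) (N *v w) = 0"
  using Sp_n1_herm[OF assms(1), of v w] by (simp add: N_def mult_vec_minus_one)

text \<open>\<open>X\<close> is the logarithm of \<open>g\<close>, hence skew.\<close>

lemma unipotent_log:
  fixes g :: "'m::{finite,zero} qmat"
  assumes g: "g \<in> Sp_n1" and N3: "\<And>v. (g - mat 1) *v ((g - mat 1) *v ((g - mat 1) *v v)) = 0"
  obtains X :: "'m qmat" where "\<And>v. g *v v = v + X *v v + (1 / 2) *\<^sub>R (X *v (X *v v))"
    "\<And>v. X *v (X *v (X *v v)) = 0" "\<And>v w. herm (X *v v) w = - herm v (X *v w)"
    "\<And>v. X *v (X *v v) = (g - mat 1) *v ((g - mat 1) *v v)"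
    "\<And>h v. h ** g = g ** h \<Longrightarrow> h *v (X *v v) = X *v (h *v v)"
proof -
  define N where "N = g - mat 1"
  have N3: "N *v (N *v (N *v v)) = 0" for v
    using N3 by (simp add: N_def)
  \<comment> \<open>The logarithm series stops after the quadratic term because
    \<open>N^3 = 0\<close>.\<close>
  obtain X where X: "\<And>v. X *v v = N *v v - (1 / 2) *\<^sub>R (N *v (N *v v))"
    by (rule exists_matrix_of_hlinear[of "\<lambda>v. N *v v - (1 / 2) *\<^sub>R (N *v (N *v v))"])
      (auto simp: mult_vec_algebra rscale_algebra rscale_scaleR scaleR_right_distrib)
  have X2: "X *v (X *v v) = N *v (N *v v)" for v
    by (simp add: X mult_vec_algebra mult_vec_scaleR N3)
  show ?thesis
  proof (rule that)
    show "g *v v = v + X *v v + (1 / 2) *\<^sub>R (X *v (X *v v))" for v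
      by (simp add: X2) (simp add: X N_def mult_vec_minus_one)
    show "X *v (X *v (X *v v)) = 0" for v
      unfolding X2 unfolding X by (simp add: mult_vec_algebra mult_vec_scaleR N3)
    show "X *v (X *v v) = (g - mat 1) *v ((g - mat 1) *v v)" for v
      by (simp add: X2 N_def)
    show "h *v (X *v v) = X *v (h *v v)" if "h ** g = g ** h" for h v
    proof -
      have "h *v (g *v v) = g *v (h *v v)" for v
        using that by (simp add: matrix_vector_mul_assoc)
      then have hN: "h *v (N *v v) = N *v (h *v v)" for v
        by (simp add: N_def mult_vec_minus_one mult_vec_algebra)
      show ?thesis
        by (simp add: X mult_vec_algebra mult_vec_scaleR hN)
    qed
    show "herm (X *v v) w = - herm v (X *v w)" for v w
    proof -
      note iso = isometry_minus_one[OF g, folded N_def]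
      \<comment> \<open>With the fourth-order term zero, the third-order terms cancel. The relations
        for \<open>(N v, w)\<close> and \<open>(v, N w)\<close> then express
        \<open>herm (N v) (N w)\<close> through \<open>N^2\<close>, exactly as the quadratic term of
        \<open>X\<close> demands.\<close>
      have 0: "herm (N *v (N *v v)) (N *v (N *v w)) = 0"
        using iso[of "N *v v" "N *v (N *v w)"] by (simp add: N3)
      have "herm (N *v (N *v v)) (N *v w) + herm (N *v v) (N *v (N *v w)) = 0"
        using iso[of "N *v v" "N *v w"] 0 by simp
      then show ?thesis
        using iso[of v w] iso[of "N *v v" w] iso[of v "N *v w"]
        by (simp add: X quat_eq_iff plus_quat_def zero_quat_def minus_quat_def uminus_quat_def
            scaleR_quat_def algebra_simps)
    qed
  qed
qed

section \<open>Jordan blocks of size three and two\<close>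

lemma exists_eigenvector_not_orthogonal:
  fixes h :: "'m::{finite,zero} qmat"
  assumes "semisimple h" "p \<noteq> 0"
  obtains w b where "h *v w = w *\<^sub>H b" "herm p w \<noteq> 0"
proof (rule ccontr)
  assume "\<not> thesis"
  with that have "{v. \<exists>a. v \<in> eigenspace h a} \<subseteq> orthc {p}"
    by (auto simp: eigenspace_def orthc_def)
  then have "hspan {v. \<exists>a. v \<in> eigenspace h a} \<subseteq> orthc {p}"
    by (rule hspan_minimal) (rule hsubspace_orthc)
  then have "herm w p = 0" for w
    using assms(1) herm_eq_0_commute unfolding semisimple_def orthc_def by blast
  then have "p = 0"
    by (rule herm_nondegenerate)
  with assms(2) show False ..
qed

lemma eq_0_if_real_conjugation_fixes:
  fixes h :: quat
  assumes "e = 1 \<or> e = -1" "a \<notin> \<real>" "h = e * h * a"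
  shows "h = 0"
proof (rule ccontr)
  assume "h \<noteq> 0"
  have "h * (e * a) = e * h * a"
    using assms(1) by auto
  then have "h * (e * a) = h * 1"
    by (metis assms(3) mult.right_neutral)
  then have "e * a = 1"
    using \<open>h \<noteq> 0\<close> by simp
  then have "a = e"
    using assms(1) by (auto simp: minus_equation_iff)
  with assms(1,2) show False
    by auto
qed

text \<open>On the block \<open>X\<close> sends \<open>v\<close> to \<open>y\<close>,
  \<open>y\<close> to \<open>p\<close> and \<open>p\<close> to zero, while \<open>gs\<close> acts by
  the sign \<open>e\<close>. The reflection in \<open>y\<close> fixes \<open>v\<close> and
  \<open>p\<close>, hence conjugates \<open>X\<close> to \<open>-X\<close> and \<open>gu\<close> to
  its inverse; the sign is its own inverse.\<close>

lemma jordan_block_3_strongly_reversible: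
  fixes g :: "'m::{finite,zero} qmat"
  assumes g: "g \<in> Sp_n1" "gs \<in> Sp_n1" "gu \<in> Sp_n1" "g = gs ** gu" "g = gu ** gs" "semisimple gs"
    and N3: "\<And>v. (gu - mat 1) *v ((gu - mat 1) *v ((gu - mat 1) *v v)) = 0"
    and N2: "(gu - mat 1) *v ((gu - mat 1) *v v\<^sub>0) \<noteq> 0"
    and null: "\<And>p c. p \<noteq> 0 \<Longrightarrow> herm p p = 0 \<Longrightarrow> g *v p = p *\<^sub>H c \<Longrightarrow> c = 1 \<or> c = -1"
    and even: "\<And>a. positive_type g a \<Longrightarrow>
      sim_class a = {1} \<or> sim_class a = {-1} \<or> even (class_multiplicity g a)"
  shows "strongly_reversible_in Sp_n1 g"
proof -
  obtain X :: "'m qmat" where X: "\<And>v. gu *v v = v + X *v v + (1 / 2) *\<^sub>R (X *v (X *v v))"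
    and X3: "\<And>v. X *v (X *v (X *v v)) = 0" and skew: "\<And>v w. herm (X *v v) w = - herm v (X *v w)"
    and X2: "\<And>v. X *v (X *v v) = (gu - mat 1) *v ((gu - mat 1) *v v)"
    and Xcomm: "\<And>h v. h ** gu = gu ** h \<Longrightarrow> h *v (X *v v) = X *v (h *v v)"
    by (rule unipotent_log[OF g(3) N3]) blast
  have gsX: "gs *v (X *v v) = X *v (gs *v v)" for v
    using g(4,5) by (intro Xcomm) simp
  have gsgu: "g *v v = gs *v (gu *v v)" for v
    by (simp add: g(4) matrix_vector_mul_assoc)
  define p\<^sub>0 where "p\<^sub>0 = X *v (X *v v\<^sub>0)"
  have p0: "p\<^sub>0 \<noteq> 0" "herm p\<^sub>0 p\<^sub>0 = 0"
    using N2 by (simp_all add: p\<^sub>0_def skew X3) (simp add: X2)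
  \<comment> \<open>By skewness all pairings between images of \<open>X^2\<close> involve
    \<open>X^3\<close> and vanish, so these images lie on one null line. As \<open>gs\<close>
    commutes with \<open>X\<close>, it preserves that line.\<close>
  have XXp0: "\<exists>c. X *v (X *v w) = p\<^sub>0 *\<^sub>H c" for w
  proof -
    have "herm p\<^sub>0 (X *v (X *v w)) = 0" "herm (X *v (X *v w)) (X *v (X *v w)) = 0"
      by (simp_all add: p\<^sub>0_def skew X3)
    then show ?thesis
      using orthogonal_nonpositive_proportional[OF p0(1)] p0(2) by (metis order_refl qRe_simps(1))
  qed
  obtain e where gsp0: "gs *v p\<^sub>0 = p\<^sub>0 *\<^sub>H e"
    using XXp0[of "gs *v v\<^sub>0"] by (auto simp: p\<^sub>0_def gsX)
  have "g *v p\<^sub>0 = p\<^sub>0 *\<^sub>H e"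
    by (simp add: gsgu X flip: gsp0) (simp add: p\<^sub>0_def X3)
  then have e: "e = 1 \<or> e = -1"
    using null p0 by blast
  have ee: "e * e = 1" "e * c = c * e" "qnormsq e = 1" "qcnj e = e" for c
    using e by auto
  \<comment> \<open>The vector \<open>v\<^sub>0\<close> need not be an eigenvector of
    \<open>gs\<close>. It is replaced by one that is not orthogonal to \<open>p\<^sub>0\<close>,
    whose eigenvalue is then forced to be \<open>e\<close>.\<close>
  obtain v\<^sub>1 b where v1: "gs *v v\<^sub>1 = v\<^sub>1 *\<^sub>H b" "herm p\<^sub>0 v\<^sub>1 \<noteq> 0"
    using exists_eigenvector_not_orthogonal[OF g(6) p0(1)] by blast
  have "e * herm p\<^sub>0 v\<^sub>1 = herm p\<^sub>0 v\<^sub>1 * b"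
    by (rule eigenvector_herm_commute[OF g(2) gsp0 v1(1) ee(3)])
  then have be: "b = e"
    using v1(2) ee(2) by (metis mult_left_cancel)
  define p where "p = X *v (X *v v\<^sub>1)"
  define y\<^sub>1 where "y\<^sub>1 = X *v v\<^sub>1"
  have Xy1: "X *v y\<^sub>1 = p" and Xp: "X *v p = 0"
    by (simp_all add: y\<^sub>1_def p_def X3)
  have pp: "herm p p = 0" "herm p y\<^sub>1 = 0" "herm y\<^sub>1 p = 0"
    unfolding p_def y\<^sub>1_def by (simp_all add: skew X3)
  have sym: "herm p w = herm v\<^sub>1 (X *v (X *v w))" for w
    by (simp add: p_def skew)
  define t where "t = qRe (herm v\<^sub>1 p)"
  have "qcnj (herm v\<^sub>1 p) = herm v\<^sub>1 p"
    by (metis herm_commute sym p_def)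
  then have t1: "herm v\<^sub>1 p = of_real t"
    unfolding t_def by (intro quat_real_eq) (simp add: qcnj_fixed_iff)
  moreover have "herm p v\<^sub>1 = of_real t"
    unfolding herm_commute[of p v\<^sub>1] t1 by simp
  ultimately have t: "herm v\<^sub>1 p = of_real t" "herm p v\<^sub>1 = of_real t"
    by blast+
  have t0: "t \<noteq> 0"
  proof
    assume "t = 0"
    obtain c where c: "p = p\<^sub>0 *\<^sub>H c"
      using XXp0 p_def by blast
    have "herm v\<^sub>1 p\<^sub>0 \<noteq> 0"
      using v1(2) herm_eq_0_commute by blast
    then have "c = 0"
      using t(1) c \<open>t = 0\<close> by simp
    then have "herm v\<^sub>0 p = 0"
      by (simp add: c)
    moreover have "herm p\<^sub>0 v\<^sub>1 = herm v\<^sub>0 p"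
      by (simp add: p\<^sub>0_def p_def skew)
    ultimately show False
      using v1(2) by simp
  qed
  have yy: "herm y\<^sub>1 y\<^sub>1 = - of_real t"
    by (simp add: y\<^sub>1_def skew t(1)[unfolded p_def])
  define s where "s = herm v\<^sub>1 y\<^sub>1"
  have s: "qcnj s = - s" "herm y\<^sub>1 v\<^sub>1 = - s"
    unfolding s_def herm_commute[symmetric] by (simp_all add: y\<^sub>1_def skew)
  text \<open>Adding multiples of \<open>X v\<^sub>1\<close> and \<open>X\<^sup>2 v\<^sub>1\<close> makes \<open>v\<^sub>1\<close> null and orthogonal to its image.\<close>
  define \<alpha> where "\<alpha> = (- 1 / (2 * t)) *\<^sub>R s"
  define v\<^sub>2 where "v\<^sub>2 = v\<^sub>1 + y\<^sub>1 *\<^sub>H \<alpha>"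
  define c\<^sub>0 where "c\<^sub>0 = qRe (herm v\<^sub>2 v\<^sub>2)"
  define v where "v = v\<^sub>2 + (- c\<^sub>0 / (2 * t)) *\<^sub>R p"
  define y where "y = X *v v"
  have y_eq: "y = y\<^sub>1 + p *\<^sub>H \<alpha>"
    by (simp add: y_def v_def v\<^sub>2_def mult_vec_algebra mult_vec_scaleR Xp Xy1) (simp add: y\<^sub>1_def)
  have Xy: "X *v y = p"
    by (simp add: y_eq mult_vec_algebra Xp Xy1)
  have v2p: "herm v\<^sub>2 p = of_real t" "herm p v\<^sub>2 = of_real t"
    by (simp_all add: v\<^sub>2_def t pp)
  have vp: "herm v p = of_real t" "herm p v = of_real t"
    by (simp_all add: v_def v2p pp)
  have py: "herm p y = 0" "herm y p = 0"
    by (simp_all add: y_eq pp)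
  \<comment> \<open>Since \<open>s\<close> is purely imaginary,
    \<open>qcnj \<alpha> = - \<alpha>\<close>, and both corrections contribute \<open>-s/2\<close>;
    this fixes the constant in \<open>\<alpha>\<close>.\<close>
  have "herm v\<^sub>2 y = s + (of_real t * \<alpha> - qcnj \<alpha> * of_real t)"
    by (simp add: v\<^sub>2_def y_eq t yy pp s_def)
  also have "\<dots> = s + ((- 1 / 2) *\<^sub>R s + (- 1 / 2) *\<^sub>R s)"
    using t0 by (simp add: \<alpha>_def s(1) of_real_def)
  also have "\<dots> = 0"
    by (simp add: quat_simps)
  finally have vy: "herm v y = 0" "herm y v = 0"
    by (simp_all add: v_def py herm_eq_0_commute[of y])
  \<comment> \<open>Adding a real multiple \<open>r p\<close> to \<open>v\<^sub>2\<close> changes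
    its norm by \<open>2 r t\<close>, whence the coefficient
    \<open>- c\<^sub>0 / (2 * t)\<close>.\<close>
  have vv: "herm v v = 0"
    unfolding herm_self_eq_0_iff using t0 by (simp add: v_def v2p pp c\<^sub>0_def)
  have yy: "herm y y = of_real (- t)"
    using skew[of v y] by (simp add: Xy vp flip: y_def)
  have p_nz: "p \<noteq> 0"
    using t(1) t0 by auto
  \<comment> \<open>A nonpositive \<open>y\<close> orthogonal to the null vector \<open>p\<close>
    would be a multiple of \<open>p\<close>, but \<open>X\<close> kills \<open>p\<close> and not
    \<open>y\<close>.\<close>
  have tneg: "t < 0"
  proof (rule ccontr)
    assume "\<not> t < 0"
    then obtain c where "y = p *\<^sub>H c"
      using orthogonal_nonpositive_proportional[OF p_nz _ py(1)] pp(1) yy by fastforce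
    then have "p = 0"
      using Xy Xp by (simp add: mult_vec_rscale)
    with p_nz show False ..
  qed
  have gsv1: "gs *v v\<^sub>1 = v\<^sub>1 *\<^sub>H e"
    using v1(1) be by simp
  have gsy1: "gs *v y\<^sub>1 = y\<^sub>1 *\<^sub>H e" and gsp: "gs *v p = p *\<^sub>H e"
    by (simp_all add: y\<^sub>1_def p_def gsX gsv1 mult_vec_rscale)
  have gsv: "gs *v v = v *\<^sub>H e"
    by (simp add: v_def v\<^sub>2_def mult_vec_algebra mult_vec_scaleR gsv1 gsy1 gsp rscale_algebra rscale_scaleR ee(2))
  have gsy: "gs *v y = y *\<^sub>H e"
    by (simp add: y_def gsX gsv mult_vec_rscale)
  have gv: "g *v v = (v + y + (1 / 2) *\<^sub>R p) *\<^sub>H e"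
    by (simp add: gsgu X gsv gsy gsp mult_vec_algebra mult_vec_scaleR rscale_algebra rscale_scaleR flip: y_def)
      (simp add: Xy gsp rscale_scaleR)
  have gy: "g *v y = (y + p) *\<^sub>H e"
    by (simp add: gsgu X Xy Xp gsy gsp mult_vec_algebra rscale_algebra)
  have gp: "g *v p = p *\<^sub>H e"
    by (simp add: gsgu X Xp gsp)
  have "qRe (herm y y) = - t" "- t \<noteq> 0"
    using yy t0 by simp_all
  then obtain x where x: "x \<in> Sp_n1" "x ** x = mat 1"
    "\<And>z. x *v z = z - y *\<^sub>H ((2 / - t) *\<^sub>R herm y z)"
    by (rule exists_reflection) blast
  have xv: "x *v v = v" and xp: "x *v p = p"
    by (simp_all add: x(3) vy py)
  have xy: "x *v y = - y"
    using t0 rscale_algebra(3)[of y 1 1] by (simp add: x(3) yy of_real_def scaleR_2)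
  have mem: "v \<in> hspan {v, y, p}" "y \<in> hspan {v, y, p}" "p \<in> hspan {v, y, p}"
    using hspan_superset[of "{v, y, p}"] by auto
  have tt: "of_real t * ((1 / t) *\<^sub>R q) = q" for q
    using t0 by (simp add: of_real_def)
  have "reversed_on g (hspan {v, y, p})"
  proof (rule reversed_on_hspanI[where x = x])
    show "\<exists>a\<in>hspan {v, y, p}. z - a \<in> orthc {v, y, p}" for z
      using t0
      by (intro bexI[of _ "v *\<^sub>H ((1 / t) *\<^sub>R herm p z) + y *\<^sub>H ((- 1 / t) *\<^sub>R herm y z) + p *\<^sub>H ((1 / t) *\<^sub>R herm v z)"]
            hsubspaceD[OF hsubspace_hspan] mem)
        (auto simp: orthc_def vv vy vp py pp yy tt of_real_def)
    show "g *v z \<in> hspan {v, y, p}" if "z \<in> {v, y, p}" for z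
      using that mem by (auto simp: gv gy gp intro!: hsubspaceD[OF hsubspace_hspan])
    show "x *v z = z" if "z \<in> orthc {v, y, p}" for z
      using that by (simp add: x(3) orthc_def)
    show "x *v (g *v (x *v (g *v z))) = z" if "z \<in> {v, y, p}" for z
    proof -
      have half: "(1 / 2) *\<^sub>R p + (1 / 2) *\<^sub>R p = p"
        by (simp flip: scaleR_left_distrib)
      have 1: "g *v ((v - y + (1 / 2) *\<^sub>R p) *\<^sub>H e) = v"
        by (simp add: mult_vec_algebra mult_vec_scaleR gv gy gp ee(1) rscale_algebra rscale_scaleR)
          (simp add: diff_add_eq half)
      have 2: "g *v ((p - y) *\<^sub>H e) = - y"
        by (simp add: mult_vec_algebra gy gp ee(1) rscale_algebra)
      have 3: "x *v (g *v v) = (v - y + (1 / 2) *\<^sub>R p) *\<^sub>H e" "x *v (g *v y) = (p - y) *\<^sub>H e"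
        by (simp_all add: gv gy mult_vec_algebra mult_vec_scaleR xv xy xp rscale_algebra)
      have "x *v (g *v (x *v (g *v v))) = v" "x *v (g *v (x *v (g *v y))) = y"
        by (simp_all only: 3 1 2 xv mult_vec_minus xy minus_minus)
      moreover have "x *v (g *v (x *v (g *v p))) = p"
        by (simp add: gp mult_vec_rscale xp ee(1))
      ultimately show ?thesis
        using that by blast
    qed
  qed (use x in auto)
  then show ?thesis
  proof (rule strongly_reversible_if_reversed_on[OF g(1) _ _ _ even])
    have neg: "qRe (herm (v + p) (v + p)) < 0"
      using tneg by (simp add: vv vp pp)
    show "orthc (hspan {v, y, p}) - {0} \<subseteq> V_pos"
      unfolding orthc_hspan V_pos_def
      by (auto intro!: orthogonal_to_negative_pos[OF neg] simp: orthc_def)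
    show "eigenspace g a \<subseteq> orthc (hspan {v, y, p})" if a: "a \<notin> \<real>" for a
    proof
      fix u assume "u \<in> eigenspace g a"
      then have u: "g *v u = u *\<^sub>H a"
        by (simp add: eigenspace_def)
      have h: "herm z u = e * herm z' u * a" if "g *v z = z' *\<^sub>H e" for z z'
        using Sp_n1_herm[OF g(1), of z u] that u by (simp add: ee(4) mult.assoc)
      note z = eq_0_if_real_conjugation_fixes[OF e a]
      \<comment> \<open>The invariance relations are triangular: the extra terms for
        \<open>y\<close> involve \<open>p\<close>, and those for \<open>v\<close> involve
        \<open>y\<close> and \<open>p\<close>, which have already been shown orthogonal to
        \<open>u\<close>.\<close>
      have "herm p u = 0"
        using h[OF gp] by (rule z)
      moreover from this have "herm y u = 0"
        using h[OF gy] by (intro z) simp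
      moreover from calculation have "herm v u = 0"
        using h[OF gv] by (intro z) simp
      ultimately show "u \<in> orthc (hspan {v, y, p})"
        unfolding orthc_hspan by (simp add: orthc_def)
    qed
  qed
qed

text \<open>Here \<open>N = gu - mat 1\<close> is itself skew, and its image is one null line. An
  eigenvector \<open>w\<close> of \<open>gs\<close> off the hyperplane orthogonal to that line has
  the same eigenvalue \<open>e\<close> as the line; reversibility makes \<open>e\<close> real, the
  pairing gives \<open>e * e = 1\<close>, and \<open>w\<close>, \<open>N w\<close> form a block of
  size two.\<close>

lemma square_zero_part_not_reversible:
  fixes g :: "'m::{finite,zero} qmat"
  assumes g: "g \<in> Sp_n1" "gs \<in> Sp_n1" "gu \<in> Sp_n1" "g = gs ** gu" "g = gu ** gs" "semisimple gs"
    and N2: "\<And>v. (gu - mat 1) *v ((gu - mat 1) *v v) = 0" and N1: "gu \<noteq> mat 1"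
  shows "\<not> strongly_reversible_in Sp_n1 g"
proof
  assume sr: "strongly_reversible_in Sp_n1 g"
  define N where "N = gu - mat 1"
  have NN: "N *v (N *v v) = 0" for v
    using N2 by (simp add: N_def)
  have Ngu: "gu *v v = v + N *v v" for v
    by (simp add: N_def mult_vec_minus_one)
  note iso = isometry_minus_one[OF g(3), folded N_def]
  have isotropic: "herm (N *v v) (N *v w) = 0" for v w
    using iso[of v "N *v w"] by (simp add: NN)
  have skew: "herm (N *v v) w = - herm v (N *v w)" for v w
    using iso[of v w] isotropic[of v w] by (simp add: eq_neg_iff_add_eq_0)
  have "gs *v (gu *v v) = gu *v (gs *v v)" for v
    using g(4,5) by (simp add: matrix_vector_mul_assoc)
  then have gsN: "gs *v (N *v v) = N *v (gs *v v)" for v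
    by (simp add: N_def mult_vec_minus_one mult_vec_algebra)
  have gsgu: "g *v v = gs *v (gu *v v)" for v
    by (simp add: g(4) matrix_vector_mul_assoc)
  obtain v\<^sub>0 where v0: "N *v v\<^sub>0 \<noteq> 0"
    using N1 by (auto simp: N_def mult_vec_minus_one matrix_eq)
  define p\<^sub>0 where "p\<^sub>0 = N *v v\<^sub>0"
  have p0: "p\<^sub>0 \<noteq> 0" "herm p\<^sub>0 p\<^sub>0 = 0"
    using v0 isotropic by (simp_all add: p\<^sub>0_def)
  have Np0: "\<exists>c. N *v w = p\<^sub>0 *\<^sub>H c" for w
    using orthogonal_nonpositive_proportional[OF p0(1), of "N *v w"] p0(2) isotropic
    by (metis order_refl p\<^sub>0_def qRe_simps(1))
  obtain e where gsp0: "gs *v p\<^sub>0 = p\<^sub>0 *\<^sub>H e"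
    using Np0[of "gs *v v\<^sub>0"] by (auto simp: p\<^sub>0_def gsN)
  have gp0: "g *v p\<^sub>0 = p\<^sub>0 *\<^sub>H e"
    by (simp add: gsgu Ngu flip: gsp0) (simp add: p\<^sub>0_def NN)
  have e_real: "e \<in> \<real>"
    by (rule null_eigenvalue_real[OF g(1) sr gp0 p0])
  then have e_comm: "e * c = c * e" for c
    by (auto simp: Reals_def of_real_quat_commute)
  obtain w b where w: "gs *v w = w *\<^sub>H b" "herm p\<^sub>0 w \<noteq> 0"
    using exists_eigenvector_not_orthogonal[OF g(6) p0(1)] by blast
  obtain f where f: "N *v w = p\<^sub>0 *\<^sub>H f"
    using Np0 by blast
  have "herm p\<^sub>0 w = - herm v\<^sub>0 (p\<^sub>0 *\<^sub>H f)"
    unfolding p\<^sub>0_def skew by (simp add: f[unfolded p\<^sub>0_def])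
  then have f0: "f \<noteq> 0"
    using w(2) by auto
  have "p\<^sub>0 *\<^sub>H (e * f) = p\<^sub>0 *\<^sub>H (f * b)"
    using gsN[of w] by (simp add: f w(1) mult_vec_rscale gsp0)
  then have "p\<^sub>0 *\<^sub>H (f * e - f * b) = 0"
    by (simp add: rscale_algebra e_comm)
  then have be: "b = e"
    using p0(1) f0 by simp
  have "qcnj e * herm p\<^sub>0 w * e = herm p\<^sub>0 w"
    using eigenvector_herm[OF g(2) gsp0 w(1)] be by simp
  then have "herm p\<^sub>0 w * (e * e) = herm p\<^sub>0 w * 1"
    using e_real e_comm by (metis mult.assoc mult.right_neutral qcnj_fixed_iff)
  then have "e * e = 1"
    using w(2) by simp
  then have e: "e = 1 \<or> e = -1"
    by (rule quat_square_eq_1)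
  have "\<not> strongly_reversible_in Sp_n1 g"
  proof (rule jordan_block_2_not_reversible[OF g(1) _ _ _ _ _ e])
    show "N *v w \<noteq> 0" "herm (N *v w) (N *v w) = 0"
      using f f0 p0 by simp_all
    show "g *v (N *v w) = (N *v w) *\<^sub>H e"
      by (simp add: f mult_vec_rscale gp0 e_comm)
    show "g *v w = (w + N *v w) *\<^sub>H e"
      by (simp add: gsgu Ngu mult_vec_algebra w(1) be rscale_algebra) (simp add: f mult_vec_rscale gsp0 e_comm)
    show "herm w (N *v w) \<noteq> 0"
      using w(2) f0 herm_eq_0_commute[of w p\<^sub>0] by (simp add: f)
  qed
  with sr show False
    by blast
qed

section \<open>Minimal polynomials of unipotent matrices\<close>

lemma poly_mat_mult_vec: "poly_mat p A *v v = (\<Sum>i\<le>degree p. coeff p i *\<^sub>R (mat_pow A i *v v))"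
proof -
  have "(\<Sum>i\<in>S. f i) *v v = (\<Sum>i\<in>S. f i *v v)" for f :: "nat \<Rightarrow> 'a qmat" and S
    by (induction S rule: infinite_finite_induct) (simp_all add: matrix_vector_mult_add_rdistrib)
  moreover have "(r *\<^sub>R B) *v v = r *\<^sub>R (B *v v)" for r and B :: "'a qmat"
    by (simp add: vec_eq_iff matrix_vector_mult_def scaleR_sum_right)
  ultimately show ?thesis
    by (simp add: poly_mat_def)
qed

lemma poly_mat_mult_vec_bound:
  assumes "degree p \<le> n"
  shows "poly_mat p A *v v = (\<Sum>i\<le>n. coeff p i *\<^sub>R (mat_pow A i *v v))"
  unfolding poly_mat_mult_vec using assms
  by (intro sum.mono_neutral_left) (auto simp: coeff_eq_0)

lemma scaleR_3: "3 *\<^sub>R v = v + v + (v :: 'a :: real_vector)"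
  using scaleR_left_distrib[of 1 2 v] by (simp add: scaleR_2)

lemma poly_mat_square: "poly_mat ([:-1, 1:] ^ 2) A *v v = (A - mat 1) *v ((A - mat 1) *v v)"
proof -
  have "[:-1, 1:] ^ 2 = [:1, -2, 1 :: real:]"
    by (simp add: power2_eq_square)
  then show ?thesis
    by (simp add: poly_mat_mult_vec numeral_2_eq_2 mult_vec_minus_one mult_vec_algebra
        flip: matrix_vector_mul_assoc) (simp add: scaleR_2)
qed

lemma poly_mat_cube: "poly_mat ([:-1, 1:] ^ 3) A *v v = (A - mat 1) *v ((A - mat 1) *v ((A - mat 1) *v v))"
proof -
  have "[:-1, 1:] ^ 3 = [:-1, 3, -3, 1 :: real:]"
    by (simp add: power3_eq_cube)
  then show ?thesis
    by (simp add: poly_mat_mult_vec numeral_3_eq_3 mult_vec_minus_one mult_vec_algebra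
        flip: matrix_vector_mul_assoc) (simp add: scaleR_3)
qed

lemma is_min_poly_cube_iff:
  "is_min_poly A ([:-1, 1:] ^ 3) \<longleftrightarrow>
    (\<forall>v. (A - mat 1) *v ((A - mat 1) *v ((A - mat 1) *v v)) = 0) \<and>
    (\<exists>v. (A - mat 1) *v ((A - mat 1) *v v) \<noteq> 0)" (is "_ \<longleftrightarrow> ?N3 \<and> ?N2")
proof -
  define N where "N = A - mat 1"
  have zero_iff: "B = 0 \<longleftrightarrow> (\<forall>v. B *v v = 0)" for B :: "'a qmat"
    by (simp add: matrix_eq)
  have deg: "degree ([:-1, 1:] ^ 2 :: real poly) = 2" "degree ([:-1, 1:] ^ 3 :: real poly) = 3"
    by (simp_all add: degree_power_eq)
  have lead: "lead_coeff ([:-1, 1:] ^ 3 :: real poly) = 1"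
    by (simp add: lead_coeff_power)
  show ?thesis
  proof
    assume min: "is_min_poly A ([:-1, 1:] ^ 3)"
    have "poly_mat ([:-1, 1:] ^ 2) A \<noteq> 0"
    proof
      assume "poly_mat ([:-1, 1:] ^ 2) A = 0"
      moreover have "[:-1, 1:] ^ 2 \<noteq> (0 :: real poly)"
        by simp
      ultimately have "degree ([:-1, 1:] ^ 3 :: real poly) \<le> degree ([:-1, 1:] ^ 2 :: real poly)"
        using min unfolding is_min_poly_def by blast
      then show False
        by (simp add: deg)
    qed
    with min show "?N3 \<and> ?N2"
      unfolding is_min_poly_def zero_iff poly_mat_square poly_mat_cube by blast
  next
    assume *: "?N3 \<and> ?N2"
    then obtain v where v: "N *v (N *v v) \<noteq> 0"
      by (auto simp: N_def)
    define y where "y = N *v v"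
    define p where "p = N *v y"
    have "N *v p = 0"
      using * by (simp add: N_def p_def y_def)
    then have A: "A *v p = p" "A *v y = y + p" "A *v v = v + y"
      by (simp_all add: N_def y_def p_def mult_vec_minus_one)
    have p: "p \<noteq> 0"
      using v by (simp add: p_def y_def)
    have "3 \<le> degree q" if q: "q \<noteq> 0" "poly_mat q A = 0" for q
    proof (rule ccontr)
      assume "\<not> 3 \<le> degree q"
      then have "degree q \<le> 2"
        by simp
      define c where "c = coeff q"
      have e: "c 0 *\<^sub>R w + c 1 *\<^sub>R (A *v w) + c 2 *\<^sub>R (A *v (A *v w)) = 0" for w
        using poly_mat_mult_vec_bound[OF \<open>degree q \<le> 2\<close>, of A w] q(2)
        by (simp add: c_def numeral_2_eq_2 flip: matrix_vector_mul_assoc)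
      \<comment> \<open>Evaluation on \<open>p\<close>, \<open>y\<close>, \<open>v\<close> gives a
        triangular system: the value of \<open>q\<close> at 1, then its derivative at 1, then its
        quadratic coefficient must vanish.\<close>
      have "(c 0 + c 1 + c 2) *\<^sub>R p = 0"
        using e[of p] by (simp add: A scaleR_left_distrib)
      then have 0: "c 0 + c 1 + c 2 = 0"
        using p by simp
      have "(c 0 + c 1 + c 2) *\<^sub>R y + (c 1 + 2 * c 2) *\<^sub>R p = 0"
        using e[of y] by (simp add: A mult_vec_algebra scaleR_left_distrib scaleR_right_distrib
            scaleR_2 algebra_simps flip: scaleR_scaleR)
      then have 1: "c 1 + 2 * c 2 = 0"
        using p 0 by simp
      have "(c 0 + c 1 + c 2) *\<^sub>R v + (c 1 + 2 * c 2) *\<^sub>R y + c 2 *\<^sub>R p = 0"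
        using e[of v] by (simp add: A mult_vec_algebra scaleR_left_distrib scaleR_right_distrib
            scaleR_2 algebra_simps flip: scaleR_scaleR)
      then have "c 2 = 0"
        using p 0 1 by simp
      with 0 1 have "c i = 0" if "i \<le> 2" for i
        using that by (auto simp: le_Suc_eq numeral_2_eq_2)
      then have "lead_coeff q = 0"
        using \<open>degree q \<le> 2\<close> by (simp add: c_def)
      with q(1) show False
        by simp
    qed
    moreover have "poly_mat ([:-1, 1:] ^ 3) A = 0"
      unfolding zero_iff poly_mat_cube using * by blast
    ultimately show "is_min_poly A ([:-1, 1:] ^ 3)"
      unfolding is_min_poly_def deg(2) using lead deg(2) by auto
  qed
qed

section \<open>Fixed points\<close>

lemma proj_pt_rscale: "c \<noteq> 0 \<Longrightarrow> proj_pt (v *\<^sub>H c) = proj_pt v"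
  unfolding proj_pt_def
proof (intro set_eqI iffI; clarsimp)
  fix a :: quat assume "c \<noteq> 0" "a \<noteq> 0"
  then show "\<exists>b. v *\<^sub>H (c * a) = v *\<^sub>H b \<and> b \<noteq> 0"
    by (intro exI[of _ "c * a"]) simp
  from \<open>c \<noteq> 0\<close> \<open>a \<noteq> 0\<close> show "\<exists>b. v *\<^sub>H a = v *\<^sub>H (c * b) \<and> b \<noteq> 0"
    by (intro exI[of _ "inverse c * a"]) (simp flip: mult.assoc)
qed

lemma mem_proj_pt: "v \<in> proj_pt v"
  by (auto simp: proj_pt_def intro!: exI[of _ 1])

lemma fixed_proj_pt_iff:
  assumes "g \<in> Sp_n1" "v \<noteq> 0"
  shows "(\<lambda>w. g *v w) ` proj_pt v = proj_pt v \<longleftrightarrow> (\<exists>a. g *v v = v *\<^sub>H a)"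
proof
  assume "(\<lambda>w. g *v w) ` proj_pt v = proj_pt v"
  then have "g *v v \<in> proj_pt v"
    using mem_proj_pt by blast
  then show "\<exists>a. g *v v = v *\<^sub>H a"
    by (auto simp: proj_pt_def)
next
  assume "\<exists>a. g *v v = v *\<^sub>H a"
  then obtain a where a: "g *v v = v *\<^sub>H a" "a \<noteq> 0"
    using eigenvalue_nonzero[OF assms(1) _ assms(2)] by blast
  have "(\<lambda>w. g *v w) ` proj_pt v = proj_pt (g *v v)"
    by (auto simp: proj_pt_def mult_vec_rscale image_iff) (metis mult_vec_rscale)
  with a show "(\<lambda>w. g *v w) ` proj_pt v = proj_pt v"
    by (simp add: proj_pt_rscale)
qed

lemma fixed_pts_hyp_space_iff:
  assumes "g \<in> Sp_n1"
  shows "fixed_pts g hyp_space \<noteq> {} \<longleftrightarrow> (\<exists>v a. qRe (herm v v) < 0 \<and> g *v v = v *\<^sub>H a)"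
proof -
  have "v \<noteq> 0" if "qRe (herm v v) < 0" for v :: "'a qvec"
    using that by auto
  then show ?thesis
    using fixed_proj_pt_iff[OF assms] by (fastforce simp: fixed_pts_def hyp_space_def V_neg_def)
qed

lemma fixed_pts_hyp_boundary:
  assumes "g \<in> Sp_n1"
  shows "fixed_pts g hyp_boundary = {proj_pt v |v. v \<noteq> 0 \<and> herm v v = 0 \<and> (\<exists>a. g *v v = v *\<^sub>H a)}"
  using fixed_proj_pt_iff[OF assms]
  by (auto simp: fixed_pts_def hyp_boundary_def V_null_def herm_self_eq_0_iff)

section \<open>Null eigenvectors of parabolic isometries\<close>

lemma parabolic_null_eigenvector:
  assumes "parabolic g"
  obtains p c where "p \<noteq> 0" "herm p p = 0" "g *v p = p *\<^sub>H c"
proof -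
  have "g \<in> Sp_n1" "fixed_pts g hyp_boundary \<noteq> {}"
    using assms by (auto simp: parabolic_def)
  with that show ?thesis
    by (auto simp: fixed_pts_hyp_boundary)
qed

lemma parabolic_null_eigenvectors_proportional:
  assumes "parabolic g" "p \<noteq> 0" "herm p p = 0" "g *v p = p *\<^sub>H a"
    "q \<noteq> 0" "herm q q = 0" "g *v q = q *\<^sub>H b"
  obtains c where "q = p *\<^sub>H c"
proof -
  have g: "g \<in> Sp_n1" "card (fixed_pts g hyp_boundary) = 1"
    using assms(1) by (auto simp: parabolic_def)
  have "proj_pt p \<in> fixed_pts g hyp_boundary" "proj_pt q \<in> fixed_pts g hyp_boundary"
    using assms by (auto simp: fixed_pts_hyp_boundary[OF g(1)])
  then have "proj_pt p = proj_pt q"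
    using g(2) by (auto simp: card_1_singleton_iff)
  then have "q \<in> proj_pt p"
    using mem_proj_pt by simp
  with that show ?thesis
    by (auto simp: proj_pt_def)
qed

text \<open>Taking norms in the invariance relation multiplies the norm of \<open>herm v w\<close>
  by a factor different from 1.\<close>

lemma eigenvector_herm_eq_0_if_not_unit:
  assumes "g \<in> Sp_n1" "g *v v = v *\<^sub>H a" "g *v w = w *\<^sub>H a" "qnormsq a \<noteq> 1"
  shows "herm v w = 0"
proof -
  have "qnormsq (herm v w) = (qnormsq a)\<^sup>2 * qnormsq (herm v w)"
    using arg_cong[OF eigenvector_herm[OF assms(1-3)], of qnormsq]
    by (simp add: qnormsq_mult power2_eq_square mult.commute mult.left_commute)
  moreover have "qnormsq a \<noteq> -1"
    using qnormsq_ge_0[of a] by linarith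
  then have "(qnormsq a)\<^sup>2 \<noteq> 1"
    using assms(4) by (simp add: power2_eq_1_iff)
  ultimately show ?thesis
    by simp
qed

text \<open>If the pairing \<open>h\<close> were nonzero, moving \<open>u\<close> along
  \<open>p\<close> by a coefficient commuting with \<open>c\<close> would stay among eigenvectors
  and reach a negative one, that is, a fixed point in hyperbolic space. The number \<open>k\<close>
  makes the norm exactly \<open>-1\<close>.\<close>

lemma parabolic_null_eigenvector_orthogonal:
  assumes g: "parabolic g" and p: "herm p p = 0" "g *v p = p *\<^sub>H c" and u: "g *v u = u *\<^sub>H c"
  shows "herm p u = 0"
proof (rule ccontr)
  have Sp: "g \<in> Sp_n1"
    using g by (simp add: parabolic_def)
  define h where "h = herm p u"
  assume "herm p u \<noteq> 0"
  then have h: "h \<noteq> 0" "qnormsq c = 1"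
    using eigenvector_herm_eq_0_if_not_unit[OF Sp p(2) u] by (auto simp: h_def)
  have ch: "c * h = h * c"
    unfolding h_def by (rule eigenvector_herm_commute[OF Sp p(2) u h(2)])
  define k where "k = (qRe (herm u u) + 1) / (2 * qnormsq h)"
  define z where "z = u - p *\<^sub>H (k *\<^sub>R h)"
  have gz: "g *v z = z *\<^sub>H c"
    using ch by (simp add: z_def mult_vec_algebra p(2) u rscale_algebra)
  have "herm z z = herm u u - k *\<^sub>R (qcnj h * h) - k *\<^sub>R (qcnj h * h)"
    by (simp add: z_def p(1) h_def herm_commute[of u p])
  then have "qRe (herm z z) = qRe (herm u u) - 2 * k * qnormsq h"
    by (simp add: qcnj_mult_self_qnormsq)
  also have "\<dots> = -1"
    using h(1) by (simp add: k_def field_simps)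
  finally have "fixed_pts g hyp_space \<noteq> {}"
    unfolding fixed_pts_hyp_space_iff[OF Sp] using gz by (intro exI[of _ z] exI[of _ c]) simp
  with g show False
    by (simp add: parabolic_def)
qed

lemma parabolic_null_type:
  assumes "parabolic g" "p \<noteq> 0" "herm p p = 0" "g *v p = p *\<^sub>H c"
  shows "null_type g c"
  unfolding null_type_def eigenvalue_def degenerate_on_def eigenspace_def
  using assms parabolic_null_eigenvector_orthogonal by blast

section \<open>The classes of isometries\<close>

lemma hyperbolic_strongly_reversible:
  assumes "hyperbolic g" and null: "\<And>a. null_type g a \<Longrightarrow> a \<in> \<real>"
    and even: "\<And>a. positive_type g a \<Longrightarrow>
      sim_class a = {1} \<or> sim_class a = {-1} \<or> even (class_multiplicity g a)"
  shows "strongly_reversible_in Sp_n1 g"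
proof -
  have g: "g \<in> Sp_n1" "fixed_pts g hyp_space = {}" "card (fixed_pts g hyp_boundary) = 2"
    using assms(1) by (auto simp: hyperbolic_def)
  then obtain P Q where "fixed_pts g hyp_boundary = {P, Q}" "P \<noteq> Q"
    by (auto simp: card_2_iff)
  then have "P \<in> fixed_pts g hyp_boundary" "Q \<in> fixed_pts g hyp_boundary"
    by auto
  then obtain v w\<^sub>0 a b\<^sub>0 where v: "P = proj_pt v" "v \<noteq> 0" "herm v v = 0" "g *v v = v *\<^sub>H a"
    and w0: "Q = proj_pt w\<^sub>0" "w\<^sub>0 \<noteq> 0" "herm w\<^sub>0 w\<^sub>0 = 0" "g *v w\<^sub>0 = w\<^sub>0 *\<^sub>H b\<^sub>0"
    by (auto simp: fixed_pts_hyp_boundary[OF g(1)])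
  have h0: "herm v w\<^sub>0 \<noteq> 0"
  proof
    assume "herm v w\<^sub>0 = 0"
    then obtain c where "w\<^sub>0 = v *\<^sub>H c"
      using orthogonal_nonpositive_proportional[OF v(2)] v(3) w0(3) by (metis order_refl qRe_simps(1))
    moreover from this have "c \<noteq> 0"
      using w0(2) by auto
    ultimately show False
      using v(1) w0(1) \<open>P \<noteq> Q\<close> by (simp add: proj_pt_rscale)
  qed
  \<comment> \<open>Rescaling normalizes the pairing to \<open>herm v w = 1\<close> and replaces the
    eigenvalue by a conjugate.\<close>
  define w where "w = w\<^sub>0 *\<^sub>H inverse (herm v w\<^sub>0)"
  define b where "b = herm v w\<^sub>0 * b\<^sub>0 * inverse (herm v w\<^sub>0)"
  have w: "herm w w = 0" "g *v w = w *\<^sub>H b" "herm v w = 1" "herm w v = 1"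
    using h0 w0(3,4) herm_commute[of w v]
    by (simp_all add: w_def b_def mult_vec_rscale flip: mult.assoc)
  have ab: "qcnj a * b = 1"
    using eigenvector_herm[OF g(1) v(4) w(2)] by (simp add: w(3))
  have nofix: "\<not> qRe (herm z z) < 0" if "g *v z = z *\<^sub>H c" for z c
    using g(1,2) fixed_pts_hyp_space_iff[of g] that by blast
  \<comment> \<open>For a unit \<open>a\<close> both eigenvalues would agree, and
    \<open>v - w\<close> would be a negative eigenvector. For a non-unit \<open>a\<close> the
    eigenspace is totally isotropic, so \<open>a\<close> is a null eigenvalue and hence
    real.\<close>
  have a1: "qnormsq a \<noteq> 1"
  proof
    assume "qnormsq a = 1"
    then have "a * (qcnj a * b) = b"
      by (simp add: qcnj_unit flip: mult.assoc)
    then have "a = b"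
      by (simp add: ab)
    then have "g *v (v - w) = (v - w) *\<^sub>H a"
      by (simp add: mult_vec_algebra v(4) w(2) rscale_algebra)
    then show False
      using nofix[of "v - w" a] v(3) w by simp
  qed
  have "null_type g a"
    unfolding null_type_def eigenvalue_def degenerate_on_def eigenspace_def
    using v(2,4) eigenvector_herm_eq_0_if_not_unit[OF g(1) v(4) _ a1] by blast
  then have a: "a \<in> \<real>"
    by (rule null)
  then have ca: "qcnj a = a" and a_comm: "a * q = q * a" for q
    by (auto simp: qcnj_fixed_iff Reals_def of_real_quat_commute)
  have ab1: "a * b = 1" "b * a = 1"
    using ab by (simp_all add: ca flip: a_comm)
  \<comment> \<open>The reflection in \<open>v - w\<close> exchanges \<open>v\<close> and
    \<open>w\<close>, whose eigenvalues are mutually inverse. The same negative vector later shows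
    that the complement is positive definite.\<close>
  have "qRe (herm (v - w) (v - w)) = -2"
    by (simp add: v(3) w)
  then obtain x where x: "x \<in> Sp_n1" "x ** x = mat 1"
    "\<And>z. x *v z = z - (v - w) *\<^sub>H ((2 / - 2) *\<^sub>R herm (v - w) z)"
    by (rule exists_reflection) auto
  have xv: "x *v v = w" and xw: "x *v w = v"
    by (simp_all add: x(3) v(3) w rscale_scaleR)
  have mem: "v \<in> hspan {v, w}" "w \<in> hspan {v, w}"
    using hspan_superset by blast+
  have "reversed_on g (hspan {v, w})"
  proof (rule reversed_on_hspanI[where x = x])
    show "\<exists>a\<in>hspan {v, w}. z - a \<in> orthc {v, w}" for z
      by (intro bexI[of _ "v *\<^sub>H herm w z + w *\<^sub>H herm v z"] hsubspaceD[OF hsubspace_hspan] mem)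
        (auto simp: orthc_def v(3) w)
    show "g *v z \<in> hspan {v, w}" if "z \<in> {v, w}" for z
      using that mem by (auto simp: v(4) w(2) intro!: hsubspaceD[OF hsubspace_hspan])
    show "x *v z = z" if "z \<in> orthc {v, w}" for z
      using that by (simp add: x(3) orthc_def)
    show "x *v (g *v (x *v (g *v z))) = z" if "z \<in> {v, w}" for z
      using that by (auto simp: v(4) w(2) mult_vec_rscale xv xw ab1)
  qed (use x in auto)
  then show ?thesis
  proof (rule strongly_reversible_if_reversed_on[OF g(1) _ _ _ even])
    have neg: "qRe (herm (v - w) (v - w)) < 0"
      by (simp add: v(3) w)
    show "orthc (hspan {v, w}) - {0} \<subseteq> V_pos"
      unfolding orthc_hspan V_pos_def
      by (auto intro!: orthogonal_to_negative_pos[OF neg] simp: orthc_def)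
    show "eigenspace g c \<subseteq> orthc (hspan {v, w})" if c: "c \<notin> \<real>" for c
    proof
      fix u assume "u \<in> eigenspace g c"
      then have u: "g *v u = u *\<^sub>H c"
        by (simp add: eigenspace_def)
      have b: "b \<in> \<real>"
        using ab1(1) a by (metis inverse_unique Reals_inverse_iff)
      have 0: "herm z u = 0" if z: "g *v z = z *\<^sub>H e" and e: "e \<in> \<real>" "e * f = 1" for z e f
      proof (rule ccontr)
        assume "herm z u \<noteq> 0"
        moreover have "herm z u * (e * c) = herm z u * 1"
          using eigenvector_herm[OF g(1) z u] e(1)
          by (auto simp: Reals_def of_real_quat_commute mult.assoc)
        ultimately have "e * c = 1"
          by simp
        then have "c = inverse e"
          by (metis inverse_unique)
        with c e(1) show False
          by simp
      qed
      show "u \<in> orthc (hspan {v, w})"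
        unfolding orthc_hspan using 0[OF v(4) a ab1(1)] 0[OF w(2) b ab1(2)] by (simp add: orthc_def)
    qed
  qed
qed

text \<open>Suppose the eigenspace contains no positive vector. The component of an eigenvector
  orthogonal to \<open>v\<close> stays in the eigenspace and would be positive unless zero, so every
  eigenvector is a multiple of \<open>v\<close> and therefore negative.\<close>

lemma negative_eigenvector_type:
  assumes g: "g \<in> Sp_n1" and v: "g *v v = v *\<^sub>H a" "qRe (herm v v) < 0"
  shows "negative_type g a \<or> indefinite_type g a"
proof (cases "eigenspace g a \<inter> V_pos = {}")
  case False
  have "v \<in> eigenspace g a \<inter> V_neg" "v \<noteq> 0"
    using v by (auto simp: eigenspace_def V_neg_def)
  with False v show ?thesis
    unfolding indefinite_type_def eigenvalue_def by blast
next
  case True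
  have vv: "herm v v \<noteq> 0" "v \<noteq> 0"
    using v(2) by auto
  have a: "qnormsq a = 1"
    by (rule eigenvalue_nonnull_unit[OF g v(1) vv(1)])
  have "u \<in> V_neg" if u: "u \<in> eigenspace g a" "u \<noteq> 0" for u
  proof -
    define d where "d = qRe (herm v v)"
    have d: "herm v v = of_real d" "d < 0"
      using herm_self_real[of v] v(2) by (simp_all add: d_def)
    define c where "c = (1 / d) *\<^sub>R herm v u"
    have "a * c = c * a"
      using eigenvector_herm_commute[OF g v(1) _ a, of u] u(1) by (simp add: c_def eigenspace_def)
    then have z: "u - v *\<^sub>H c \<in> eigenspace g a"
      using u(1) v(1) by (intro eigenspace_closed) (auto simp: eigenspace_def)
    have orth: "herm v (u - v *\<^sub>H c) = 0"
      using d by (simp add: c_def of_real_def)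
    have "u - v *\<^sub>H c = 0"
    proof (rule ccontr)
      assume "u - v *\<^sub>H c \<noteq> 0"
      then have "u - v *\<^sub>H c \<in> V_pos"
        unfolding V_pos_def mem_Collect_eq by (rule orthogonal_to_negative_pos[OF v(2) orth])
      with z True show False
        by blast
    qed
    then have u_eq: "u = v *\<^sub>H c"
      by simp
    then have "c \<noteq> 0"
      using u(2) by auto
    then show ?thesis
      using v(2) qnormsq_pos[of c] by (simp only: u_eq V_neg_def mem_Collect_eq qRe_herm_rscale)
        (simp add: mult_pos_neg)
  qed
  with v(1) vv(2) show ?thesis
    unfolding negative_type_def eigenvalue_def by blast
qed

lemma elliptic_strongly_reversible:
  assumes "elliptic g" and neg: "\<And>a. negative_type g a \<or> indefinite_type g a \<Longrightarrow> a = 1 \<or> a = -1"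
    and even: "\<And>a. positive_type g a \<Longrightarrow>
      sim_class a = {1} \<or> sim_class a = {-1} \<or> even (class_multiplicity g a)"
  shows "strongly_reversible_in Sp_n1 g"
proof -
  have g: "g \<in> Sp_n1" "fixed_pts g hyp_space \<noteq> {}"
    using assms(1) by (auto simp: elliptic_def)
  then obtain v a where v: "qRe (herm v v) < 0" "g *v v = v *\<^sub>H a"
    by (auto simp: fixed_pts_hyp_space_iff)
  have a: "a = 1 \<or> a = -1"
    using neg negative_eigenvector_type[OF g(1) v(2,1)] .
  have "reversed_on g (hspan {v})"
    using v by (intro reversed_on_line[OF _ v(2) a]) auto
  then show ?thesis
  proof (rule strongly_reversible_if_reversed_on[OF g(1) _ _ _ even])
    show "orthc (hspan {v}) - {0} \<subseteq> V_pos"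
      unfolding orthc_hspan V_pos_def
      by (auto intro!: orthogonal_to_negative_pos[OF v(1)] simp: orthc_def)
    show "eigenspace g c \<subseteq> orthc (hspan {v})" if c: "c \<notin> \<real>" for c
    proof
      fix u assume "u \<in> eigenspace g c"
      then have "qcnj a * herm v u * c = herm v u"
        by (intro eigenvector_herm[OF g(1) v(2)]) (simp add: eigenspace_def)
      then have "herm v u = a * herm v u * c"
        using a by auto
      then have "herm v u = 0"
        by (rule eq_0_if_real_conjugation_fixes[OF a c])
      then show "u \<in> orthc (hspan {v})"
        unfolding orthc_hspan by (simp add: orthc_def)
    qed
  qed
qed

section \<open>Translations\<close>

lemma semisimple_mat_1: "semisimple (mat 1)"
proof -
  have "{v. \<exists>a. v \<in> eigenspace (mat 1) a} = UNIV"
    by (auto simp: eigenspace_def intro!: exI[of _ 1])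
  then show ?thesis
    using hspan_superset[of UNIV] by (auto simp: semisimple_def)
qed

text \<open>A translation is its own unipotent part, so the results on Jordan blocks apply with
  \<open>gs = mat 1\<close> and \<open>gu = g\<close>.\<close>

lemma vertical_translation_not_strongly_reversible:
  assumes "vertical_translation g"
  shows "\<not> strongly_reversible_in Sp_n1 g"
proof -
  have g: "g \<in> Sp_n1" "g \<noteq> mat 1" "poly_mat ([:-1, 1:] ^ 2) g = 0"
    using assms by (auto simp: vertical_translation_def parabolic_def is_min_poly_def)
  show ?thesis
    using g poly_mat_square[of g]
    by (intro square_zero_part_not_reversible[OF g(1) mat_1_in_Sp_n1 g(1) _ _ semisimple_mat_1]) auto
qed

lemma nonvertical_translation_strongly_reversible:
  assumes "nonvertical_translation g"
  shows "strongly_reversible_in Sp_n1 g"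
proof -
  have g: "g \<in> Sp_n1" "is_min_poly g ([:-1, 1:] ^ 3)"
    using assms by (auto simp: nonvertical_translation_def parabolic_def)
  then obtain v where N: "\<And>v. (g - mat 1) *v ((g - mat 1) *v ((g - mat 1) *v v)) = 0"
    "(g - mat 1) *v ((g - mat 1) *v v) \<noteq> 0"
    by (auto simp: is_min_poly_cube_iff)
  \<comment> \<open>On an eigenvector \<open>(g - mat 1)^3\<close> acts by \<open>(c - 1)^3\<close>,
    so 1 is the only eigenvalue and the conditions on null and positive eigenvalues hold
    automatically.\<close>
  have eigen: "c = 1" if "g *v p = p *\<^sub>H c" "p \<noteq> 0" for p c
  proof -
    have "(g - mat 1) *v (p *\<^sub>H d) = p *\<^sub>H ((c - 1) * d)" for d
      by (simp add: mult_vec_minus_one mult_vec_rscale that(1) left_diff_distrib rscale_algebra)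
    from this[of 1] this have "p *\<^sub>H ((c - 1) * ((c - 1) * (c - 1))) = 0"
      using N(1)[of p] by simp
    then show ?thesis
      using that(2) by simp
  qed
  show ?thesis
  proof (rule jordan_block_3_strongly_reversible[OF g(1) mat_1_in_Sp_n1 g(1) _ _ semisimple_mat_1 N])
    show "c = 1 \<or> c = -1" if "p \<noteq> 0" "g *v p = p *\<^sub>H c" for p c
      using eigen that by blast
    show "sim_class a = {1} \<or> sim_class a = {-1} \<or> even (class_multiplicity g a)"
      if "positive_type g a" for a
    proof -
      have "a = 1"
        using that eigen by (auto simp: positive_type_def eigenvalue_def)
      then show ?thesis
        using sim_class_real[of a] by simp
    qed
  qed auto
qed

text \<open>The involution maps the unique fixed boundary point to a fixed boundary point, so
  \<open>x p = p c\<close>. Comparing eigenvalues on this line, where the real number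
  \<open>a\<close> commutes with \<open>c\<close>, gives \<open>a = inverse a\<close>.\<close>

lemma parabolic_null_eigenvalue:
  assumes "parabolic g" "strongly_reversible_in Sp_n1 g"
    and p: "p \<noteq> 0" "herm p p = 0" "g *v p = p *\<^sub>H a"
  shows "a = 1 \<or> a = -1"
proof -
  have g: "g \<in> Sp_n1"
    using assms(1) by (simp add: parabolic_def)
  have "a \<in> \<real>"
    by (rule null_eigenvalue_real[OF g assms(2) p(3,1,2)])
  then have a_comm: "a * q = q * a" for q
    by (auto simp: Reals_def of_real_quat_commute)
  obtain x where x: "x \<in> Sp_n1" "\<And>v. x *v (x *v v) = v" "\<And>v. g *v (x *v (g *v v)) = x *v v"
    by (rule strongly_reversibleE[OF assms(2) g]) blast
  have a0: "a \<noteq> 0"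
    by (rule eigenvalue_nonzero[OF g p(3,1)])
  have gx: "g *v (x *v p) = (x *v p) *\<^sub>H inverse a"
    by (rule reversing_eigenvector[OF x(3) p(3) a0])
  have xp: "x *v p \<noteq> 0" "herm (x *v p) (x *v p) = 0"
    using p(1,2) by (simp_all add: Sp_n1_mult_vec_eq_0_iff[OF x(1)] Sp_n1_herm[OF x(1)])
  obtain c where c: "x *v p = p *\<^sub>H c"
    by (rule parabolic_null_eigenvectors_proportional[OF assms(1) p xp gx])
  have "c \<noteq> 0"
    using c xp(1) by auto
  have "p *\<^sub>H (a * c) = p *\<^sub>H (c * inverse a)"
    using gx by (simp add: c mult_vec_rscale p(3))
  then have "p *\<^sub>H (c * a - c * inverse a) = 0"
    by (simp add: rscale_algebra a_comm)
  then have "a = inverse a"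
    using p(1) \<open>c \<noteq> 0\<close> by simp
  then have "a * a = 1"
    using a0 by (metis right_inverse)
  then show ?thesis
    by (rule quat_square_eq_1)
qed

lemma parabolic_iff_strongly_reversible:
  assumes par: "parabolic g" and jd: "jordan_decomposition g gs gu"
  shows "strongly_reversible_in Sp_n1 g \<longleftrightarrow>
    (\<forall>a. null_type g a \<longrightarrow> a = 1 \<or> a = -1) \<and> is_min_poly gu ([:-1, 1:] ^ 3) \<and>
    (\<forall>a. positive_type g a \<longrightarrow>
      sim_class a = {1} \<or> sim_class a = {-1} \<or> even (class_multiplicity g a))" (is "?L \<longleftrightarrow> ?R")
proof
  have g: "g \<in> Sp_n1" "gs \<in> Sp_n1" "gu \<in> Sp_n1" "g = gs ** gu" "g = gu ** gs" "semisimple gs"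
    and uni: "unipotent gu"
    using par jd by (auto simp: parabolic_def jordan_decomposition_def)
  {
    assume ?L
    have null: "a = 1 \<or> a = -1" if "null_type g a" for a
      using that parabolic_null_eigenvalue[OF par \<open>?L\<close>] by (metis null_typeE)
    \<comment> \<open>Otherwise \<open>g\<close> is semisimple and has an eigenvector
      \<open>w\<close> not orthogonal to \<open>p\<close>; since \<open>c\<close> is a sign,
      \<open>w\<close> has the same eigenvalue, against
      \<open>parabolic_null_eigenvector_orthogonal\<close>.\<close>
    have "gu \<noteq> mat 1"
    proof
      assume "gu = mat 1"
      then have ss: "semisimple g"
        using g(4,6) by simp
      obtain p c where p: "p \<noteq> 0" "herm p p = 0" "g *v p = p *\<^sub>H c"
        by (rule parabolic_null_eigenvector[OF par])
      obtain w b where w: "g *v w = w *\<^sub>H b" "herm p w \<noteq> 0"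
        using exists_eigenvector_not_orthogonal[OF ss p(1)] by blast
      have c: "c = 1 \<or> c = -1"
        by (rule null[OF parabolic_null_type[OF par p]])
      then have "c * herm p w = herm p w * b"
        by (intro eigenvector_herm_commute[OF g(1) p(3) w(1)]) auto
      moreover have "c * herm p w = herm p w * c"
        using c by auto
      ultimately have "b = c"
        using w(2) by (metis mult_left_cancel)
      then show False
        using parabolic_null_eigenvector_orthogonal[OF par p(2,3)] w by blast
    qed
    then obtain v where "(gu - mat 1) *v ((gu - mat 1) *v v) \<noteq> 0"
      using square_zero_part_not_reversible[OF g] \<open>?L\<close> by blast
    then have "is_min_poly gu ([:-1, 1:] ^ 3)"
      using unipotent_cube_eq_0[OF g(3) uni] by (auto simp: is_min_poly_cube_iff)
    with null positive_classes_of_strongly_reversible[OF g(1) \<open>?L\<close>] show ?R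
      by blast
  }
  assume ?R
  then obtain v where N: "\<And>v. (gu - mat 1) *v ((gu - mat 1) *v ((gu - mat 1) *v v)) = 0"
    "(gu - mat 1) *v ((gu - mat 1) *v v) \<noteq> 0"
    by (auto simp: is_min_poly_cube_iff)
  show ?L
    using \<open>?R\<close> parabolic_null_type[OF par]
    by (intro jordan_block_3_strongly_reversible[OF g N]) blast+
qed

lemma hyperbolic_iff_strongly_reversible:
  assumes "hyperbolic g"
  shows "strongly_reversible_in Sp_n1 g \<longleftrightarrow>
    (\<forall>a. positive_type g a \<longrightarrow>
      sim_class a = {1} \<or> sim_class a = {-1} \<or> even (class_multiplicity g a)) \<and>
    (\<forall>a. null_type g a \<longrightarrow> a \<in> \<real>)"
proof -
  have "g \<in> Sp_n1"
    using assms by (simp add: hyperbolic_def)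
  then show ?thesis
    using positive_classes_of_strongly_reversible hyperbolic_strongly_reversible[OF assms]
      null_eigenvalue_real null_typeE by metis
qed

lemma elliptic_iff_strongly_reversible:
  assumes "elliptic g"
  shows "strongly_reversible_in Sp_n1 g \<longleftrightarrow>
    (\<forall>a. negative_type g a \<or> indefinite_type g a \<longrightarrow> a = 1 \<or> a = -1) \<and>
    (\<forall>a. positive_type g a \<longrightarrow>
      sim_class a = {1} \<or> sim_class a = {-1} \<or> even (class_multiplicity g a))"
proof -
  have g: "g \<in> Sp_n1"
    using assms by (simp add: elliptic_def)
  have "\<exists>v. g *v v = v *\<^sub>H a \<and> qRe (herm v v) < 0" if "negative_type g a \<or> indefinite_type g a" for a
    using that by (auto simp: negative_type_def indefinite_type_def eigenvalue_def eigenspace_def V_neg_def)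
  then show ?thesis
    using positive_classes_of_strongly_reversible[OF g] elliptic_strongly_reversible[OF assms]
      negative_eigenvalue_of_strongly_reversible[OF g] by metis
qed

theorem theorem1p4:
  fixes g :: "('m::{finite,zero}) qmat"
  assumes "g \<in> Sp_n1"
  shows
    "(hyperbolic g \<longrightarrow>
        (strongly_reversible_in Sp_n1 g \<longleftrightarrow>
          (\<forall>a. positive_type g a \<longrightarrow>
            sim_class a = {1} \<or> sim_class a = {-1} \<or> even (class_multiplicity g a)) \<and>
          (\<forall>a. null_type g a \<longrightarrow> a \<in> \<real>))) \<and>
     (elliptic g \<longrightarrow>
        (strongly_reversible_in Sp_n1 g \<longleftrightarrow>
          (\<forall>a. negative_type g a \<or> indefinite_type g a \<longrightarrow> a = 1 \<or> a = -1) \<and>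
          (\<forall>a. positive_type g a \<longrightarrow>
            sim_class a = {1} \<or> sim_class a = {-1} \<or> even (class_multiplicity g a)))) \<and>
     (vertical_translation g \<longrightarrow> \<not> strongly_reversible_in Sp_n1 g) \<and>
     (nonvertical_translation g \<longrightarrow> strongly_reversible_in Sp_n1 g) \<and>
     (\<forall>gs gu. parabolic g \<and> \<not> unipotent g \<and> jordan_decomposition g gs gu \<longrightarrow>
        (strongly_reversible_in Sp_n1 g \<longleftrightarrow>
          (\<forall>a. null_type g a \<longrightarrow> a = 1 \<or> a = -1) \<and>
          is_min_poly gu ([:-1, 1:] ^ 3) \<and>
          (\<forall>a. positive_type g a \<longrightarrow>
            sim_class a = {1} \<or> sim_class a = {-1} \<or> even (class_multiplicity g a))))"
  by (intro conjI allI impI hyperbolic_iff_strongly_reversible elliptic_iff_strongly_reversible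
      vertical_translation_not_strongly_reversible nonvertical_translation_strongly_reversible
      parabolic_iff_strongly_reversible) blast+

end
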